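(* Let $\Omega\subset\mathbb{R}^N$, $N\ge1$, be a bounded open set and let $a:\Omega\times\mathbb{R}\times\mathbb{R}^N\to\mathbb{R}^N$ be a Carathéodory function satisfying $|a(x,s,\xi)|\leq\beta(1+|\xi|)$ for some $\beta>0$, for all $(s,\xi)\in\mathbb{R}\times\mathbb{R}^N$ and a.e. $x\in\Omega$. Let $p>2$, $\lambda\in\mathbb{R}$, and let $f\in L^q(\Omega)$ for some $q\ge1$ with $q>\frac Np$. Let $u\in W^{1,p}_0(\Omega)$ be a subsolution, in the sense of distributions, of $$-\operatorname{div}(a(x,u,\nabla u))+\lambda u+|\nabla u|^p\leq f(x)\qquad\text{in }\Omega.$$ Then $u\in L^\infty(\Omega)$, and $$\|u\|_{L^\infty(\Omega)}\leq C(\beta,p,N,q,\lambda,\|f\|_{L^q(\Omega)},|\Omega|),$$ where the constant $C$ depends only on the quantities indicated.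
   Context: Carathéodory function: measurable in $x$ for every fixed $(s,\xi)$ and continuous in $(s,\xi)$ for a.e. $x$. $|\Omega|$ is the Lebesgue measure of $\Omega$. Subsolution in the sense of distributions means that for every $\varphi\in C^\infty_0(\Omega)$ (smooth, compactly supported) with $\varphi\ge0$, $$\int_\Omega a(x,u,\nabla u)\cdot\nabla\varphi\,dx+\lambda\int_\Omega u\,\varphi\,dx+\int_\Omega|\nabla u|^p\varphi\,dx\leq\int_\Omega f\varphi\,dx.$$ *)

theory Defs
  imports "HOL-Analysis.Analysis" "HOL-Probability.Essential_Supremum"
begin

text \<open>
  Functions on an open set \<open>\<Omega>\<close> are total functions on \<open>real ^ 'n\<close>, where \<open>N = CARD('n)\<close>. Only their
  values on \<open>\<Omega>\<close> matter, and measurability and integrals refer to \<open>lebesgue_on \<Omega>\<close>.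
\<close>

text \<open>
  The exponent ranges over \<open>[1,\<infinity>]\<close>. In \<open>Lp_norm\<close>, \<open>real_of_ereal\<close> turns the essential supremum
  \<open>-\<infinity>\<close>, which occurs only if the whole space is a null set, into the correct norm 0.
\<close>

definition Lp_space :: "'a measure \<Rightarrow> ereal \<Rightarrow> ('a \<Rightarrow> 'b::euclidean_space) set" where
  "Lp_space M p = {f \<in> borel_measurable M.
     if p = \<infinity> then esssup M (\<lambda>x. ereal (norm (f x))) < \<infinity>
     else integrable M (\<lambda>x. norm (f x) powr real_of_ereal p)}"

definition Lp_norm :: "'a measure \<Rightarrow> ereal \<Rightarrow> ('a \<Rightarrow> 'b::euclidean_space) \<Rightarrow> real" where
  "Lp_norm M p f =
     (if p = \<infinity> then real_of_ereal (esssup M (\<lambda>x. ereal (norm (f x))))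
      else (integral\<^sup>L M (\<lambda>x. norm (f x) powr real_of_ereal p)) powr (1 / real_of_ereal p))"

definition partial_deriv :: "'n \<Rightarrow> (real ^ 'n \<Rightarrow> real) \<Rightarrow> real ^ 'n \<Rightarrow> real" where
  "partial_deriv i \<phi> x = frechet_derivative \<phi> (at x) (axis i 1)"

definition grad :: "(real ^ 'n \<Rightarrow> real) \<Rightarrow> real ^ 'n \<Rightarrow> real ^ 'n" where
  "grad \<phi> x = (\<chi> i. partial_deriv i \<phi> x)"

text \<open>
  Differentiability is required at every level because \<open>frechet_derivative\<close> is unspecified
  where the derivative does not exist.
\<close>

fun C_k :: "nat \<Rightarrow> (real ^ 'n \<Rightarrow> real) \<Rightarrow> bool" where
  "C_k 0 \<phi> \<longleftrightarrow> continuous_on UNIV \<phi>"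
| "C_k (Suc k) \<phi> \<longleftrightarrow> (\<forall>x. \<phi> differentiable (at x)) \<and> (\<forall>i. C_k k (partial_deriv i \<phi>))"

text \<open>\<open>C\<^sub>0\<^sup>\<infinity>(\<Omega>)\<close>, each function being extended by zero outside \<open>\<Omega>\<close>.\<close>

definition test_functions :: "(real ^ 'n) set \<Rightarrow> (real ^ 'n \<Rightarrow> real) set" where
  "test_functions \<Omega> = {\<phi>. (\<forall>k. C_k k \<phi>) \<and>
     compact (closure {x. \<phi> x \<noteq> 0}) \<and> closure {x. \<phi> x \<noteq> 0} \<subseteq> \<Omega>}"

definition locally_integrable ::
    "(real ^ 'n) set \<Rightarrow> (real ^ 'n \<Rightarrow> 'b::euclidean_space) \<Rightarrow> bool" where
  "locally_integrable \<Omega> f \<longleftrightarrow> (\<forall>K. compact K \<and> K \<subseteq> \<Omega> \<longrightarrow> set_integrable lebesgue K f)"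

text \<open>
  The weak gradient is unique up to null sets, so it is a relation between \<open>u\<close> and the
  representatives \<open>Du\<close>.
\<close>

definition has_weak_gradient ::
    "(real ^ 'n) set \<Rightarrow> (real ^ 'n \<Rightarrow> real) \<Rightarrow> (real ^ 'n \<Rightarrow> real ^ 'n) \<Rightarrow> bool" where
  "has_weak_gradient \<Omega> u Du \<longleftrightarrow> locally_integrable \<Omega> u \<and> locally_integrable \<Omega> Du \<and>
     (\<forall>\<phi>\<in>test_functions \<Omega>.
        integral\<^sup>L (lebesgue_on \<Omega>) (\<lambda>x. u x *\<^sub>R grad \<phi> x) =
        - integral\<^sup>L (lebesgue_on \<Omega>) (\<lambda>x. \<phi> x *\<^sub>R Du x))"

text \<open>\<open>W\<^sub>0\<^sup>1\<^sup>,\<^sup>p(\<Omega>)\<close>: the closure of \<open>C\<^sub>0\<^sup>\<infinity>(\<Omega>)\<close> in \<open>W\<^sup>1\<^sup>,\<^sup>p(\<Omega>)\<close>.\<close>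

definition sobolev_W01 :: "(real ^ 'n) set \<Rightarrow> real \<Rightarrow> (real ^ 'n \<Rightarrow> real) set" where
  "sobolev_W01 \<Omega> p = {u \<in> Lp_space (lebesgue_on \<Omega>) (ereal p).
     \<exists>Du \<in> Lp_space (lebesgue_on \<Omega>) (ereal p). has_weak_gradient \<Omega> u Du \<and>
       (\<exists>\<phi> :: nat \<Rightarrow> real ^ 'n \<Rightarrow> real. (\<forall>k. \<phi> k \<in> test_functions \<Omega>) \<and>
          (\<lambda>k. Lp_norm (lebesgue_on \<Omega>) (ereal p) (\<lambda>x. \<phi> k x - u x)) \<longlonglongrightarrow> 0 \<and>
          (\<lambda>k. Lp_norm (lebesgue_on \<Omega>) (ereal p) (\<lambda>x. grad (\<phi> k) x - Du x)) \<longlonglongrightarrow> 0)}"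

definition caratheodory ::
    "(real ^ 'n) set \<Rightarrow> (real ^ 'n \<Rightarrow> real \<Rightarrow> real ^ 'n \<Rightarrow> real ^ 'n) \<Rightarrow> bool" where
  "caratheodory \<Omega> a \<longleftrightarrow>
     (\<forall>s \<xi>. (\<lambda>x. a x s \<xi>) \<in> borel_measurable (lebesgue_on \<Omega>)) \<and>
     (AE x in lebesgue_on \<Omega>. continuous_on UNIV (\<lambda>(s, \<xi>). a x s \<xi>))"

text \<open>
  \<open>- div (a(x,u,\<nabla>u)) + \<lambda> u + |\<nabla>u|\<^sup>p \<le> f\<close> in \<open>\<Omega>\<close> in the sense of distributions, where \<open>Du\<close> is a
  representative of the weak gradient of \<open>u\<close>.
\<close>

definition distributional_subsolution ::
    "(real ^ 'n) set \<Rightarrow> (real ^ 'n \<Rightarrow> real \<Rightarrow> real ^ 'n \<Rightarrow> real ^ 'n) \<Rightarrow> real \<Rightarrow> real \<Rightarrow>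
     (real ^ 'n \<Rightarrow> real) \<Rightarrow> (real ^ 'n \<Rightarrow> real) \<Rightarrow> (real ^ 'n \<Rightarrow> real ^ 'n) \<Rightarrow> bool" where
  "distributional_subsolution \<Omega> a lam p f u Du \<longleftrightarrow>
     (\<forall>\<phi>\<in>test_functions \<Omega>. (\<forall>x. \<phi> x \<ge> 0) \<longrightarrow>
        integral\<^sup>L (lebesgue_on \<Omega>) (\<lambda>x. a x (u x) (Du x) \<bullet> grad \<phi> x)
        + lam * integral\<^sup>L (lebesgue_on \<Omega>) (\<lambda>x. u x * \<phi> x)
        + integral\<^sup>L (lebesgue_on \<Omega>) (\<lambda>x. norm (Du x) powr p * \<phi> x)
        \<le> integral\<^sup>L (lebesgue_on \<Omega>) (\<lambda>x. f x * \<phi> x))"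

end

theory Submission
  imports Defs
begin

text \<open>
  Since \<open>p > 2\<close>, no ellipticity of \<open>a\<close> is needed: when the inequality is tested with \<open>G(u)\<close>, \<open>G\<close> an even
  cutoff supported in \<open>|u| > k\<close>, the term \<open>|\<nabla>u|\<^sup>p G(u)\<close> absorbs \<open>a(x,u,\<nabla>u) \<bullet> \<nabla>u G'(u)\<close>, which grows only
  quadratically in \<open>\<nabla>u\<close>. This bounds the \<open>p\<close>-energy of \<open>u\<close> on \<open>{|u| > k}\<close> by the integral of
  \<open>1 + |\<lambda>| |u| + |f|\<close> over that set, for both signs of \<open>u\<close> at once. Combined with the inequality
  \<open>\<integral>|w| \<le> C |{w \<noteq> 0}|\<^bsup>1/N\<^esup> \<integral>|\<nabla>w|\<close>, it gives a decay estimate for the integrals of \<open>(|u| - k)\<^sup>+\<close> whose exponent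
  exceeds 1 exactly because \<open>q > N/p\<close>, and De Giorgi's iteration applies. The starting level of the
  iteration only depends on the \<open>L\<^sup>1\<close> norm of \<open>u\<close>, which the same estimate with \<open>k = 0\<close> controls.
\<close>

subsection \<open>Smooth functions\<close>

text \<open>The inequality admits only smooth compactly supported test functions, while
  \<open>u\<close> is just a limit of such functions \<open>\<phi> k\<close>. Hence \<open>G\<close>
  has to be smooth with \<open>G 0 = 0\<close>; the inequality is tested with
  \<open>G(\<phi> k)\<close> and \<open>k\<close> tends to infinity. Absorbing the quadratic drift
  requires |G'| <= c G^(2/p) up to the edge of the support. The function exp(-1/t) satisfies such a
  bound for every exponent below 1, so it works for all p > 2. The price is a transition layer of
  width h in which G' has size 1/h, and the drift then costs a multiple of h^(-p/(p-2)) for small h.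
  Along the iteration h shrinks like 2^(-n), so this is a geometric factor, which a superlinear
  recursion tolerates. The integral inequality is applied to a second function of \<open>u\<close>,
  comparable to (|u| - k)^+, whose derivative is at most c G^(1/p), so that the same energy controls
  its gradient. If mu is the measure of {|u| > k}, the excess above k + h is at most C mu^(1/N + 1 -
  1/p) E^(1/p) with E the energy bound. As \<open>f\<close> contributes mu^(1 - 1/q) to E, the total
  exponent is 1 + 1/N - 1/(pq).\<close>

coinductive smooth_real :: "(real \<Rightarrow> real) \<Rightarrow> bool" where
  "(\<And>x. (g has_real_derivative g' x) (at x)) \<Longrightarrow> smooth_real g' \<Longrightarrow> smooth_real g"

lemma smooth_realE:
  assumes "smooth_real g"
  obtains g' where "\<And>x. (g has_real_derivative g' x) (at x)" "smooth_real g'"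
  using assms by (cases rule: smooth_real.cases) blast

text \<open>Each differentiation multiplies by \<open>a\<close>, so the factor \<open>c\<close> has
  to belong to the coinduction class; \<open>a\<close> and \<open>b\<close> stay fixed in
  it.\<close>

lemma smooth_real_scale_affine:
  assumes "smooth_real g"
  shows "smooth_real (\<lambda>t. c * g (a * t + b))"
proof -
  have "\<exists>c g. smooth_real g \<and> (\<lambda>t. c * g (a * t + b)) = (\<lambda>t. c * g (a * t + b))"
    by (metis assms)
  then have "\<exists>c' g'. smooth_real g' \<and> (\<lambda>t. c * g (a * t + b)) = (\<lambda>t. c' * g' (a * t + b))"
    using assms by blast
  then show ?thesis
  proof (coinduction arbitrary: c g)
    case (smooth_real c0 g0)
    then obtain c g where g: "smooth_real g" "(\<lambda>t. c0 * g0 (a * t + b)) = (\<lambda>t. c * g (a * t + b))"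
      by blast
    obtain g' where g': "\<And>x. (g has_real_derivative g' x) (at x)" "smooth_real g'"
      using smooth_realE[OF g(1)] by blast
    have "((\<lambda>t. c * g (a * t + b)) has_real_derivative (c * a) * g' (a * x + b)) (at x)" for x
    proof -
      have "((\<lambda>t. a * t + b) has_real_derivative a) (at x)" by (auto intro!: derivative_eq_intros)
      from DERIV_cmult[OF DERIV_chain2[OF g'(1) this], of c] show ?thesis by (simp add: mult_ac)
    qed
    with g g'(2) show ?case
      by (intro exI[of _ "\<lambda>t. c * g (a * t + b)"] exI[of _ "\<lambda>t. (c * a) * g' (a * t + b)"]) auto
  qed
qed

lemma smooth_real_add:
  assumes "smooth_real g" "smooth_real h"
  shows "smooth_real (\<lambda>t. g t + h t)"
  using assms
proof (coinduction arbitrary: g h)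
  case (smooth_real g h)
  then obtain g' h' where "\<And>x. (g has_real_derivative g' x) (at x)" "smooth_real g'"
      "\<And>x. (h has_real_derivative h' x) (at x)" "smooth_real h'"
    by (metis smooth_realE)
  then show ?case
    by (intro exI[of _ "\<lambda>t. g t + h t"] exI[of _ "\<lambda>t. g' t + h' t"])
      (auto intro!: derivative_eq_intros)
qed

section \<open>Partial derivatives and closure properties of \<open>C_k\<close>\<close>

lemma partial_deriv_eqI: "(\<phi> has_derivative D) (at x) \<Longrightarrow> partial_deriv i \<phi> x = D (axis i 1)"
  unfolding partial_deriv_def by (metis frechet_derivative_at)

lemma C_k_SucD: "C_k (Suc k) \<phi> \<Longrightarrow> C_k k \<phi>"
proof (induction k arbitrary: \<phi>)
  case 0
  then show ?case
    by (auto intro!: continuous_at_imp_continuous_on differentiable_imp_continuous_within)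
next
  case (Suc k)
  show ?case
    unfolding C_k.simps(2)[of k] using Suc.IH Suc.prems C_k.simps(2)[of "Suc k"] by blast
qed


text \<open>The analogue for \<open>C_k\<close> of coinduction for \<open>smooth_real\<close>: a
  class of differentiable functions closed under partial derivatives consists of smooth functions,
  and no formula for higher derivatives is required.\<close>

lemma C_k_coinduct:
  assumes "P \<phi>" and step: "\<And>\<psi> x. P \<psi> \<Longrightarrow> \<psi> differentiable (at x)"
    "\<And>\<psi> i. P \<psi> \<Longrightarrow> P (partial_deriv i \<psi>)"
  shows "C_k k \<phi>"
  using assms(1)
proof (induction k arbitrary: \<phi>)
  case 0
  then show ?case
    by (auto intro!: continuous_at_imp_continuous_on differentiable_imp_continuous_within step)
qed (use step in auto)

lemma C_k_add: "C_k k \<phi> \<Longrightarrow> C_k k \<psi> \<Longrightarrow> C_k k (\<lambda>x. \<phi> x + \<psi> x)"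
proof (induction k arbitrary: \<phi> \<psi>)
  case (Suc k)
  have "partial_deriv i (\<lambda>x. \<phi> x + \<psi> x) = (\<lambda>x. partial_deriv i \<phi> x + partial_deriv i \<psi> x)" for i
    using Suc.prems
    by (intro ext partial_deriv_eqI[THEN trans])
      (auto intro!: has_derivative_add simp: frechet_derivative_works partial_deriv_def)
  then show ?case using Suc by auto
qed (simp add: continuous_on_add continuous_on_mult)

lemma C_k_mult: "C_k k \<phi> \<Longrightarrow> C_k k \<psi> \<Longrightarrow> C_k k (\<lambda>x. \<phi> x * \<psi> x)"
proof (induction k arbitrary: \<phi> \<psi>)
  case (Suc k)
  have "partial_deriv i (\<lambda>x. \<phi> x * \<psi> x) = (\<lambda>x. \<phi> x * partial_deriv i \<psi> x + partial_deriv i \<phi> x * \<psi> x)" for i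
    using Suc.prems
    by (intro ext partial_deriv_eqI[THEN trans])
      (auto intro!: has_derivative_mult simp: frechet_derivative_works partial_deriv_def)
  moreover have "C_k k (\<lambda>x. \<phi> x * partial_deriv i \<psi> x + partial_deriv i \<phi> x * \<psi> x)" for i
    using Suc.prems C_k_SucD[OF Suc.prems(1)] C_k_SucD[OF Suc.prems(2)]
    by (intro C_k_add Suc.IH) simp_all
  ultimately show ?case using Suc.prems by simp
qed (simp add: continuous_on_add continuous_on_mult)

lemma has_derivative_real_comp:
  fixes \<phi> :: "'a::real_normed_vector \<Rightarrow> real"
  assumes "(g has_real_derivative d) (at (\<phi> x))" "(\<phi> has_derivative D) (at x)"
  shows "((\<lambda>x. g (\<phi> x)) has_derivative (\<lambda>v. d * D v)) (at x)"
  using has_derivative_compose[OF assms(2), of g "(*) d"] assms(1)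
  by (simp add: has_field_derivative_def)

lemma partial_deriv_comp:
  assumes "(g has_real_derivative d) (at (\<phi> x))" "\<phi> differentiable (at x)"
  shows "partial_deriv i (\<lambda>x. g (\<phi> x)) x = d * partial_deriv i \<phi> x"
  using partial_deriv_eqI[OF has_derivative_real_comp[where \<phi> = \<phi>, OF assms(1)]] assms(2)
  by (auto simp: partial_deriv_def frechet_derivative_works)

lemma C_k_comp: "smooth_real g \<Longrightarrow> C_k k \<phi> \<Longrightarrow> C_k k (\<lambda>x. g (\<phi> x))"
proof (induction k arbitrary: g \<phi>)
  case 0
  then have "continuous_on UNIV g"
    by (meson smooth_realE DERIV_isCont continuous_at_imp_continuous_on)
  with 0 show ?case using continuous_on_compose2[of UNIV g UNIV \<phi>] by auto
next
  case (Suc k)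
  obtain g' where g': "\<And>x. (g has_real_derivative g' x) (at x)" "smooth_real g'"
    using smooth_realE[OF Suc.prems(1)] by blast
  have "partial_deriv i (\<lambda>x. g (\<phi> x)) = (\<lambda>x. g' (\<phi> x) * partial_deriv i \<phi> x)" for i
    using Suc.prems by (intro ext partial_deriv_comp g') auto
  moreover have "(\<lambda>x. g (\<phi> x)) differentiable (at x)" for x
    using has_derivative_real_comp[where \<phi> = \<phi>, OF g'(1)] Suc.prems(2)
    unfolding differentiable_def C_k.simps by blast
  moreover have "C_k k (\<lambda>x. g' (\<phi> x) * partial_deriv i \<phi> x)" for i
    using Suc.prems(2) C_k_SucD[OF Suc.prems(2)] by (intro C_k_mult Suc.IH[OF g'(2)]) simp_all
  ultimately show ?case by simp
qed

lemma has_derivative_prod_coords: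
  fixes h :: "'n::finite \<Rightarrow> real \<Rightarrow> real"
  assumes "\<And>i t. (h i has_real_derivative h' i t) (at t)"
  shows "((\<lambda>x::real^'n. \<Prod>i\<in>UNIV. h i (x $ i)) has_derivative
     (\<lambda>v. \<Sum>i\<in>UNIV. (h' i (x $ i) * v $ i) * (\<Prod>j\<in>UNIV - {i}. h j (x $ j)))) (at x)"
proof (rule has_derivative_prod)
  fix i :: 'n
  show "((\<lambda>x::real^'n. h i (x $ i)) has_derivative (\<lambda>v. h' i (x $ i) * v $ i)) (at x)"
    by (intro has_derivative_real_comp assms bounded_linear_imp_has_derivative bounded_linear_vec_nth)
qed

text \<open>Products of smooth functions of single coordinates form a class closed under partial
  derivatives: differentiating in direction \<open>i\<close> replaces the factor \<open>h i\<close>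
  by its derivative.\<close>

lemma C_k_prod_coords:
  fixes h :: "'n::finite \<Rightarrow> real \<Rightarrow> real"
  assumes "\<And>i. smooth_real (h i)"
  shows "C_k k (\<lambda>x::real^'n. \<Prod>i\<in>UNIV. h i (x $ i))"
proof (rule C_k_coinduct[where P = "\<lambda>\<phi>. \<exists>h. (\<forall>i. smooth_real (h i)) \<and> \<phi> = (\<lambda>x. \<Prod>i\<in>UNIV. h i (x $ i))"])
  fix \<psi> :: "real^'n \<Rightarrow> real" and x i
  assume "\<exists>h. (\<forall>i. smooth_real (h i)) \<and> \<psi> = (\<lambda>x. \<Prod>i\<in>UNIV. h i (x $ i))"
  then obtain h where h: "\<And>i. smooth_real (h i)" and \<psi>: "\<psi> = (\<lambda>x. \<Prod>i\<in>UNIV. h i (x $ i))" by auto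
  have "\<exists>h'. \<forall>i. (\<forall>x. (h i has_real_derivative h' i x) (at x)) \<and> smooth_real (h' i)"
    by (rule choice) (meson h smooth_realE)
  then obtain h' where h': "\<And>i x. (h i has_real_derivative h' i x) (at x)" "\<And>i. smooth_real (h' i)"
    by blast
  show "\<psi> differentiable (at x)"
    unfolding \<psi> using has_derivative_prod_coords[of h h', OF h'(1)] by (auto simp: differentiable_def)
  have "partial_deriv i \<psi> x = (\<Prod>j\<in>UNIV. (h(i := h' i)) j (x $ j))" for x
  proof -
    have "partial_deriv i \<psi> x = (\<Sum>k\<in>UNIV. (h' k (x $ k) * axis i 1 $ k) * (\<Prod>j\<in>UNIV - {k}. h j (x $ j)))"
      unfolding \<psi> by (rule partial_deriv_eqI[OF has_derivative_prod_coords[of h h', OF h'(1)]])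
    also have "\<dots> = (\<Sum>k\<in>UNIV. if k = i then h' i (x $ i) * (\<Prod>j\<in>UNIV - {i}. h j (x $ j)) else 0)"
      by (intro sum.cong) (auto simp: axis_def)
    also have "\<dots> = h' i (x $ i) * (\<Prod>j\<in>UNIV - {i}. h j (x $ j))" by simp
    also have "\<dots> = (\<Prod>j\<in>UNIV. (h(i := h' i)) j (x $ j))"
      by (subst prod.remove[of UNIV i]) (auto intro!: prod.cong)
    finally show ?thesis .
  qed
  then show "\<exists>h. (\<forall>i. smooth_real (h i)) \<and> partial_deriv i \<psi> = (\<lambda>x. \<Prod>i\<in>UNIV. h i (x $ i))"
    using h h'(2) by (intro exI[of _ "h(i := h' i)"]) auto
qed (use assms in auto)

section \<open>The flat functions P(1/t) exp(-1/t), a family closed under differentiation\<close>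

definition exp_flat :: "real poly \<Rightarrow> real \<Rightarrow> real" where
  "exp_flat P t = (if t > 0 then poly P (1 / t) * exp (- (1 / t)) else 0)"

lemma poly_exp_neg_tendsto_0: "((\<lambda>s::real. poly P s * exp (- s)) \<longlongrightarrow> 0) at_top"
proof -
  have "((\<lambda>s::real. s ^ i * exp (- s)) \<longlongrightarrow> 0) at_top" for i
    using tendsto_power_div_exp_0[of i] by (simp add: exp_minus field_simps)
  then have "((\<lambda>s::real. \<Sum>i\<le>degree P. coeff P i * (s ^ i * exp (- s))) \<longlongrightarrow>
      (\<Sum>i\<le>degree P. coeff P i * 0)) at_top"
    by (intro tendsto_sum tendsto_mult_left)
  then show ?thesis by (simp add: poly_altdef sum_distrib_left mult_ac)
qed

lemma exp_flat_tendsto_0: "(exp_flat P \<longlongrightarrow> 0) (at_right 0)"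
proof -
  have "((\<lambda>t. poly P (inverse t) * exp (- inverse t)) \<longlongrightarrow> 0) (at_right (0::real))"
    using filterlim_compose[OF poly_exp_neg_tendsto_0 filterlim_inverse_at_top_right] .
  then show ?thesis
    by (rule Lim_transform_eventually)
      (auto simp: exp_flat_def divide_inverse eventually_at_filter)
qed

text \<open>In the variable s = 1/t one has d/dt = - s^2 d/ds, and P(s) exp(-s) has s-derivative (P'
  - P)(s) exp(-s). This is the origin of the polynomial X^2 (P - P').\<close>

lemma has_real_derivative_exp_flat:
  "(exp_flat P has_real_derivative exp_flat ([:0, 0, 1:] * (P - pderiv P)) t) (at t)"
proof -
  consider "t > 0" | "t < 0" | "t = 0" by linarith
  then show ?thesis
  proof cases
    case 1
    have *: "((\<lambda>t. 1 / t) has_real_derivative - (1 / t^2)) (at t)"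
      using 1 by (auto intro!: derivative_eq_intros simp: power2_eq_square)
    have "((\<lambda>t. poly P (1 / t)) has_real_derivative poly (pderiv P) (1 / t) * - (1 / t^2)) (at t)"
      using DERIV_chain2[OF poly_DERIV *] .
    moreover have "((\<lambda>t. exp (- (1 / t))) has_real_derivative exp (- (1 / t)) * (1 / t^2)) (at t)"
      using DERIV_chain2[OF DERIV_exp DERIV_minus[OF *]] by simp
    ultimately have "((\<lambda>t. poly P (1 / t) * exp (- (1 / t))) has_real_derivative
        poly (pderiv P) (1 / t) * - (1 / t^2) * exp (- (1 / t)) + exp (- (1 / t)) * (1 / t^2) * poly P (1 / t)) (at t)"
      by (rule DERIV_mult)
    also have "poly (pderiv P) (1 / t) * - (1 / t^2) * exp (- (1 / t)) + exp (- (1 / t)) * (1 / t^2) * poly P (1 / t) =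
        exp_flat ([:0, 0, 1:] * (P - pderiv P)) t"
      using 1 by (simp add: exp_flat_def field_simps power2_eq_square)
    finally have "((\<lambda>t. poly P (1 / t) * exp (- (1 / t))) has_real_derivative
        exp_flat ([:0, 0, 1:] * (P - pderiv P)) t) (at t)" .
    then show ?thesis
      by (rule DERIV_cong_ev[THEN iffD1, rotated -1, OF _ refl _ refl])
        (use 1 eventually_nhds_in_open[of "{0<..}" t] in \<open>auto simp: exp_flat_def elim!: eventually_mono\<close>)
  next
    case 2
    have "((\<lambda>t. 0) has_real_derivative exp_flat ([:0, 0, 1:] * (P - pderiv P)) t) (at t)"
      using 2 by (auto simp: exp_flat_def)
    then show ?thesis
      by (rule DERIV_cong_ev[THEN iffD1, rotated -1, OF _ refl _ refl])
        (use 2 eventually_nhds_in_open[of "{..<0}" t] in \<open>auto simp: exp_flat_def elim!: eventually_mono\<close>)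
  next
    case 3
    \<comment> \<open>To the right of 0 the difference quotient is again a flat function, with
      polynomial X P, and therefore tends to 0.\<close>
    have "((\<lambda>h. exp_flat P h / h) \<longlongrightarrow> 0) (at_right 0)"
      using exp_flat_tendsto_0[of "[:0, 1:] * P"]
      by (rule Lim_transform_eventually) (auto simp: exp_flat_def eventually_at_filter)
    moreover have "((\<lambda>h. exp_flat P h / h) \<longlongrightarrow> 0) (at_left 0)"
      by (rule Lim_transform_eventually[OF tendsto_const]) (auto simp: exp_flat_def eventually_at_filter)
    ultimately have "((\<lambda>h. exp_flat P h / h) \<longlongrightarrow> 0) (at 0)"
      by (simp add: filterlim_split_at)
    then show ?thesis using 3 by (simp add: DERIV_def exp_flat_def)
  qed
qed

lemma smooth_real_exp_flat: "smooth_real (exp_flat P)"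
  by (coinduction arbitrary: P) (use has_real_derivative_exp_flat in blast)

subsection \<open>Test functions\<close>

lemma has_derivative_grad:
  fixes \<phi> :: "real ^ 'n \<Rightarrow> real"
  assumes "\<phi> differentiable (at x)"
  shows "(\<phi> has_derivative (\<lambda>v. grad \<phi> x \<bullet> v)) (at x)"
proof -
  let ?D = "frechet_derivative \<phi> (at x)"
  have D: "(\<phi> has_derivative ?D) (at x)"
    using assms by (simp add: frechet_derivative_works)
  interpret D: bounded_linear ?D using D by (rule has_derivative_bounded_linear)
  have "?D v = grad \<phi> x \<bullet> v" for v
  proof -
    have "?D v = ?D (\<Sum>i\<in>UNIV. v $ i *\<^sub>R axis i 1)"
      using basis_expansion[of v] by (simp add: scalar_mult_eq_scaleR)
    also have "\<dots> = (\<Sum>i\<in>UNIV. v $ i * partial_deriv i \<phi> x)"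
      by (simp add: D.sum D.scale partial_deriv_def)
    finally show ?thesis by (simp add: inner_vec_def grad_def mult.commute)
  qed
  then show ?thesis using D by (metis (no_types) ext)
qed

lemma grad_eqI:
  assumes "(\<phi> has_derivative (\<lambda>v. w \<bullet> v)) (at x)"
  shows "grad \<phi> x = w"
  using partial_deriv_eqI[OF assms] by (auto simp: grad_def vec_eq_iff inner_axis)

lemma test_functions_C_k: "\<phi> \<in> test_functions \<Omega> \<Longrightarrow> C_k k \<phi>"
  by (simp add: test_functions_def)

lemma test_functions_differentiable: "\<phi> \<in> test_functions \<Omega> \<Longrightarrow> \<phi> differentiable (at x)"
  using test_functions_C_k[of \<phi> \<Omega> "Suc 0"] by simp

lemma test_functions_continuous: "\<phi> \<in> test_functions \<Omega> \<Longrightarrow> continuous_on A \<phi>"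
  using test_functions_C_k[of \<phi> \<Omega> 0] by (auto intro: continuous_on_subset)

lemma test_functions_measurable:
  assumes "\<phi> \<in> test_functions \<Omega>"
  shows "\<phi> \<in> borel_measurable borel" "\<phi> \<in> borel_measurable lebesgue"
  using test_functions_continuous[OF assms, of UNIV]
  by (auto intro!: borel_measurable_continuous_onI measurable_completion)

lemma test_functions_continuous_grad:
  assumes "\<phi> \<in> test_functions \<Omega>" shows "continuous_on A (grad \<phi>)"
proof -
  have "continuous_on UNIV (partial_deriv i \<phi>)" for i
    using test_functions_C_k[OF assms, of "Suc 0"] by simp
  then have "continuous_on UNIV (grad \<phi>)"
    unfolding grad_def by (intro continuous_on_vec_lambda)
  then show ?thesis by (auto intro: continuous_on_subset)
qed

lemma test_functions_eq_0: "\<phi> \<in> test_functions \<Omega> \<Longrightarrow> x \<notin> \<Omega> \<Longrightarrow> \<phi> x = 0"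
  using closure_subset[of "{x. \<phi> x \<noteq> 0}"] by (auto simp: test_functions_def)

lemma test_functions_grad_eq_0:
  assumes "\<phi> \<in> test_functions \<Omega>" "x \<notin> closure {x. \<phi> x \<noteq> 0}"
  shows "grad \<phi> x = 0"
proof (rule grad_eqI)
  have "((\<lambda>_. 0) has_derivative (\<lambda>v. 0 \<bullet> v)) (at x)" by simp
  then show "(\<phi> has_derivative (\<lambda>v. 0 \<bullet> v)) (at x)"
    by (rule has_derivative_transform_within_open[where s = "- closure {x. \<phi> x \<noteq> 0}"])
      (use assms(2) closure_subset[of "{x. \<phi> x \<noteq> 0}"] in auto)
qed

lemma test_functions_bounded:
  assumes "\<phi> \<in> test_functions \<Omega>"
  shows "\<exists>B. \<forall>x. \<bar>\<phi> x\<bar> \<le> B \<and> norm (grad \<phi> x) \<le> B"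
proof -
  let ?K = "closure {x. \<phi> x \<noteq> 0}"
  have K: "compact ?K" using assms by (simp add: test_functions_def)
  have "bounded (\<phi> ` ?K)" "bounded (grad \<phi> ` ?K)"
    using K assms by (auto intro!: compact_imp_bounded compact_continuous_image
        test_functions_continuous test_functions_continuous_grad)
  then obtain B1 B2 where B: "\<And>x. x \<in> ?K \<Longrightarrow> \<bar>\<phi> x\<bar> \<le> B1" "\<And>x. x \<in> ?K \<Longrightarrow> norm (grad \<phi> x) \<le> B2"
    by (auto simp: bounded_iff)
  show ?thesis
  proof (intro exI allI conjI)
    fix x
    show "\<bar>\<phi> x\<bar> \<le> max 0 (max B1 B2)"
      using B(1)[of x] closure_subset[of "{x. \<phi> x \<noteq> 0}"] by (cases "\<phi> x = 0") fastforce+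
    show "norm (grad \<phi> x) \<le> max 0 (max B1 B2)"
      using B(2)[of x] test_functions_grad_eq_0[OF assms, of x] by (cases "x \<in> ?K") auto
  qed
qed

lemma grad_comp:
  assumes "\<And>t. (g has_real_derivative g' t) (at t)" "\<phi> differentiable (at x)"
  shows "grad (\<lambda>x. g (\<phi> x)) x = g' (\<phi> x) *\<^sub>R grad \<phi> x"
  by (rule grad_eqI)
    (use has_derivative_real_comp[where \<phi> = \<phi>, OF assms(1) has_derivative_grad[OF assms(2)]] in simp)

lemma test_functions_comp:
  assumes "\<phi> \<in> test_functions \<Omega>" "smooth_real g" "g 0 = 0"
  shows "(\<lambda>x. g (\<phi> x)) \<in> test_functions \<Omega>"
proof -
  have *: "closure {x. g (\<phi> x) \<noteq> 0} \<subseteq> closure {x. \<phi> x \<noteq> 0}"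
    by (rule closure_mono) (use assms(3) in auto)
  moreover have "bounded (closure {x. \<phi> x \<noteq> 0})"
    using assms(1) by (auto simp: test_functions_def intro: compact_imp_bounded)
  ultimately have "compact (closure {x. g (\<phi> x) \<noteq> 0})"
    unfolding compact_eq_bounded_closed by (meson bounded_subset closed_closure)
  with * assms(1) C_k_comp[OF assms(2) test_functions_C_k[OF assms(1)]] show ?thesis
    by (auto simp: test_functions_def)
qed

lemma exp_flat_1: "exp_flat 1 t = (if t > 0 then exp (- (1 / t)) else 0)"
  by (simp add: exp_flat_def)

lemma exp_flat_1_bounds: "0 \<le> exp_flat 1 t" "exp_flat 1 t \<le> 1"
  by (auto simp: exp_flat_1)

text \<open>Each coordinate contributes the factors exp(-1/((n+1) t)), cut to 0 for t <= 0, with t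
  the distance to either face. They tend to 1 for every t > 0, so the products approximate the
  indicator of the open box from inside while their supports stay in the closed box.\<close>

lemma box_bump_sequence:
  fixes a b :: "real ^ 'n"
  assumes "cbox a b \<subseteq> \<Omega>"
  shows "\<exists>\<phi>. (\<forall>n. \<phi> n \<in> test_functions \<Omega>) \<and> (\<forall>n x. 0 \<le> \<phi> n x \<and> \<phi> n x \<le> 1) \<and>
    (\<forall>n x. x \<notin> box a b \<longrightarrow> \<phi> n x = 0) \<and> (\<forall>x. (\<lambda>n. \<phi> n x) \<longlonglongrightarrow> indicator (box a b) x)"
proof -
  define e where "e n t = exp_flat 1 (real (Suc n) * t)" for n t
  define \<phi> :: "nat \<Rightarrow> real ^ 'n \<Rightarrow> real"
    where "\<phi> n x = (\<Prod>i\<in>UNIV. e n (x $ i - a $ i)) * (\<Prod>i\<in>UNIV. e n (b $ i - x $ i))" for n x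
  have e01: "0 \<le> e n t" "e n t \<le> 1" for n t by (auto simp: e_def exp_flat_1_bounds)
  have e0: "e n t = 0" if "t \<le> 0" for n t
    using that by (auto simp: e_def exp_flat_1 zero_less_mult_iff)
  have box: "box a b = {x. \<forall>i. 0 < x $ i - a $ i \<and> 0 < b $ i - x $ i}"
    by (auto simp: mem_box_cart)
  have out: "\<phi> n x = 0" if "x \<notin> box a b" for n x
  proof -
    obtain i where "x $ i - a $ i \<le> 0 \<or> b $ i - x $ i \<le> 0"
      using \<open>x \<notin> box a b\<close> by (auto simp: box not_less)
    then have "(\<exists>i. e n (x $ i - a $ i) = 0) \<or> (\<exists>i. e n (b $ i - x $ i) = 0)" using e0 by blast
    then show ?thesis unfolding \<phi>_def by auto
  qed
  have lim: "(\<lambda>n. e n t) \<longlonglongrightarrow> 1" if "t > 0" for t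
  proof -
    have "(\<lambda>n. exp (- (inverse (real (Suc n)) * (1 / t)))) \<longlonglongrightarrow> exp (- (0 * (1 / t)))"
      by (intro tendsto_intros LIMSEQ_inverse_real_of_nat)
    moreover have "e n t = exp (- (inverse (real (Suc n)) * (1 / t)))" for n
      using that by (simp add: e_def exp_flat_1 field_simps zero_less_mult_iff del: of_nat_Suc)
    ultimately show ?thesis by simp
  qed
  show ?thesis
  proof (intro exI[of _ \<phi>] conjI allI impI)
    fix n
    have "C_k k (\<phi> n)" for k
    proof -
      have "smooth_real (\<lambda>t. e n (t - a $ i))" for i
        using smooth_real_scale_affine[OF smooth_real_exp_flat, of 1 1 "real (Suc n)" "- real (Suc n) * a $ i"]
        by (simp add: e_def right_diff_distrib del: of_nat_Suc)
      moreover have "smooth_real (\<lambda>t. e n (b $ i - t))" for i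
        using smooth_real_scale_affine[OF smooth_real_exp_flat, of 1 1 "- real (Suc n)" "real (Suc n) * b $ i"]
        by (simp add: e_def right_diff_distrib del: of_nat_Suc)
      ultimately show ?thesis
        unfolding \<phi>_def by (intro C_k_mult C_k_prod_coords)
    qed
    moreover have sub: "closure {x. \<phi> n x \<noteq> 0} \<subseteq> cbox a b"
      by (rule closure_minimal) (use out box_subset_cbox[of a b] in auto)
    moreover have "compact (closure {x. \<phi> n x \<noteq> 0})"
      using sub bounded_cbox[of a b] by (metis bounded_subset closed_closure compact_eq_bounded_closed)
    ultimately show "\<phi> n \<in> test_functions \<Omega>"
      using assms by (auto simp: test_functions_def)
    fix x
    have "0 \<le> (\<Prod>i\<in>UNIV. e n (x $ i - a $ i))" "(\<Prod>i\<in>UNIV. e n (x $ i - a $ i)) \<le> 1"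
        "0 \<le> (\<Prod>i\<in>UNIV. e n (b $ i - x $ i))" "(\<Prod>i\<in>UNIV. e n (b $ i - x $ i)) \<le> 1"
      by (simp_all add: e01 prod_nonneg prod_le_1)
    then show "0 \<le> \<phi> n x" "\<phi> n x \<le> 1"
      unfolding \<phi>_def by (simp_all add: mult_le_one)
    show "\<phi> n x = 0" if "x \<notin> box a b" using out[OF that] .
    show "(\<lambda>n. \<phi> n x) \<longlonglongrightarrow> indicator (box a b) x"
    proof (cases "x \<in> box a b")
      case True
      then have "(\<lambda>n. \<phi> n x) \<longlonglongrightarrow> (\<Prod>i::'n\<in>UNIV. 1) * (\<Prod>i::'n\<in>UNIV. 1)"
        unfolding \<phi>_def by (intro tendsto_mult tendsto_prod lim) (auto simp: box)
      then show ?thesis using True by simp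
    qed (simp add: out)
  qed
qed

section \<open>The fundamental lemma of the calculus of variations and uniqueness of weak
  gradients\<close>

lemma sigma_finite_lebesgue: "sigma_finite_measure (lebesgue :: 'a::euclidean_space measure)"
proof
  show "\<exists>A. countable A \<and> A \<subseteq> sets (lebesgue :: 'a measure) \<and> \<Union> A = space lebesgue \<and>
      (\<forall>a\<in>A. emeasure lebesgue a \<noteq> \<infinity>)"
    by (intro exI[of _ "range (\<lambda>n::nat. box (- (real n *\<^sub>R One)) (real n *\<^sub>R One) :: 'a set)"])
      (auto simp: UN_box_eq_UNIV)
qed

text \<open>Open boxes form an intersection-stable generator of the Borel sets, and the sets over
  which \<open>f\<close> integrates to 0 are closed under complements and countable disjoint unions.
  Once all Lebesgue sets are reached, the density \<open>f\<close> must vanish.\<close>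

lemma integrable_zero_on_boxes:
  fixes f :: "'a::euclidean_space \<Rightarrow> 'b::{banach, second_countable_topology}"
  assumes f: "integrable lebesgue f"
    and zero: "\<And>a b. set_lebesgue_integral lebesgue (box a b) f = 0"
  shows "AE x in lebesgue. f x = 0"
proof (rule sigma_finite_measure.density_zero[OF sigma_finite_lebesgue f])
  have si: "set_integrable lebesgue A f" if "A \<in> sets borel" for A
    using that f unfolding set_integrable_def by (intro integrable_mult_indicator) auto
  \<comment> \<open>Complements require the integral over the whole space, which is a limit over
    growing cubes.\<close>
  have UN: "set_lebesgue_integral lebesgue UNIV f = 0"
  proof -
    let ?Q = "\<lambda>n::nat. box (- (real n *\<^sub>R One)) (real n *\<^sub>R One) :: 'a set"
    have "incseq ?Q"
      unfolding incseq_def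
    proof (intro allI impI subsetI)
      fix m n x assume "m \<le> n" "x \<in> ?Q m"
      then show "x \<in> ?Q n" unfolding mem_box by (force intro: less_le_trans le_less_trans)
    qed
    then have "(\<lambda>n. set_lebesgue_integral lebesgue (?Q n) f) \<longlonglongrightarrow> set_lebesgue_integral lebesgue (\<Union>n. ?Q n) f"
      by (intro set_integral_cont_up si) auto
    then show ?thesis using zero by (simp add: UN_box_eq_UNIV LIMSEQ_const_iff)
  qed
  have borel: "set_lebesgue_integral lebesgue A f = 0" if "A \<in> sets borel" for A
  proof -
    have "Int_stable (range (\<lambda>(a, b). box a b :: 'a set))"
      by (auto simp: Int_stable_def box_Int_box)
    moreover have "range (\<lambda>(a, b). box a b :: 'a set) \<subseteq> Pow UNIV" by simp
    moreover have "A \<in> sigma_sets UNIV (range (\<lambda>(a, b). box a b :: 'a set))"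
      using that unfolding borel_eq_box by (simp add: sets_measure_of)
    ultimately show ?thesis
    proof (induction A rule: sigma_sets_induct_disjoint)
      case (compl A)
      then have A: "A \<in> sets borel" unfolding borel_eq_box by (simp add: sets_measure_of)
      have "set_lebesgue_integral lebesgue (A \<union> (UNIV - A)) f
          = set_lebesgue_integral lebesgue A f + set_lebesgue_integral lebesgue (UNIV - A) f"
        by (intro set_integral_Un si) (use A in auto)
      then show ?case using compl UN by simp
    next
      case (union A)
      then have A: "A i \<in> sets borel" for i unfolding borel_eq_box by (auto simp: sets_measure_of)
      have "set_lebesgue_integral lebesgue (\<Union>i. A i) f = (\<Sum>i. set_lebesgue_integral lebesgue (A i) f)"
        by (intro lebesgue_integral_countable_add si) (use A union in \<open>auto simp: disjoint_family_on_def\<close>)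
      then show ?case using union by simp
    qed (use zero in \<open>auto simp: set_lebesgue_integral_def\<close>)
  qed
  fix A :: "'a set" assume A: "A \<in> sets lebesgue"
  \<comment> \<open>A Lebesgue set differs from its Borel main part only by a null set.\<close>
  have "set_lebesgue_integral lebesgue A f = set_lebesgue_integral lebesgue (main_part lborel A) f"
    unfolding set_lebesgue_integral_def
  proof (rule integral_cong_AE)
    have "main_part lborel A \<in> sets lebesgue" by (rule sets_completionI_sets[OF main_part_sets[OF A]])
    then show "(\<lambda>x. indicator A x *\<^sub>R f x) \<in> borel_measurable lebesgue"
        "(\<lambda>x. indicator (main_part lborel A) x *\<^sub>R f x) \<in> borel_measurable lebesgue"
      using f A by auto
    have "AE x in lebesgue. x \<in> A \<longleftrightarrow> x \<in> main_part lborel A"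
      using AE_in_main_part[OF A] by (auto simp: AE_completion_iff)
    then show "AE x in lebesgue. indicator A x *\<^sub>R f x = indicator (main_part lborel A) x *\<^sub>R f x"
      by eventually_elim (auto simp: indicator_def)
  qed
  also have "\<dots> = 0" using main_part_sets[OF A] by (intro borel) (simp only: sets_lborel)
  finally show "set_lebesgue_integral lebesgue A f = 0" .
qed

lemma locally_integrable_mult_test:
  fixes v :: "real ^ 'n \<Rightarrow> 'b::euclidean_space"
  assumes "open \<Omega>" "locally_integrable \<Omega> v" "\<phi> \<in> test_functions \<Omega>"
  shows "integrable (lebesgue_on \<Omega>) (\<lambda>x. \<phi> x *\<^sub>R v x)"
proof -
  let ?K = "closure {x. \<phi> x \<noteq> 0}"
  have K: "compact ?K" "?K \<subseteq> \<Omega>" using assms(3) by (auto simp: test_functions_def)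
  obtain B where B: "\<And>x. \<bar>\<phi> x\<bar> \<le> B" using test_functions_bounded[OF assms(3)] by blast
  have int: "integrable lebesgue (\<lambda>x. indicator ?K x *\<^sub>R v x)"
    using assms(2) K by (auto simp: locally_integrable_def set_integrable_def)
  have "integrable lebesgue (\<lambda>x. \<phi> x *\<^sub>R (indicator ?K x *\<^sub>R v x))"
  proof (rule Bochner_Integration.integrable_bound[where f = "\<lambda>x. B *\<^sub>R indicator ?K x *\<^sub>R v x"])
    show "(\<lambda>x. \<phi> x *\<^sub>R indicat_real ?K x *\<^sub>R v x) \<in> borel_measurable lebesgue"
      by (rule borel_measurable_scaleR[OF test_functions_measurable(2)[OF assms(3)] borel_measurable_integrable[OF int]])
    show "integrable lebesgue (\<lambda>x. B *\<^sub>R indicator ?K x *\<^sub>R v x)"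
      by (intro integrable_scaleR_right int)
    show "AE x in lebesgue. norm (\<phi> x *\<^sub>R indicat_real ?K x *\<^sub>R v x) \<le> norm (B *\<^sub>R indicat_real ?K x *\<^sub>R v x)"
      using B by (intro AE_I2) (auto simp: indicator_def intro!: mult_right_mono order_trans[OF B])
  qed
  moreover have "\<phi> x *\<^sub>R (indicator ?K x *\<^sub>R v x) = indicator \<Omega> x *\<^sub>R (\<phi> x *\<^sub>R v x)" for x
    using K(2) closure_subset[of "{x. \<phi> x \<noteq> 0}"] by (auto simp: indicator_def)
  ultimately have "integrable lebesgue (\<lambda>x. indicator \<Omega> x *\<^sub>R (\<phi> x *\<^sub>R v x))" by (simp only:)
  then show ?thesis using assms(1) by (simp add: integrable_restrict_space)
qed

text \<open>The bumps of \<open>box_bump_sequence\<close> and dominated convergence give zero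
  integrals over all boxes with closure in \<open>\<Omega>\<close>. This forces \<open>v = 0\<close>
  almost everywhere on each such box, and countably many of them cover
  \<open>\<Omega>\<close>.\<close>

lemma fundamental_lemma_calculus_of_variations:
  fixes v :: "real ^ 'n \<Rightarrow> 'b::euclidean_space"
  assumes "open \<Omega>" and v: "locally_integrable \<Omega> v"
    and zero: "\<And>\<phi>. \<phi> \<in> test_functions \<Omega> \<Longrightarrow> integral\<^sup>L (lebesgue_on \<Omega>) (\<lambda>x. \<phi> x *\<^sub>R v x) = 0"
  shows "AE x in lebesgue_on \<Omega>. v x = 0"
proof -
  have box0: "set_lebesgue_integral lebesgue (box a b) v = 0" if ab: "cbox a b \<subseteq> \<Omega>" for a b
  proof -
    obtain \<phi> where \<phi>: "\<And>n. \<phi> n \<in> test_functions \<Omega>" "\<And>n x. 0 \<le> \<phi> n x" "\<And>n x. \<phi> n x \<le> 1"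
      "\<And>n x. x \<notin> box a b \<Longrightarrow> \<phi> n x = 0" "\<And>x. (\<lambda>n. \<phi> n x) \<longlonglongrightarrow> indicator (box a b) x"
      using box_bump_sequence[OF ab] by blast
    have int: "integrable lebesgue (\<lambda>x. indicator (cbox a b) x *\<^sub>R v x)"
      using v ab compact_cbox by (auto simp: locally_integrable_def set_integrable_def)
    have "(\<lambda>n. integral\<^sup>L lebesgue (\<lambda>x. \<phi> n x *\<^sub>R (indicator (cbox a b) x *\<^sub>R v x))) \<longlonglongrightarrow>
        integral\<^sup>L lebesgue (\<lambda>x. indicator (box a b) x *\<^sub>R (indicator (cbox a b) x *\<^sub>R v x))"
    proof (rule integral_dominated_convergence[where w = "\<lambda>x. norm (indicator (cbox a b) x *\<^sub>R v x)"])
      show "(\<lambda>x. \<phi> n x *\<^sub>R (indicator (cbox a b) x *\<^sub>R v x)) \<in> borel_measurable lebesgue" for n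
        by (rule borel_measurable_scaleR[OF test_functions_measurable(2)[OF \<phi>(1)] borel_measurable_integrable[OF int]])
      show "AE x in lebesgue. norm (\<phi> n x *\<^sub>R indicat_real (cbox a b) x *\<^sub>R v x)
          \<le> norm (indicat_real (cbox a b) x *\<^sub>R v x)" for n
        using \<phi>(2,3) by (intro AE_I2) (auto simp: indicator_def intro!: mult_left_le_one_le)
      show "(\<lambda>x. indicator (box a b) x *\<^sub>R (indicator (cbox a b) x *\<^sub>R v x)) \<in> borel_measurable lebesgue"
        by (intro borel_measurable_integrable integrable_mult_indicator int) auto
      show "integrable lebesgue (\<lambda>x. norm (indicator (cbox a b) x *\<^sub>R v x))"
        using int by (rule integrable_norm)
      show "AE x in lebesgue. (\<lambda>n. \<phi> n x *\<^sub>R indicator (cbox a b) x *\<^sub>R v x)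
          \<longlonglongrightarrow> indicator (box a b) x *\<^sub>R indicator (cbox a b) x *\<^sub>R v x"
        by (intro AE_I2 tendsto_scaleR \<phi>(5) tendsto_const)
    qed
    moreover have "integral\<^sup>L lebesgue (\<lambda>x. \<phi> n x *\<^sub>R (indicator (cbox a b) x *\<^sub>R v x)) = 0" for n
    proof -
      have "\<phi> n x *\<^sub>R (indicator (cbox a b) x *\<^sub>R v x) = indicator \<Omega> x *\<^sub>R (\<phi> n x *\<^sub>R v x)" for x
        using \<phi>(4)[of x n] ab box_subset_cbox[of a b] by (cases "x \<in> box a b") (auto simp: indicator_def)
      moreover have "integral\<^sup>L lebesgue (\<lambda>x. indicator \<Omega> x *\<^sub>R (\<phi> n x *\<^sub>R v x)) = 0"
        using zero[OF \<phi>(1)[of n]] \<open>open \<Omega>\<close> by (simp add: integral_restrict_space)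
      ultimately show ?thesis by (simp only:)
    qed
    ultimately have "integral\<^sup>L lebesgue (\<lambda>x. indicator (box a b) x *\<^sub>R (indicator (cbox a b) x *\<^sub>R v x)) = 0"
      by (simp add: LIMSEQ_const_iff)
    moreover have "indicator (box a b) x *\<^sub>R (indicator (cbox a b) x *\<^sub>R v x) = indicator (box a b) x *\<^sub>R v x" for x
      using box_subset_cbox[of a b] by (auto simp: indicator_def)
    ultimately show ?thesis unfolding set_lebesgue_integral_def by (simp only:)
  qed
  have ae: "AE x in lebesgue. x \<in> box a b \<longrightarrow> v x = 0" if ab: "cbox a b \<subseteq> \<Omega>" for a b
  proof -
    have int: "integrable lebesgue (\<lambda>x. indicator (cbox a b) x *\<^sub>R v x)"
      using v ab compact_cbox by (auto simp: locally_integrable_def set_integrable_def)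
    have "integrable lebesgue (\<lambda>x. indicator (box a b) x *\<^sub>R (indicator (cbox a b) x *\<^sub>R v x))"
      by (rule integrable_mult_indicator[OF _ int]) auto
    moreover have "indicator (box a b) x *\<^sub>R (indicator (cbox a b) x *\<^sub>R v x) = indicator (box a b) x *\<^sub>R v x" for x
      using box_subset_cbox[of a b] by (auto simp: indicator_def)
    ultimately have "integrable lebesgue (\<lambda>x. indicator (box a b) x *\<^sub>R v x)" by (simp only:)
    then have "AE x in lebesgue. indicator (box a b) x *\<^sub>R v x = 0"
    proof (rule integrable_zero_on_boxes)
      fix c d :: "real ^ 'n"
      \<comment> \<open>The criterion is applied to \<open>v\<close> cut off to
        \<open>box a b\<close>. Its integral over another box is the integral of \<open>v\<close>
        over the intersection, again a box, whose closure stays in \<open>cbox a b\<close>.\<close>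
      obtain a' b' where eq: "box c d \<inter> box a b = box a' b'"
        using box_Int_box[of c d a b] by blast
      have "set_lebesgue_integral lebesgue (box c d) (\<lambda>x. indicat_real (box a b) x *\<^sub>R v x)
          = set_lebesgue_integral lebesgue (box a' b') v"
        unfolding set_lebesgue_integral_def eq[symmetric]
        by (rule Bochner_Integration.integral_cong) (auto simp: indicator_def)
      also have "\<dots> = 0"
      proof (cases "box a' b' = {}")
        case False
        then have "cbox a' b' = closure (box c d \<inter> box a b)" unfolding eq by (rule closure_box[symmetric])
        also have "\<dots> \<subseteq> cbox a b" using box_subset_cbox[of a b] by (intro closure_minimal) auto
        finally show ?thesis using box0 ab by blast
      qed (simp add: set_lebesgue_integral_def)
      finally show "set_lebesgue_integral lebesgue (box c d) (\<lambda>x. indicat_real (box a b) x *\<^sub>R v x) = 0" .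
    qed
    then show ?thesis by eventually_elim (simp add: indicator_def)
  qed
  obtain \<D> where D: "countable \<D>" "\<D> \<subseteq> Pow \<Omega>" "\<And>X. X \<in> \<D> \<Longrightarrow> \<exists>a b. X = cbox a b" "\<Union>\<D> = \<Omega>"
    by (rule open_countable_Union_open_cbox[OF \<open>open \<Omega>\<close>]) blast
  have "AE x in lebesgue. \<forall>X\<in>\<D>. x \<in> X \<longrightarrow> v x = 0"
  proof (unfold AE_ball_countable[OF D(1)], rule ballI)
    fix X assume "X \<in> \<D>"
    then have "X \<subseteq> \<Omega>" using D(2) by auto
    obtain a b where X: "X = cbox a b" using D(3)[OF \<open>X \<in> \<D>\<close>] by auto
    \<comment> \<open>The cover consists of closed boxes, whereas \<open>ae\<close> speaks of open
      ones; the faces form a null set.\<close>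
    have "AE x in lebesgue. x \<notin> cbox a b - box a b"
      using null_sets_cbox_Diff_box[of a b] by (intro AE_completion AE_not_in)
    with ae[OF \<open>X \<subseteq> \<Omega>\<close>[unfolded X]] show "AE x in lebesgue. x \<in> X \<longrightarrow> v x = 0"
      unfolding X by eventually_elim blast
  qed
  then have "AE x in lebesgue. x \<in> \<Omega> \<longrightarrow> v x = 0"
    unfolding D(4)[symmetric] by eventually_elim blast
  then show ?thesis using \<open>open \<Omega>\<close> by (subst AE_restrict_space_iff) auto
qed

text \<open>\<open>sobolev_W01\<close> provides one weak gradient with an approximating sequence,
  while the inequality is formulated with an arbitrary one. This lemma identifies the two.\<close>

lemma has_weak_gradient_unique:
  assumes "open \<Omega>" "has_weak_gradient \<Omega> u D1" "has_weak_gradient \<Omega> u D2"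
  shows "AE x in lebesgue_on \<Omega>. D1 x = D2 x"
proof -
  have l: "locally_integrable \<Omega> D1" "locally_integrable \<Omega> D2"
    using assms by (auto simp: has_weak_gradient_def)
  have "AE x in lebesgue_on \<Omega>. D1 x - D2 x = 0"
  proof (rule fundamental_lemma_calculus_of_variations[OF assms(1)])
    show "locally_integrable \<Omega> (\<lambda>x. D1 x - D2 x)"
      using l unfolding locally_integrable_def by (blast intro: set_integral_diff(1))
    fix \<phi> assume \<phi>: "\<phi> \<in> test_functions \<Omega>"
    have "integral\<^sup>L (lebesgue_on \<Omega>) (\<lambda>x. u x *\<^sub>R grad \<phi> x) = - integral\<^sup>L (lebesgue_on \<Omega>) (\<lambda>x. \<phi> x *\<^sub>R D1 x)"
      using assms(2) \<phi> unfolding has_weak_gradient_def by blast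
    moreover have "integral\<^sup>L (lebesgue_on \<Omega>) (\<lambda>x. u x *\<^sub>R grad \<phi> x) = - integral\<^sup>L (lebesgue_on \<Omega>) (\<lambda>x. \<phi> x *\<^sub>R D2 x)"
      using assms(3) \<phi> unfolding has_weak_gradient_def by blast
    ultimately have "integral\<^sup>L (lebesgue_on \<Omega>) (\<lambda>x. \<phi> x *\<^sub>R D1 x) - integral\<^sup>L (lebesgue_on \<Omega>) (\<lambda>x. \<phi> x *\<^sub>R D2 x) = 0"
      by simp
    also have "integral\<^sup>L (lebesgue_on \<Omega>) (\<lambda>x. \<phi> x *\<^sub>R D1 x) - integral\<^sup>L (lebesgue_on \<Omega>) (\<lambda>x. \<phi> x *\<^sub>R D2 x)
        = integral\<^sup>L (lebesgue_on \<Omega>) (\<lambda>x. \<phi> x *\<^sub>R D1 x - \<phi> x *\<^sub>R D2 x)"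
      using locally_integrable_mult_test[OF assms(1) l(1) \<phi>] locally_integrable_mult_test[OF assms(1) l(2) \<phi>]
      by (rule Bochner_Integration.integral_diff[symmetric])
    finally show "integral\<^sup>L (lebesgue_on \<Omega>) (\<lambda>x. \<phi> x *\<^sub>R (D1 x - D2 x)) = 0"
      by (simp only: scaleR_diff_right)
  qed
  then show ?thesis by simp
qed

subsection \<open>A Sobolev inequality for functions supported in a set of small measure\<close>

lemma nn_integral_lborel_translate:
  fixes f :: "'a::euclidean_space \<Rightarrow> ennreal"
  assumes "f \<in> borel_measurable borel"
  shows "(\<integral>\<^sup>+x. f (x + z) \<partial>lborel) = (\<integral>\<^sup>+x. f x \<partial>lborel)"
proof -
  have "(\<integral>\<^sup>+x. f x \<partial>lborel) = (\<integral>\<^sup>+x. f x \<partial>distr lborel borel ((+) z))"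
    by (simp add: lborel_distr_plus)
  also have "\<dots> = (\<integral>\<^sup>+x. f (z + x) \<partial>lborel)"
    using assms by (intro nn_integral_distr) auto
  finally show ?thesis by (simp add: add.commute)
qed

text \<open>By the fundamental theorem of calculus along the segment from x to x + z, |w(x + z) -
  w(x)| is at most |z| times the integral of |Dw(x + t z)| over t in [0,1]. Fubini and translation
  invariance then remove t.\<close>

lemma nn_integral_translate_diff_le:
  fixes w :: "'a::euclidean_space \<Rightarrow> real"
  assumes der: "\<And>x. (w has_derivative (\<lambda>v. Dw x \<bullet> v)) (at x)" and cont: "continuous_on UNIV Dw"
  shows "(\<integral>\<^sup>+x. ennreal \<bar>w (x + z) - w x\<bar> \<partial>lborel) \<le> ennreal (norm z) * (\<integral>\<^sup>+x. ennreal (norm (Dw x)) \<partial>lborel)"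
proof -
  have [measurable]: "Dw \<in> borel_measurable borel"
    using cont by (rule borel_measurable_continuous_onI)
  have pointwise: "ennreal \<bar>w (x + z) - w x\<bar> \<le>
      (\<integral>\<^sup>+t. ennreal (norm z) * (indicator {0..1} t * ennreal (norm (Dw (x + t *\<^sub>R z)))) \<partial>lborel)" for x
  proof -
    have c: "continuous_on {0..1} (\<lambda>t. Dw (x + t *\<^sub>R z))"
      by (intro continuous_on_compose2[OF cont] continuous_intros) auto
    have "((\<lambda>t. w (x + t *\<^sub>R z)) has_vector_derivative (Dw (x + t *\<^sub>R z) \<bullet> z)) (at t within {0..1})" for t
    proof -
      have "((\<lambda>t. w (x + t *\<^sub>R z)) has_derivative (\<lambda>s. Dw (x + t *\<^sub>R z) \<bullet> (s *\<^sub>R z))) (at t within {0..1})"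
        by (rule has_derivative_compose[OF _ der]) (auto intro!: derivative_eq_intros)
      then show ?thesis by (simp add: has_vector_derivative_def)
    qed
    then have "((\<lambda>t. Dw (x + t *\<^sub>R z) \<bullet> z) has_integral (w (x + 1 *\<^sub>R z) - w (x + 0 *\<^sub>R z))) {0..1}"
      by (intro fundamental_theorem_of_calculus) auto
    then have eq: "integral {0..1} (\<lambda>t. Dw (x + t *\<^sub>R z) \<bullet> z) = w (x + z) - w x"
      by (simp add: integral_unique)
    let ?I = "integral {0..1} (\<lambda>t. norm z * norm (Dw (x + t *\<^sub>R z)))"
    have int: "(\<lambda>t. norm z * norm (Dw (x + t *\<^sub>R z))) integrable_on {0..1}"
      by (intro integrable_continuous_interval continuous_intros c)
    have "norm (integral {0..1} (\<lambda>t. Dw (x + t *\<^sub>R z) \<bullet> z)) \<le> ?I"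
    proof (rule integral_norm_bound_integral[OF _ int])
      show "(\<lambda>t. Dw (x + t *\<^sub>R z) \<bullet> z) integrable_on {0..1}"
        by (intro integrable_continuous_interval continuous_intros c)
      show "norm (Dw (x + t *\<^sub>R z) \<bullet> z) \<le> norm z * norm (Dw (x + t *\<^sub>R z))" for t
        using Cauchy_Schwarz_ineq2[of "Dw (x + t *\<^sub>R z)" z] by (simp add: mult.commute)
    qed
    then have "ennreal \<bar>w (x + z) - w x\<bar> \<le> ennreal ?I"
      unfolding eq by (simp add: ennreal_leI)
    also have "ennreal ?I = (\<integral>\<^sup>+t. ennreal (indicator {0..1} t * (norm z * norm (Dw (x + t *\<^sub>R z)))) \<partial>lborel)"
      by (rule nn_integral_has_integral_lebesgue[symmetric]) (use int in \<open>auto simp: has_integral_integral\<close>)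
    also have "\<dots> = (\<integral>\<^sup>+t. ennreal (norm z) * (indicator {0..1} t * ennreal (norm (Dw (x + t *\<^sub>R z)))) \<partial>lborel)"
      by (intro nn_integral_cong) (auto simp: indicator_def ennreal_mult)
    finally show ?thesis .
  qed
  have "(\<integral>\<^sup>+x. ennreal \<bar>w (x + z) - w x\<bar> \<partial>lborel) \<le>
      (\<integral>\<^sup>+x. (\<integral>\<^sup>+t. ennreal (norm z) * (indicator {0..1::real} t * ennreal (norm (Dw (x + t *\<^sub>R z)))) \<partial>lborel) \<partial>lborel)"
    by (intro nn_integral_mono pointwise)
  also have "\<dots> = (\<integral>\<^sup>+t. (\<integral>\<^sup>+x. ennreal (norm z) * (indicator {0..1::real} t * ennreal (norm (Dw (x + t *\<^sub>R z)))) \<partial>lborel) \<partial>lborel)"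
    by (rule lborel_pair.Fubini') measurable
  also have "\<dots> = (\<integral>\<^sup>+t. ennreal (norm z) * (indicator {0..1::real} t * (\<integral>\<^sup>+x. ennreal (norm (Dw x)) \<partial>lborel)) \<partial>lborel)"
    using nn_integral_lborel_translate[of "\<lambda>x. ennreal (norm (Dw x))"]
    by (intro nn_integral_cong) (simp add: nn_integral_cmult)
  also have "\<dots> = ennreal (norm z) * (\<integral>\<^sup>+x. ennreal (norm (Dw x)) \<partial>lborel)"
    by (simp add: nn_integral_cmult nn_integral_multc)
  finally show ?thesis .
qed

text \<open>
  Averaging \<open>|U(x + z) - U(x)|\<close> over \<open>z\<close> in a cube of twice the measure of the support: for every \<open>x\<close>,
  at least half of the translates \<open>U(x + z)\<close> vanish.
\<close>

lemma nn_integral_le_of_translate_diff: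
  fixes U :: "'a::euclidean_space \<Rightarrow> real"
  assumes [measurable]: "U \<in> borel_measurable borel"
    and diff: "\<And>z. (\<integral>\<^sup>+x. ennreal \<bar>U (x + z) - U x\<bar> \<partial>lborel) \<le> ennreal (norm z) * V"
    and m: "emeasure lborel {x. U x \<noteq> 0} = ennreal m" "0 \<le> m"
  shows "(\<integral>\<^sup>+x. ennreal \<bar>U x\<bar> \<partial>lborel) \<le> ennreal (2 * DIM('a) * (2 * m) powr (1 / DIM('a))) * V"
proof (cases "m = 0")
  case True
  then have "AE x in lborel. U x = 0"
    using m by (subst AE_iff_measurable[OF _ refl]) auto
  then have "(\<integral>\<^sup>+x. ennreal \<bar>U x\<bar> \<partial>lborel) = (\<integral>\<^sup>+x. 0 \<partial>(lborel :: 'a measure))"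
    by (intro nn_integral_cong_AE) auto
  then show ?thesis by simp
next
  case False
  with m have "m > 0" by simp
  define l where "l = (2 * m) powr (1 / DIM('a))"
  define Q where "Q = cbox 0 (l *\<^sub>R (One::'a))"
  have "l > 0" using \<open>m > 0\<close> by (simp add: l_def)
  have [measurable]: "Q \<in> sets borel" by (simp add: Q_def)
  have "l ^ DIM('a) = 2 * m"
    using \<open>m > 0\<close> by (simp add: l_def powr_realpow[symmetric] powr_powr)
  then have Q: "emeasure lborel Q = ennreal (2 * m)"
    using \<open>l > 0\<close> unfolding Q_def by (subst emeasure_lborel_cbox) (auto simp: inner_diff_left)
  \<comment> \<open>The l^1 norm dominates the Euclidean norm, which gives the factor
    \<open>DIM('a)\<close> of the final constant; the factor 2 is the ratio of the measure of
    \<open>Q\<close> to \<open>m\<close>.\<close>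
  have norm_Q: "norm z \<le> DIM('a) * l" if "z \<in> Q" for z
  proof -
    have "norm z \<le> (\<Sum>b\<in>Basis. \<bar>z \<bullet> b\<bar>)" by (rule norm_le_l1)
    also have "\<dots> \<le> (\<Sum>b\<in>(Basis::'a set). l)"
      using that by (intro sum_mono) (auto simp: Q_def mem_box abs_le_iff)
    finally show ?thesis by simp
  qed
  have half: "ennreal m \<le> emeasure lborel {z \<in> Q. U (x + z) = 0}" for x
  proof -
    have "emeasure lborel {z. U (x + z) \<noteq> 0} = (\<integral>\<^sup>+z. indicator {z. U z \<noteq> 0} (z + x) \<partial>lborel)"
    proof -
      have "(\<lambda>z. indicator {z. U z \<noteq> 0} (z + x) :: ennreal) = indicator {z. U (x + z) \<noteq> 0}"
        by (auto simp: indicator_def add.commute fun_eq_iff)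
      then show ?thesis by simp
    qed
    also have "\<dots> = ennreal m"
      using m(1) by (subst nn_integral_lborel_translate) auto
    finally have *: "emeasure lborel {z. U (x + z) \<noteq> 0} = ennreal m" .
    have "ennreal (2 * m) \<le> emeasure lborel ({z \<in> Q. U (x + z) = 0} \<union> {z. U (x + z) \<noteq> 0})"
      unfolding Q[symmetric] by (intro emeasure_mono) auto
    also have "\<dots> \<le> emeasure lborel {z \<in> Q. U (x + z) = 0} + emeasure lborel {z. U (x + z) \<noteq> 0}"
      by (intro emeasure_subadditive) auto
    finally have "ennreal m + ennreal m \<le> ennreal m + emeasure lborel {z \<in> Q. U (x + z) = 0}"
      using \<open>m > 0\<close> unfolding * by (simp add: ennreal_plus[symmetric] add.commute del: ennreal_plus)
    then show ?thesis by (simp add: ennreal_add_left_cancel_le)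
  qed
  have "ennreal m * (\<integral>\<^sup>+x. ennreal \<bar>U x\<bar> \<partial>lborel) = (\<integral>\<^sup>+x. ennreal m * ennreal \<bar>U x\<bar> \<partial>lborel)"
    by (simp add: nn_integral_cmult)
  also have "\<dots> \<le> (\<integral>\<^sup>+x. (\<integral>\<^sup>+z. indicator Q z * ennreal \<bar>U (x + z) - U x\<bar> \<partial>lborel) \<partial>lborel)"
  proof (rule nn_integral_mono)
    fix x
    have "ennreal m * ennreal \<bar>U x\<bar> \<le> emeasure lborel {z \<in> Q. U (x + z) = 0} * ennreal \<bar>U x\<bar>"
      by (intro mult_right_mono half) auto
    also have "\<dots> = (\<integral>\<^sup>+z. indicator {z \<in> Q. U (x + z) = 0} z * ennreal \<bar>U x\<bar> \<partial>lborel)"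
      by (simp add: nn_integral_multc)
    also have "\<dots> \<le> (\<integral>\<^sup>+z. indicator Q z * ennreal \<bar>U (x + z) - U x\<bar> \<partial>lborel)"
      by (intro nn_integral_mono) (auto simp: indicator_def)
    finally show "ennreal m * ennreal \<bar>U x\<bar> \<le> \<dots>" .
  qed
  also have "\<dots> = (\<integral>\<^sup>+z. (\<integral>\<^sup>+x. indicator Q z * ennreal \<bar>U (x + z) - U x\<bar> \<partial>lborel) \<partial>lborel)"
    by (rule lborel_pair.Fubini') measurable
  also have "\<dots> \<le> (\<integral>\<^sup>+z. indicator Q z * (ennreal (DIM('a) * l) * V) \<partial>lborel)"
  proof (rule nn_integral_mono)
    fix z
    have "indicator Q z * (\<integral>\<^sup>+x. ennreal \<bar>U (x + z) - U x\<bar> \<partial>lborel) \<le> indicator Q z * (ennreal (DIM('a) * l) * V)"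
    proof (cases "z \<in> Q")
      case True
      have "(\<integral>\<^sup>+x. ennreal \<bar>U (x + z) - U x\<bar> \<partial>lborel) \<le> ennreal (norm z) * V" by (rule diff)
      also have "\<dots> \<le> ennreal (DIM('a) * l) * V"
        by (intro mult_right_mono ennreal_leI norm_Q True) auto
      finally show ?thesis using True by simp
    qed simp
    then show "(\<integral>\<^sup>+x. indicator Q z * ennreal \<bar>U (x + z) - U x\<bar> \<partial>lborel) \<le> indicator Q z * (ennreal (DIM('a) * l) * V)"
      by (simp add: nn_integral_cmult)
  qed
  also have "\<dots> = ennreal (2 * m) * (ennreal (DIM('a) * l) * V)"
    using Q by (simp add: nn_integral_multc)
  also have "\<dots> = ennreal m * (ennreal (2 * DIM('a) * l) * V)"
    using \<open>m > 0\<close> \<open>l > 0\<close> by (simp add: ennreal_mult mult_ac)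
  finally show ?thesis
    using \<open>m > 0\<close> unfolding l_def by (simp add: ennreal_mult_le_mult_iff)
qed

subsection \<open>Measurability and convergence of powers\<close>

lemma borel_measurable_lebesgue_on_AE:
  fixes f g :: "'a::euclidean_space \<Rightarrow> 'b::euclidean_space"
  assumes "f \<in> borel_measurable (lebesgue_on S)" "S \<in> sets lebesgue" "AE x in lebesgue_on S. f x = g x"
  shows "g \<in> borel_measurable (lebesgue_on S)"
proof -
  have "AE x in lebesgue. (if x \<in> S then f x else 0) = (if x \<in> S then g x else 0)"
    using assms(2,3) by (simp add: AE_restrict_space_iff)
  then have "(\<lambda>x. if x \<in> S then g x else 0) \<in> borel_measurable lebesgue"
    by (rule borel_measurable_AE[OF borel_measurable_if_I[OF assms(1,2)]])
  then show ?thesis by (rule borel_measurable_if_D)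
qed

text \<open>If the pair \<open>(u, Du)\<close> is replaced by a simple function, the composition is
  measurable because only finitely many sections \<open>a x s \<xi>\<close> with fixed arguments
  occur. Continuity in those arguments carries this to the limit off a null set.\<close>

lemma caratheodory_measurable:
  fixes u :: "real ^ 'n \<Rightarrow> real" and Du :: "real ^ 'n \<Rightarrow> real ^ 'n"
  assumes "caratheodory \<Omega> a" "\<Omega> \<in> sets lebesgue"
    and u: "u \<in> borel_measurable (lebesgue_on \<Omega>)" and Du: "Du \<in> borel_measurable (lebesgue_on \<Omega>)"
  shows "(\<lambda>x. a x (u x) (Du x)) \<in> borel_measurable (lebesgue_on \<Omega>)"
proof -
  let ?M = "lebesgue_on \<Omega>"
  have "(\<lambda>x. (u x, Du x)) \<in> borel_measurable ?M"
    using u Du by (rule borel_measurable_Pair)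
  then obtain F where F: "\<And>i. simple_function ?M (F i)" "\<And>x. x \<in> space ?M \<Longrightarrow> (\<lambda>i. F i x) \<longlonglongrightarrow> (u x, Du x)"
    using borel_measurable_implies_sequence_metric[of "\<lambda>x. (u x, Du x)" ?M 0] by blast
  have meas: "(\<lambda>x. a x (fst (F i x)) (snd (F i x))) \<in> borel_measurable ?M" for i
  proof (rule measurable_compose_countable'[where I = "F i ` space ?M" and g = "F i" and f = "\<lambda>w x. a x (fst w) (snd w)"])
    show "(\<lambda>x. a x (fst w) (snd w)) \<in> borel_measurable ?M" for w
      using assms(1) by (simp add: caratheodory_def)
    show "F i \<in> ?M \<rightarrow>\<^sub>M count_space (F i ` space ?M)"
      using F(1)[of i] unfolding simple_function_def by (subst measurable_count_space_eq2) auto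
    show "countable (F i ` space ?M)"
      using F(1)[of i] by (auto simp: simple_function_def intro: countable_finite)
  qed
  have "AE x in ?M. continuous_on UNIV (\<lambda>(s, \<xi>). a x s \<xi>)"
    using assms(1) by (simp add: caratheodory_def)
  then obtain N where N: "{x \<in> space ?M. \<not> continuous_on UNIV (\<lambda>(s, \<xi>). a x s \<xi>)} \<subseteq> N" "N \<in> null_sets ?M"
    by (auto simp: eventually_ae_filter)
  have "(\<lambda>x. if x \<in> N then 0 else a x (u x) (Du x)) \<in> borel_measurable ?M"
  proof (rule borel_measurable_LIMSEQ_metric)
    show "(\<lambda>x. if x \<in> N then 0 else a x (fst (F i x)) (snd (F i x))) \<in> borel_measurable ?M" for i
      using N(2) by (intro measurable_If_set meas) auto
    fix x assume x: "x \<in> space ?M"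
    show "(\<lambda>i. if x \<in> N then 0 else a x (fst (F i x)) (snd (F i x))) \<longlonglongrightarrow> (if x \<in> N then 0 else a x (u x) (Du x))"
    proof (cases "x \<in> N")
      case False
      then have "continuous_on UNIV (\<lambda>(s, \<xi>). a x s \<xi>)" using N(1) x by blast
      then have "isCont (\<lambda>(s, \<xi>). a x s \<xi>) (u x, Du x)"
        by (simp add: continuous_on_eq_continuous_at)
      from isCont_tendsto_compose[OF this F(2)[OF x]] False show ?thesis
        by (simp add: case_prod_beta)
    qed simp
  qed
  then show ?thesis
    by (rule borel_measurable_lebesgue_on_AE[OF _ assms(2)]) (use AE_not_in[OF N(2)] in \<open>auto elim!: eventually_mono\<close>)
qed

text \<open>Split at the threshold \<open>s\<close>: below it the first summand dominates, above it
  t^(r-p) <= s^(r-p). With \<open>s\<close> chosen afterwards to balance the two integrated terms,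
  this serves as Hoelder's inequality up to a factor 2.\<close>

lemma powr_le_add_powr:
  fixes t s r p :: real
  assumes "0 < s" "0 \<le> t" "0 \<le> r" "r \<le> p"
  shows "t powr r \<le> s powr r + s powr (r - p) * t powr p"
proof (cases "t \<le> s")
  case True
  then have "t powr r \<le> s powr r" using assms by (intro powr_mono2) auto
  then show ?thesis by (smt (verit) mult_nonneg_nonneg powr_ge_zero)
next
  case False
  then have "t powr (r - p) \<le> s powr (r - p)" using assms by (intro powr_mono2') auto
  then have "t powr (r - p) * t powr p \<le> s powr (r - p) * t powr p" by (intro mult_right_mono) auto
  moreover have "t powr (r - p) * t powr p = t powr r" by (simp add: powr_add[symmetric])
  ultimately show ?thesis by (smt (verit) powr_ge_zero)
qed

lemma (in finite_measure) integrable_powr_le: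
  fixes g :: "'a \<Rightarrow> real"
  assumes g: "g \<in> borel_measurable M" "\<And>x. 0 \<le> g x" and p: "integrable M (\<lambda>x. g x powr p)" "0 \<le> r" "r \<le> p"
  shows "integrable M (\<lambda>x. g x powr r)"
proof (rule Bochner_Integration.integrable_bound)
  show "integrable M (\<lambda>x. 1 + g x powr p)" using p by auto
  show "AE x in M. norm (g x powr r) \<le> norm (1 + g x powr p)"
    using powr_le_add_powr[of 1 "g _" r p] g p by (intro AE_I2) auto
qed (use g in measurable)

lemma (in finite_measure) tendsto_integral_powr_le:
  fixes g :: "nat \<Rightarrow> 'a \<Rightarrow> real"
  assumes g: "\<And>k. g k \<in> borel_measurable M" "\<And>k x. 0 \<le> g k x"
    and p: "\<And>k. integrable M (\<lambda>x. g k x powr p)" "0 < r" "r \<le> p"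
    and lim: "(\<lambda>k. \<integral>x. g k x powr p \<partial>M) \<longlonglongrightarrow> 0"
  shows "(\<lambda>k. \<integral>x. g k x powr r \<partial>M) \<longlonglongrightarrow> 0"
proof (rule LIMSEQ_I)
  fix e :: real assume "0 < e"
  define m where "m = measure M (space M)"
  have "m \<ge> 0" by (simp add: m_def)
  \<comment> \<open>With this threshold the first summand integrates to at most \<open>e / 2\<close>
    for every \<open>k\<close>; for fixed \<open>s\<close> the second one tends to 0.\<close>
  define s where "s = (e / (2 * (m + 1))) powr (1 / r)"
  have "s > 0" using \<open>e > 0\<close> \<open>m \<ge> 0\<close> by (simp add: s_def)
  have sr: "s powr r * m < e / 2 + e / 4"
  proof -
    have "s powr r = e / (2 * (m + 1))" using \<open>e > 0\<close> \<open>m \<ge> 0\<close> p(2) by (simp add: s_def powr_powr)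
    moreover have "e / (2 * (m + 1)) * m \<le> e / 2"
      using \<open>e > 0\<close> \<open>m \<ge> 0\<close> by (simp add: field_simps)
    ultimately have "s powr r * m \<le> e / 2" by (simp only:)
    then show ?thesis using \<open>e > 0\<close> by linarith
  qed
  have "(\<lambda>k. s powr (r - p) * (\<integral>x. g k x powr p \<partial>M)) \<longlonglongrightarrow> s powr (r - p) * 0"
    by (intro tendsto_intros lim)
  then have "eventually (\<lambda>k. s powr (r - p) * (\<integral>x. g k x powr p \<partial>M) < e / 4) sequentially"
    using \<open>e > 0\<close> by (intro order_tendstoD(2)) auto
  then obtain k0 where k0: "\<And>k. k \<ge> k0 \<Longrightarrow> s powr (r - p) * (\<integral>x. g k x powr p \<partial>M) < e / 4"
    by (auto simp: eventually_sequentially)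
  have "norm ((\<integral>x. g k x powr r \<partial>M) - 0) < e" if "k \<ge> k0" for k
  proof -
    have "(\<integral>x. g k x powr r \<partial>M) \<le> (\<integral>x. s powr r + s powr (r - p) * g k x powr p \<partial>M)"
      using g p \<open>s > 0\<close> by (intro integral_mono integrable_powr_le[OF _ _ p(1)] Bochner_Integration.integrable_add powr_le_add_powr) auto
    also have "\<dots> = s powr r * m + s powr (r - p) * (\<integral>x. g k x powr p \<partial>M)"
      using p by (subst Bochner_Integration.integral_add) (auto simp: m_def mult.commute)
    finally have "(\<integral>x. g k x powr r \<partial>M) < e" using sr k0[OF that] by simp
    moreover have "0 \<le> (\<integral>x. g k x powr r \<partial>M)" by simp
    ultimately show ?thesis by (simp add: abs_less_iff)
  qed
  then show "\<exists>k0. \<forall>k\<ge>k0. norm ((\<integral>x. g k x powr r \<partial>M) - 0) < e" by blast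
qed

lemma powr_add_le: "0 \<le> p \<Longrightarrow> 0 \<le> a \<Longrightarrow> 0 \<le> b \<Longrightarrow> (a + b) powr p \<le> 2 powr p * (a powr p + b powr p)"
  for a b p :: real
proof -
  assume *: "0 \<le> p" "0 \<le> a" "0 \<le> b"
  have "(a + b) powr p \<le> (2 * max a b) powr p" using * by (intro powr_mono2) auto
  also have "\<dots> = 2 powr p * max a b powr p" using * by (simp add: powr_mult)
  also have "max a b powr p \<le> a powr p + b powr p" by (auto simp: max_def)
  finally show ?thesis by (simp add: mult_left_mono)
qed

text \<open>Young's inequality |b d| <= s b^2 + d^2 / s, where \<open>s\<close> is fixed small
  against the integral of b^2 before \<open>k\<close> grows. It is applied with \<open>b\<close> the
  norm of the drift and \<open>d k\<close> the norm of the gradient error.\<close>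

lemma tendsto_integral_mult_0:
  fixes b :: "'a \<Rightarrow> real" and d :: "nat \<Rightarrow> 'a \<Rightarrow> real"
  assumes [measurable]: "b \<in> borel_measurable M" "\<And>k. d k \<in> borel_measurable M"
    and b: "integrable M (\<lambda>x. (b x)\<^sup>2)" and d: "\<And>k. integrable M (\<lambda>x. (d k x)\<^sup>2)"
    and lim: "(\<lambda>k. \<integral>x. (d k x)\<^sup>2 \<partial>M) \<longlonglongrightarrow> 0"
  shows "\<And>k. integrable M (\<lambda>x. \<bar>b x\<bar> * \<bar>d k x\<bar>)" "(\<lambda>k. \<integral>x. \<bar>b x\<bar> * \<bar>d k x\<bar> \<partial>M) \<longlonglongrightarrow> 0"
proof -
  have young: "\<bar>b x\<bar> * \<bar>d k x\<bar> \<le> e * (b x)\<^sup>2 + (1 / e) * (d k x)\<^sup>2" if "e > 0" for e k x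
  proof -
    have "0 \<le> (sqrt e * \<bar>b x\<bar> - \<bar>d k x\<bar> / sqrt e)\<^sup>2" by simp
    also have "\<dots> = e * (b x)\<^sup>2 + (1 / e) * (d k x)\<^sup>2 - 2 * (\<bar>b x\<bar> * \<bar>d k x\<bar>)"
      using that by (simp add: power2_diff power_mult_distrib power_divide)
    finally have "2 * (\<bar>b x\<bar> * \<bar>d k x\<bar>) \<le> e * (b x)\<^sup>2 + (1 / e) * (d k x)\<^sup>2" by simp
    moreover have "0 \<le> \<bar>b x\<bar> * \<bar>d k x\<bar>" by simp
    ultimately show ?thesis by linarith
  qed
  show int: "integrable M (\<lambda>x. \<bar>b x\<bar> * \<bar>d k x\<bar>)" for k
  proof (rule Bochner_Integration.integrable_bound)
    show "integrable M (\<lambda>x. 1 * (b x)\<^sup>2 + (1 / 1) * (d k x)\<^sup>2)" using b d by auto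
    show "AE x in M. norm (\<bar>b x\<bar> * \<bar>d k x\<bar>) \<le> norm (1 * (b x)\<^sup>2 + 1 / 1 * (d k x)\<^sup>2)"
      using young[of 1] by (intro AE_I2) (simp add: abs_mult)
  qed measurable
  show "(\<lambda>k. \<integral>x. \<bar>b x\<bar> * \<bar>d k x\<bar> \<partial>M) \<longlonglongrightarrow> 0"
  proof (rule LIMSEQ_I)
    fix e :: real assume "0 < e"
    define B where "B = (\<integral>x. (b x)\<^sup>2 \<partial>M)"
    have "B \<ge> 0" by (simp add: B_def)
    define s where "s = e / (2 * (B + 1))"
    have "s > 0" using \<open>e > 0\<close> \<open>B \<ge> 0\<close> by (simp add: s_def)
    have sB: "s * B \<le> e / 2" using \<open>e > 0\<close> \<open>B \<ge> 0\<close> by (simp add: s_def field_simps)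
    have "(\<lambda>k. (1 / s) * (\<integral>x. (d k x)\<^sup>2 \<partial>M)) \<longlonglongrightarrow> (1 / s) * 0" by (intro tendsto_intros lim)
    then have "eventually (\<lambda>k. (1 / s) * (\<integral>x. (d k x)\<^sup>2 \<partial>M) < e / 2) sequentially"
      using \<open>e > 0\<close> by (intro order_tendstoD(2)) auto
    then obtain k0 where k0: "\<And>k. k \<ge> k0 \<Longrightarrow> (1 / s) * (\<integral>x. (d k x)\<^sup>2 \<partial>M) < e / 2"
      by (auto simp: eventually_sequentially)
    have "norm ((\<integral>x. \<bar>b x\<bar> * \<bar>d k x\<bar> \<partial>M) - 0) < e" if "k \<ge> k0" for k
    proof -
      have "(\<integral>x. \<bar>b x\<bar> * \<bar>d k x\<bar> \<partial>M) \<le> (\<integral>x. s * (b x)\<^sup>2 + (1 / s) * (d k x)\<^sup>2 \<partial>M)"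
        using b d \<open>s > 0\<close> by (intro integral_mono int young) auto
      also have "\<dots> = s * B + (1 / s) * (\<integral>x. (d k x)\<^sup>2 \<partial>M)"
        using b d unfolding B_def
        by (subst Bochner_Integration.integral_add) (simp_all only: integrable_mult_right integral_mult_right_zero)
      finally have "(\<integral>x. \<bar>b x\<bar> * \<bar>d k x\<bar> \<partial>M) < e" using sB k0[OF that] by linarith
      moreover have "0 \<le> (\<integral>x. \<bar>b x\<bar> * \<bar>d k x\<bar> \<partial>M)" by simp
      ultimately show ?thesis by simp
    qed
    then show "\<exists>k0. \<forall>k\<ge>k0. norm ((\<integral>x. \<bar>b x\<bar> * \<bar>d k x\<bar> \<partial>M) - 0) < e" by blast
  qed
qed

section \<open>Approximation of a Sobolev function by test functions\<close>

lemma test_functions_measurable_on: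
  assumes "\<phi> \<in> test_functions \<Omega>"
  shows "\<phi> \<in> borel_measurable (lebesgue_on A)" "grad \<phi> \<in> borel_measurable (lebesgue_on A)"
proof -
  have "grad \<phi> \<in> borel_measurable lebesgue"
    using test_functions_continuous_grad[OF assms, of UNIV]
    by (intro measurable_completion) (simp add: borel_measurable_continuous_onI)
  then show "\<phi> \<in> borel_measurable (lebesgue_on A)" "grad \<phi> \<in> borel_measurable (lebesgue_on A)"
    using test_functions_measurable(2)[OF assms] by (auto intro: measurable_restrict_space1)
qed

text \<open>The approximating sequence comes with some weak gradient \<open>Dv\<close>, and
  uniqueness transfers its properties to the given \<open>Du\<close>. Convergence in L^p on a
  bounded set implies convergence in L^1, from which a subsequence converging almost everywhere is
  extracted.\<close>

lemma sobolev_W01_approximation: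
  fixes u :: "real ^ 'n \<Rightarrow> real" and Du :: "real ^ 'n \<Rightarrow> real ^ 'n" and \<Omega> :: "(real ^ 'n) set"
  defines "M \<equiv> lebesgue_on \<Omega>"
  assumes \<Omega>: "open \<Omega>" "bounded \<Omega>" and p: "p > 2"
    and u: "u \<in> sobolev_W01 \<Omega> p" "has_weak_gradient \<Omega> u Du"
  shows "u \<in> borel_measurable M" "Du \<in> borel_measurable M"
    "integrable M (\<lambda>x. \<bar>u x\<bar>)" "integrable M (\<lambda>x. norm (Du x) powr p)"
    and "\<exists>\<phi>. (\<forall>k. \<phi> k \<in> test_functions \<Omega>) \<and> (AE x in M. (\<lambda>k. \<phi> k x) \<longlonglongrightarrow> u x) \<and>
      (\<forall>k. integrable M (\<lambda>x. norm (grad (\<phi> k) x - Du x) powr p)) \<and>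
      (\<lambda>k. \<integral>x. norm (grad (\<phi> k) x - Du x) powr p \<partial>M) \<longlonglongrightarrow> 0"
proof -
  have \<Omega>_lm: "\<Omega> \<in> lmeasurable" by (rule lmeasurable_open[OF \<Omega>(2,1)])
  then have \<Omega>_sets: "\<Omega> \<in> sets lebesgue" by auto
  interpret finite_measure M unfolding M_def by (rule finite_measure_lebesgue_on[OF \<Omega>_lm])
  obtain Dv \<psi> where u_Lp: "u \<in> Lp_space M (ereal p)" and Dv: "Dv \<in> Lp_space M (ereal p)"
    and Dv_grad: "has_weak_gradient \<Omega> u Dv"
    and \<psi>: "\<And>k. \<psi> k \<in> test_functions \<Omega>"
    and lim_u: "(\<lambda>k. Lp_norm M (ereal p) (\<lambda>x. \<psi> k x - u x)) \<longlonglongrightarrow> 0"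
    and lim_D: "(\<lambda>k. Lp_norm M (ereal p) (\<lambda>x. grad (\<psi> k) x - Dv x)) \<longlonglongrightarrow> 0"
    using u(1) unfolding sobolev_W01_def M_def[symmetric] mem_Collect_eq by (elim conjE bexE exE) blast
  have eq: "AE x in M. Dv x = Du x"
    unfolding M_def by (rule has_weak_gradient_unique[OF \<Omega>(1) Dv_grad u(2)])
  have Dv_m: "Dv \<in> borel_measurable M" and Dv_int: "integrable M (\<lambda>x. norm (Dv x) powr p)"
    using Dv by (auto simp: Lp_space_def)
  show u_m: "u \<in> borel_measurable M" using u_Lp by (auto simp: Lp_space_def)
  have u_int: "integrable M (\<lambda>x. \<bar>u x\<bar> powr p)" using u_Lp by (auto simp: Lp_space_def)
  show Du_m: "Du \<in> borel_measurable M"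
    unfolding M_def by (rule borel_measurable_lebesgue_on_AE[OF Dv_m[unfolded M_def] \<Omega>_sets eq[unfolded M_def]])
  show "integrable M (\<lambda>x. \<bar>u x\<bar>)"
    using integrable_powr_le[OF _ _ u_int, of 1] u_m p by simp
  show Du_int: "integrable M (\<lambda>x. norm (Du x) powr p)"
  proof (rule integrable_cong_AE_imp[OF Dv_int])
    show "(\<lambda>x. norm (Du x) powr p) \<in> borel_measurable M" using Du_m by measurable
    show "AE x in M. norm (Dv x) powr p = norm (Du x) powr p" using eq by eventually_elim simp
  qed
  note [measurable] = test_functions_measurable_on[OF \<psi>, of _ \<Omega>, folded M_def] u_m Du_m Dv_m
  have int_diff: "integrable M (\<lambda>x. norm (f x - g x) powr p)"
    if [measurable]: "f \<in> borel_measurable M" "g \<in> borel_measurable M" and f: "\<And>x. norm (f x) \<le> B"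
      and g: "integrable M (\<lambda>x. norm (g x) powr p)" for f g :: "real ^ 'n \<Rightarrow> 'b::euclidean_space" and B
  proof (rule Bochner_Integration.integrable_bound)
    show "integrable M (\<lambda>x. 2 powr p * (B powr p + norm (g x) powr p))"
      using g by (intro integrable_mult_right Bochner_Integration.integrable_add) auto
    show "AE x in M. norm (norm (f x - g x) powr p) \<le> norm (2 powr p * (B powr p + norm (g x) powr p))"
    proof (rule AE_I2)
      fix x
      have "norm (f x - g x) powr p \<le> (norm (f x) + norm (g x)) powr p"
        using p by (intro powr_mono2 norm_triangle_ineq4) auto
      also have "\<dots> \<le> 2 powr p * (norm (f x) powr p + norm (g x) powr p)"
        using p by (intro powr_add_le) auto
      also have "\<dots> \<le> 2 powr p * (B powr p + norm (g x) powr p)"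
        using f p by (intro mult_left_mono add_right_mono powr_mono2) auto
      finally show "norm (norm (f x - g x) powr p) \<le> norm (2 powr p * (B powr p + norm (g x) powr p))" by simp
    qed
  qed measurable
  have int_u: "integrable M (\<lambda>x. \<bar>\<psi> k x - u x\<bar> powr p)" for k
  proof -
    obtain B where "\<And>x. \<bar>\<psi> k x\<bar> \<le> B" "\<And>x. norm (grad (\<psi> k) x) \<le> B" using test_functions_bounded[OF \<psi>[of k]] by blast
    then show ?thesis using int_diff[of "\<psi> k" u B] u_int by simp
  qed
  have int_D: "integrable M (\<lambda>x. norm (grad (\<psi> k) x - Du x) powr p)" for k
  proof -
    obtain B where "\<And>x. \<bar>\<psi> k x\<bar> \<le> B" "\<And>x. norm (grad (\<psi> k) x) \<le> B" using test_functions_bounded[OF \<psi>[of k]] by blast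
    then show ?thesis using int_diff[of "grad (\<psi> k)" Du B] Du_int by simp
  qed
  have unpow: "X \<longlonglongrightarrow> 0" if "(\<lambda>k. X k powr (1 / p)) \<longlonglongrightarrow> 0" "\<And>k. 0 \<le> X k" for X :: "nat \<Rightarrow> real"
  proof -
    have "(\<lambda>k. (X k powr (1 / p)) powr p) \<longlonglongrightarrow> 0 powr p"
      by (rule tendsto_powr'[OF that(1) tendsto_const]) (use p in auto)
    moreover have "(X k powr (1 / p)) powr p = X k" for k
      using p that(2)[of k] by (simp add: powr_powr)
    ultimately show ?thesis using p by simp
  qed
  have "(\<lambda>k. \<integral>x. \<bar>\<psi> k x - u x\<bar> powr p \<partial>M) \<longlonglongrightarrow> 0"
  proof (rule unpow)
    show "(\<lambda>k. (\<integral>x. \<bar>\<psi> k x - u x\<bar> powr p \<partial>M) powr (1 / p)) \<longlonglongrightarrow> 0"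
      using lim_u by (simp add: Lp_norm_def)
  qed simp
  then have "(\<lambda>k. \<integral>x. \<bar>\<psi> k x - u x\<bar> powr 1 \<partial>M) \<longlonglongrightarrow> 0"
  proof (rule tendsto_integral_powr_le[rotated -1])
    show "(\<lambda>x. \<bar>\<psi> k x - u x\<bar>) \<in> borel_measurable M" for k by measurable
  qed (use int_u p in simp_all)
  moreover have "integrable M (\<lambda>x. \<psi> k x - u x)" for k
  proof -
    have "integrable M (\<lambda>x. \<bar>\<psi> k x - u x\<bar> powr 1)"
      by (rule integrable_powr_le[OF _ _ int_u]) (use p in simp_all)
    then have "integrable M (\<lambda>x. norm (\<psi> k x - u x))" by simp
    then show ?thesis by (rule integrable_norm_cancel) measurable
  qed
  ultimately obtain r :: "nat \<Rightarrow> nat" where r: "strict_mono r" "AE x in M. (\<lambda>n. \<psi> (r n) x - u x) \<longlonglongrightarrow> 0"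
    using tendsto_L1_AE_subseq[of M "\<lambda>k x. \<psi> k x - u x"] by fastforce
  have "(\<lambda>k. \<integral>x. norm (grad (\<psi> k) x - Dv x) powr p \<partial>M) \<longlonglongrightarrow> 0"
  proof (rule unpow)
    show "(\<lambda>k. (\<integral>x. norm (grad (\<psi> k) x - Dv x) powr p \<partial>M) powr (1 / p)) \<longlonglongrightarrow> 0"
      using lim_D by (simp add: Lp_norm_def)
  qed simp
  moreover have "(\<integral>x. norm (grad (\<psi> k) x - Dv x) powr p \<partial>M) = (\<integral>x. norm (grad (\<psi> k) x - Du x) powr p \<partial>M)" for k
  proof (rule integral_cong_AE)
    show "AE x in M. norm (grad (\<psi> k) x - Dv x) powr p = norm (grad (\<psi> k) x - Du x) powr p"
      using eq by eventually_elim simp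
  qed measurable
  ultimately have D: "(\<lambda>k. \<integral>x. norm (grad (\<psi> k) x - Du x) powr p \<partial>M) \<longlonglongrightarrow> 0" by simp
  show "\<exists>\<phi>. (\<forall>k. \<phi> k \<in> test_functions \<Omega>) \<and> (AE x in M. (\<lambda>k. \<phi> k x) \<longlonglongrightarrow> u x) \<and>
      (\<forall>k. integrable M (\<lambda>x. norm (grad (\<phi> k) x - Du x) powr p)) \<and>
      (\<lambda>k. \<integral>x. norm (grad (\<phi> k) x - Du x) powr p \<partial>M) \<longlonglongrightarrow> 0"
  proof (intro exI[of _ "\<lambda>k. \<psi> (r k)"] conjI allI)
    show "AE x in M. (\<lambda>k. \<psi> (r k) x) \<longlonglongrightarrow> u x"
      using r(2) by eventually_elim (simp add: LIM_zero_iff)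
    show "(\<lambda>k. \<integral>x. norm (grad (\<psi> (r k)) x - Du x) powr p \<partial>M) \<longlonglongrightarrow> 0"
      using LIMSEQ_subseq_LIMSEQ[OF D r(1)] by (simp add: o_def)
  qed (rule \<psi> int_D)+
qed

subsection \<open>Testing with functions of the solution\<close>

text \<open>Pointwise convergence of \<open>\<phi> k\<close> handles bounded continuous functions of
  \<open>\<phi> k\<close>, and strong convergence of the gradients handles the one factor that is
  not a function of \<open>\<phi> k\<close>. Since p > 2, the gradients also converge in L^2 and in
  L^1.\<close>

locale W01_approximation =
  fixes \<Omega> :: "(real ^ 'n) set" and p :: real and u :: "real ^ 'n \<Rightarrow> real" and Du :: "real ^ 'n \<Rightarrow> real ^ 'n"
    and \<phi> :: "nat \<Rightarrow> real ^ 'n \<Rightarrow> real"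
  assumes \<Omega>: "open \<Omega>" "bounded \<Omega>" and p_gt_2: "p > 2"
    and u_measurable: "u \<in> borel_measurable (lebesgue_on \<Omega>)"
    and Du_measurable: "Du \<in> borel_measurable (lebesgue_on \<Omega>)"
    and u_integrable: "integrable (lebesgue_on \<Omega>) (\<lambda>x. \<bar>u x\<bar>)"
    and Du_integrable: "integrable (lebesgue_on \<Omega>) (\<lambda>x. norm (Du x) powr p)"
    and test: "\<And>k. \<phi> k \<in> test_functions \<Omega>"
    and lim: "AE x in lebesgue_on \<Omega>. (\<lambda>k. \<phi> k x) \<longlonglongrightarrow> u x"
    and grad_integrable: "\<And>k. integrable (lebesgue_on \<Omega>) (\<lambda>x. norm (grad (\<phi> k) x - Du x) powr p)"
    and grad_lim: "(\<lambda>k. \<integral>x. norm (grad (\<phi> k) x - Du x) powr p \<partial>lebesgue_on \<Omega>) \<longlonglongrightarrow> 0"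
begin

abbreviation M :: "(real ^ 'n) measure" where "M \<equiv> lebesgue_on \<Omega>"

lemma \<Omega>_lmeasurable: "\<Omega> \<in> lmeasurable"
  by (rule lmeasurable_open[OF \<Omega>(2,1)])

lemma \<Omega>_sets: "\<Omega> \<in> sets lebesgue"
  using \<Omega>_lmeasurable by auto

sublocale finite_measure M
  by (rule finite_measure_lebesgue_on[OF \<Omega>_lmeasurable])

lemmas [measurable] = u_measurable Du_measurable test_functions_measurable_on[OF test, of _ \<Omega>]

lemma Du_powers:
  "integrable M (\<lambda>x. norm (Du x))" "integrable M (\<lambda>x. (norm (Du x))\<^sup>2)"
  "integrable M (\<lambda>x. norm (grad (\<phi> k) x - Du x))" "integrable M (\<lambda>x. (norm (grad (\<phi> k) x - Du x))\<^sup>2)"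
  "(\<lambda>k. \<integral>x. norm (grad (\<phi> k) x - Du x) \<partial>M) \<longlonglongrightarrow> 0" "(\<lambda>k. \<integral>x. (norm (grad (\<phi> k) x - Du x))\<^sup>2 \<partial>M) \<longlonglongrightarrow> 0"
proof -
  have 1: "integrable M (\<lambda>x. norm (Du x) powr r)" "integrable M (\<lambda>x. norm (grad (\<phi> k) x - Du x) powr r)"
    "(\<lambda>k. \<integral>x. norm (grad (\<phi> k) x - Du x) powr r \<partial>M) \<longlonglongrightarrow> 0" if "0 < r" "r \<le> 2" for r k
  proof -
    show "integrable M (\<lambda>x. norm (Du x) powr r)"
      by (rule integrable_powr_le[OF _ _ Du_integrable]) (use that p_gt_2 in simp_all)
    show "integrable M (\<lambda>x. norm (grad (\<phi> k) x - Du x) powr r)"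
      by (rule integrable_powr_le[OF _ _ grad_integrable]) (use that p_gt_2 in simp_all)
    show "(\<lambda>k. \<integral>x. norm (grad (\<phi> k) x - Du x) powr r \<partial>M) \<longlonglongrightarrow> 0"
      by (rule tendsto_integral_powr_le[OF _ _ grad_integrable _ _ grad_lim]) (use that p_gt_2 in simp_all)
  qed
  show "integrable M (\<lambda>x. norm (Du x))" "integrable M (\<lambda>x. norm (grad (\<phi> k) x - Du x))"
    "(\<lambda>k. \<integral>x. norm (grad (\<phi> k) x - Du x) \<partial>M) \<longlonglongrightarrow> 0"
    using 1(1)[of 1] 1(2)[of 1 k] 1(3)[of 1] by simp_all
  show "integrable M (\<lambda>x. (norm (Du x))\<^sup>2)" "integrable M (\<lambda>x. (norm (grad (\<phi> k) x - Du x))\<^sup>2)"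
    "(\<lambda>k. \<integral>x. (norm (grad (\<phi> k) x - Du x))\<^sup>2 \<partial>M) \<longlonglongrightarrow> 0"
    using 1(1)[of 2] 1(2)[of 2 k] 1(3)[of 2] by simp_all
qed

lemma tendsto_integral_comp_mult:
  fixes g :: "real \<Rightarrow> real"
  assumes g: "\<And>t. isCont g t" "\<And>t. \<bar>g t\<bar> \<le> B" and v: "integrable M v"
  shows "integrable M (\<lambda>x. g (u x) * v x)" "\<And>k. integrable M (\<lambda>x. g (\<phi> k x) * v x)"
    "(\<lambda>k. \<integral>x. g (\<phi> k x) * v x \<partial>M) \<longlonglongrightarrow> (\<integral>x. g (u x) * v x \<partial>M)"
proof -
  have [measurable]: "g \<in> borel_measurable borel"
    using g(1) by (intro borel_measurable_continuous_onI) (simp add: continuous_on_eq_continuous_at)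
  have [measurable]: "v \<in> borel_measurable M" using v by (rule borel_measurable_integrable)
  have w: "integrable M (\<lambda>x. B * \<bar>v x\<bar>)" using v by (intro integrable_mult_right integrable_abs)
  have l: "AE x in M. (\<lambda>k. g (\<phi> k x) * v x) \<longlonglongrightarrow> g (u x) * v x"
    using lim by eventually_elim (intro tendsto_mult tendsto_const isCont_tendsto_compose[OF g(1)])
  have b: "AE x in M. norm (g (\<phi> k x) * v x) \<le> B * \<bar>v x\<bar>" for k
    using g(2) by (intro AE_I2) (simp add: abs_mult mult_right_mono)
  have m1: "(\<lambda>x. g (u x) * v x) \<in> borel_measurable M" by measurable
  have m2: "(\<lambda>x. g (\<phi> k x) * v x) \<in> borel_measurable M" for k by measurable
  show "integrable M (\<lambda>x. g (u x) * v x)" "\<And>k. integrable M (\<lambda>x. g (\<phi> k x) * v x)"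
    "(\<lambda>k. \<integral>x. g (\<phi> k x) * v x \<partial>M) \<longlonglongrightarrow> (\<integral>x. g (u x) * v x \<partial>M)"
    using integrable_dominated_convergence[OF m1 m2 w l b] integrable_dominated_convergence2[OF m1 m2 w l b]
      integral_dominated_convergence[OF m1 m2 w l b] by auto
qed

text \<open>\<open>A\<close> stands for the drift evaluated at the solution. The functions
  \<open>G(\<phi> k)\<close> are admissible since \<open>G\<close> is smooth and
  \<open>G 0 = 0\<close>. In the drift term the gradient of \<open>\<phi> k\<close> is written as
  \<open>Du\<close> plus an error: the first part converges by dominated convergence, and the error
  is at most L |A| |grad (\<phi> k) - Du|, which vanishes in the limit because \<open>A\<close> is
  square integrable and the gradients converge in L^2.\<close>

lemma test_with_comp:
  assumes A[measurable]: "A \<in> borel_measurable M" and bound: "AE x in M. norm (A x) \<le> \<beta> * (1 + norm (Du x))"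
    and f: "integrable M f"
    and sub: "\<And>\<psi>. \<psi> \<in> test_functions \<Omega> \<Longrightarrow> (\<And>x. 0 \<le> \<psi> x) \<Longrightarrow>
      (\<integral>x. A x \<bullet> grad \<psi> x \<partial>M) + lam * (\<integral>x. u x * \<psi> x \<partial>M) + (\<integral>x. norm (Du x) powr p * \<psi> x \<partial>M)
        \<le> (\<integral>x. f x * \<psi> x \<partial>M)"
    and G: "smooth_real G" "\<And>t. (G has_real_derivative G' t) (at t)" "\<And>t. isCont G' t" "G 0 = 0"
      "\<And>t. 0 \<le> G t" "\<And>t. G t \<le> B" "\<And>t. \<bar>G' t\<bar> \<le> L"
  shows "integrable M (\<lambda>x. G' (u x) * (A x \<bullet> Du x))"
    "(\<integral>x. G' (u x) * (A x \<bullet> Du x) \<partial>M) + lam * (\<integral>x. G (u x) * u x \<partial>M) + (\<integral>x. G (u x) * norm (Du x) powr p \<partial>M)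
      \<le> (\<integral>x. G (u x) * f x \<partial>M)"
proof -
  have A2: "integrable M (\<lambda>x. (norm (A x))\<^sup>2)"
  proof (rule Bochner_Integration.integrable_bound)
    show "integrable M (\<lambda>x. 2 * \<beta>\<^sup>2 * (1 + (norm (Du x))\<^sup>2))"
      using Du_powers(2) by (intro integrable_mult_right Bochner_Integration.integrable_add) auto
    show "AE x in M. norm ((norm (A x))\<^sup>2) \<le> norm (2 * \<beta>\<^sup>2 * (1 + (norm (Du x))\<^sup>2))"
      using bound
    proof eventually_elim
      case (elim x)
      then have "(norm (A x))\<^sup>2 \<le> (\<beta> * (1 + norm (Du x)))\<^sup>2" by (intro power_mono) auto
      also have "\<dots> = \<beta>\<^sup>2 * (1 + norm (Du x))\<^sup>2" by (rule power_mult_distrib)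
      also have "\<dots> \<le> \<beta>\<^sup>2 * (2 * (1 + (norm (Du x))\<^sup>2))"
        using zero_le_power2[of "1 - norm (Du x)"]
        by (intro mult_left_mono) (simp_all add: power2_eq_square algebra_simps)
      finally show ?case by (simp add: algebra_simps)
    qed
  qed measurable
  have AD: "integrable M (\<lambda>x. A x \<bullet> Du x)"
  proof (rule Bochner_Integration.integrable_bound)
    show "integrable M (\<lambda>x. (norm (A x))\<^sup>2 + (norm (Du x))\<^sup>2)" using A2 Du_powers(2) by simp
    show "AE x in M. norm (A x \<bullet> Du x) \<le> norm ((norm (A x))\<^sup>2 + (norm (Du x))\<^sup>2)"
    proof (rule AE_I2)
      fix x
      have "\<bar>A x \<bullet> Du x\<bar> \<le> norm (A x) * norm (Du x)" by (rule Cauchy_Schwarz_ineq2)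
      also have "\<dots> \<le> (norm (A x))\<^sup>2 + (norm (Du x))\<^sup>2"
      proof -
        have "0 \<le> norm (A x) * norm (Du x)" by simp
        then show ?thesis using sum_squares_bound[of "norm (A x)" "norm (Du x)"] unfolding mult.assoc by linarith
      qed
      finally show "norm (A x \<bullet> Du x) \<le> norm ((norm (A x))\<^sup>2 + (norm (Du x))\<^sup>2)" by simp
    qed
  qed measurable
  have G_cont: "isCont G t" for t using G(2) by (rule DERIV_isCont)
  have [measurable]: "G' \<in> borel_measurable borel"
    using G(3) by (intro borel_measurable_continuous_onI) (simp add: continuous_on_eq_continuous_at)
  note main = tendsto_integral_comp_mult[of G' L, OF G(3,7) AD]
  show "integrable M (\<lambda>x. G' (u x) * (A x \<bullet> Du x))" by (rule main(1))
  note prod = tendsto_integral_mult_0[of "\<lambda>x. norm (A x)" M "\<lambda>k x. norm (grad (\<phi> k) x - Du x)", OF _ _ A2 Du_powers(4,6)]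
  have prod_int: "integrable M (\<lambda>x. norm (A x) * norm (grad (\<phi> k) x - Du x))" for k
    using prod(1)[of k] by simp
  have prod_lim: "(\<lambda>k. L * (\<integral>x. norm (A x) * norm (grad (\<phi> k) x - Du x) \<partial>M)) \<longlonglongrightarrow> L * 0"
    using prod(2) by (intro tendsto_mult_left) simp
  have err_bound: "norm (G' (\<phi> k x) * (A x \<bullet> (grad (\<phi> k) x - Du x))) \<le> L * (norm (A x) * norm (grad (\<phi> k) x - Du x))" for k x
    using G(7)[of "\<phi> k x"] Cauchy_Schwarz_ineq2[of "A x" "grad (\<phi> k) x - Du x"]
    by (simp add: abs_mult mult_mono')
  have err_int: "integrable M (\<lambda>x. G' (\<phi> k x) * (A x \<bullet> (grad (\<phi> k) x - Du x)))" for k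
  proof (rule Bochner_Integration.integrable_bound)
    show "integrable M (\<lambda>x. L * (norm (A x) * norm (grad (\<phi> k) x - Du x)))"
      by (intro integrable_mult_right prod_int)
    show "AE x in M. norm (G' (\<phi> k x) * (A x \<bullet> (grad (\<phi> k) x - Du x)))
        \<le> norm (L * (norm (A x) * norm (grad (\<phi> k) x - Du x)))"
      by (intro AE_I2 order_trans[OF err_bound]) simp
  qed measurable
  have err_lim: "(\<lambda>k. \<integral>x. G' (\<phi> k x) * (A x \<bullet> (grad (\<phi> k) x - Du x)) \<partial>M) \<longlonglongrightarrow> 0"
  proof (rule Lim_null_comparison)
    show "\<forall>\<^sub>F k in sequentially. norm (\<integral>x. G' (\<phi> k x) * (A x \<bullet> (grad (\<phi> k) x - Du x)) \<partial>M)
        \<le> L * (\<integral>x. norm (A x) * norm (grad (\<phi> k) x - Du x) \<partial>M)"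
    proof (intro always_eventually allI)
      fix k
      have "norm (\<integral>x. G' (\<phi> k x) * (A x \<bullet> (grad (\<phi> k) x - Du x)) \<partial>M)
          \<le> (\<integral>x. norm (G' (\<phi> k x) * (A x \<bullet> (grad (\<phi> k) x - Du x))) \<partial>M)" by (rule integral_norm_bound)
      also have "\<dots> \<le> (\<integral>x. L * (norm (A x) * norm (grad (\<phi> k) x - Du x)) \<partial>M)"
        by (intro integral_mono integrable_norm err_int integrable_mult_right prod_int err_bound)
      finally show "norm (\<integral>x. G' (\<phi> k x) * (A x \<bullet> (grad (\<phi> k) x - Du x)) \<partial>M)
        \<le> L * (\<integral>x. norm (A x) * norm (grad (\<phi> k) x - Du x) \<partial>M)" by simp
    qed
    show "(\<lambda>k. L * (\<integral>x. norm (A x) * norm (grad (\<phi> k) x - Du x) \<partial>M)) \<longlonglongrightarrow> 0" using prod_lim by simp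
  qed
  have split: "(\<integral>x. A x \<bullet> grad (\<lambda>x. G (\<phi> k x)) x \<partial>M) =
      (\<integral>x. G' (\<phi> k x) * (A x \<bullet> Du x) \<partial>M) + (\<integral>x. G' (\<phi> k x) * (A x \<bullet> (grad (\<phi> k) x - Du x)) \<partial>M)" for k
  proof -
    have "A x \<bullet> grad (\<lambda>x. G (\<phi> k x)) x = G' (\<phi> k x) * (A x \<bullet> Du x) + G' (\<phi> k x) * (A x \<bullet> (grad (\<phi> k) x - Du x))" for x
      by (simp add: grad_comp[OF G(2) test_functions_differentiable[OF test]] inner_diff_right algebra_simps)
    then show ?thesis using main(2)[of k] err_int[of k] by (simp add: Bochner_Integration.integral_add)
  qed
  have T1: "(\<lambda>k. \<integral>x. A x \<bullet> grad (\<lambda>x. G (\<phi> k x)) x \<partial>M) \<longlonglongrightarrow> (\<integral>x. G' (u x) * (A x \<bullet> Du x) \<partial>M)"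
    unfolding split using tendsto_add[OF main(3) err_lim] by simp
  have G_abs: "\<bar>G t\<bar> \<le> B" for t using G(5,6)[of t] by simp
  have u_int: "integrable M u" using u_integrable by (simp add: integrable_abs_iff)
  note T2 = tendsto_integral_comp_mult(3)[of G B, OF G_cont G_abs u_int]
  note T3 = tendsto_integral_comp_mult(3)[of G B, OF G_cont G_abs Du_integrable]
  note T4 = tendsto_integral_comp_mult(3)[of G B, OF G_cont G_abs f]
  have "(\<integral>x. A x \<bullet> grad (\<lambda>x. G (\<phi> k x)) x \<partial>M) + lam * (\<integral>x. G (\<phi> k x) * u x \<partial>M) + (\<integral>x. G (\<phi> k x) * norm (Du x) powr p \<partial>M)
      \<le> (\<integral>x. G (\<phi> k x) * f x \<partial>M)" for k
    using sub[OF test_functions_comp[OF test G(1,4)], of k] G(5) by (simp add: mult.commute)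
  then show "(\<integral>x. G' (u x) * (A x \<bullet> Du x) \<partial>M) + lam * (\<integral>x. G (u x) * u x \<partial>M) + (\<integral>x. G (u x) * norm (Du x) powr p \<partial>M)
      \<le> (\<integral>x. G (u x) * f x \<partial>M)"
    by (intro LIMSEQ_le[OF tendsto_add[OF tendsto_add[OF T1 tendsto_mult_left[OF T2]] T3] T4]) auto
qed

text \<open>The limit in \<open>k\<close> is taken in the estimate for translates, before averaging
  over the cube. The averaged inequality involves the measure of the support, and pointwise
  convergence does not make the supports of \<open>H(\<phi> k)\<close> comparable in measure to that
  of \<open>H(u)\<close>.\<close>

lemma sobolev_comp:
  assumes H: "\<And>t. (H has_real_derivative H' t) (at t)" "\<And>t. isCont H' t" "H 0 = 0" "\<And>t. \<bar>H' t\<bar> \<le> L"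
  shows "(\<integral>\<^sup>+x. ennreal \<bar>H (u x)\<bar> \<partial>M) \<le>
    ennreal (2 * CARD('n) * (2 * measure M {x \<in> \<Omega>. H (u x) \<noteq> 0}) powr (1 / CARD('n)) *
      (\<integral>x. \<bar>H' (u x)\<bar> * norm (Du x) \<partial>M))"
proof -
  have [measurable]: "H' \<in> borel_measurable borel"
    using H(2) by (intro borel_measurable_continuous_onI) (simp add: continuous_on_eq_continuous_at)
  have H_cont: "isCont H t" for t using H(1) by (rule DERIV_isCont)
  have [measurable]: "H \<in> borel_measurable borel"
    using H_cont by (intro borel_measurable_continuous_onI) (simp add: continuous_on_eq_continuous_at)
  \<comment> \<open>Translations leave \<open>\<Omega>\<close> and the averaging uses Borel
    functions on \<open>lborel\<close>; hence the extension by zero, which is the limit of the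
    \<open>\<phi> k\<close> on the whole space, and its Borel version \<open>U\<close>.\<close>
  let ?u0 = "\<lambda>x. if x \<in> \<Omega> then u x else 0"
  have "?u0 \<in> borel_measurable lebesgue" by (rule borel_measurable_if_I[OF u_measurable \<Omega>_sets])
  then obtain U where U: "U \<in> borel_measurable lborel" "AE x in lborel. ?u0 x = U x"
    using completion_ex_borel_measurable_real by blast
  have [measurable]: "U \<in> borel_measurable borel" using U(1) by simp
  have U_lim: "AE x in lborel. (\<lambda>k. \<phi> k x) \<longlonglongrightarrow> U x"
  proof -
    have "AE x in lebesgue. x \<in> \<Omega> \<longrightarrow> (\<lambda>k. \<phi> k x) \<longlonglongrightarrow> u x"
      using lim \<Omega>_sets by (simp add: AE_restrict_space_iff)
    then have "AE x in lborel. x \<in> \<Omega> \<longrightarrow> (\<lambda>k. \<phi> k x) \<longlonglongrightarrow> u x" by (simp add: AE_completion_iff)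
    with U(2) show ?thesis
    proof eventually_elim
      case (elim x)
      then show ?case using test_functions_eq_0[OF test, of x] by (cases "x \<in> \<Omega>") auto
    qed
  qed
  define V where "V k = (\<integral>x. \<bar>H' (\<phi> k x)\<bar> * norm (grad (\<phi> k) x) \<partial>M)" for k
  have V_int: "integrable M (\<lambda>x. \<bar>H' (\<phi> k x)\<bar> * norm (grad (\<phi> k) x))" for k
  proof -
    obtain B where B: "\<And>x. norm (grad (\<phi> k) x) \<le> B" using test_functions_bounded[OF test[of k]] by blast
    have "norm (\<bar>H' (\<phi> k x)\<bar> * norm (grad (\<phi> k) x)) \<le> L * B" for x
      using H(4)[of "\<phi> k x"] B[of x] by (simp add: mult_mono')
    then show ?thesis by (intro integrable_const_bound[of _ "L * B"] AE_I2) measurable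
  qed
  have V_lim: "V \<longlonglongrightarrow> (\<integral>x. \<bar>H' (u x)\<bar> * norm (Du x) \<partial>M)"
  proof (rule Lim_transform2)
    note conv = tendsto_integral_comp_mult[of "\<lambda>t. \<bar>H' t\<bar>" L, OF _ _ Du_powers(1)]
    show c3: "(\<lambda>k. \<integral>x. \<bar>H' (\<phi> k x)\<bar> * norm (Du x) \<partial>M) \<longlonglongrightarrow> (\<integral>x. \<bar>H' (u x)\<bar> * norm (Du x) \<partial>M)"
      using H(2,4) by (intro conv) (auto intro!: continuous_intros)
    have c2: "integrable M (\<lambda>x. \<bar>H' (\<phi> k x)\<bar> * norm (Du x))" for k
      using H(2,4) by (intro conv) (auto intro!: continuous_intros)
    show "(\<lambda>k. (\<integral>x. \<bar>H' (\<phi> k x)\<bar> * norm (Du x) \<partial>M) - V k) \<longlonglongrightarrow> 0"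
    proof (rule Lim_null_comparison)
      show "(\<lambda>k. L * (\<integral>x. norm (grad (\<phi> k) x - Du x) \<partial>M)) \<longlonglongrightarrow> 0"
        using tendsto_mult_left[OF Du_powers(5), of L] by simp
      show "\<forall>\<^sub>F k in sequentially. norm ((\<integral>x. \<bar>H' (\<phi> k x)\<bar> * norm (Du x) \<partial>M) - V k) \<le> L * (\<integral>x. norm (grad (\<phi> k) x - Du x) \<partial>M)"
      proof (intro always_eventually allI)
        fix k
        have pt: "norm (\<bar>H' (\<phi> k x)\<bar> * norm (Du x) - \<bar>H' (\<phi> k x)\<bar> * norm (grad (\<phi> k) x)) \<le> L * norm (grad (\<phi> k) x - Du x)" for x
        proof -
          have "norm (\<bar>H' (\<phi> k x)\<bar> * norm (Du x) - \<bar>H' (\<phi> k x)\<bar> * norm (grad (\<phi> k) x)) =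
              \<bar>H' (\<phi> k x)\<bar> * \<bar>norm (Du x) - norm (grad (\<phi> k) x)\<bar>"
            by (simp add: right_diff_distrib[symmetric] abs_mult)
          also have "\<dots> \<le> L * norm (grad (\<phi> k) x - Du x)"
            using H(4)[of "\<phi> k x"] norm_triangle_ineq3[of "Du x" "grad (\<phi> k) x"]
            by (intro mult_mono') (auto simp: norm_minus_commute)
          finally show ?thesis .
        qed
        have "(\<integral>x. \<bar>H' (\<phi> k x)\<bar> * norm (Du x) \<partial>M) - V k =
            (\<integral>x. \<bar>H' (\<phi> k x)\<bar> * norm (Du x) - \<bar>H' (\<phi> k x)\<bar> * norm (grad (\<phi> k) x) \<partial>M)"
          unfolding V_def using c2 V_int by (rule Bochner_Integration.integral_diff[symmetric])
        also have "norm \<dots> \<le> (\<integral>x. norm (\<bar>H' (\<phi> k x)\<bar> * norm (Du x) - \<bar>H' (\<phi> k x)\<bar> * norm (grad (\<phi> k) x)) \<partial>M)"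
          by (rule integral_norm_bound)
        also have "\<dots> \<le> (\<integral>x. L * norm (grad (\<phi> k) x - Du x) \<partial>M)"
          by (intro integral_mono pt integrable_norm Bochner_Integration.integrable_diff c2 V_int integrable_mult_right Du_powers(3))
        finally show "norm ((\<integral>x. \<bar>H' (\<phi> k x)\<bar> * norm (Du x) \<partial>M) - V k) \<le> L * (\<integral>x. norm (grad (\<phi> k) x - Du x) \<partial>M)"
          by simp
      qed
    qed
  qed
  have step: "(\<integral>\<^sup>+x. ennreal \<bar>H (\<phi> k (x + z)) - H (\<phi> k x)\<bar> \<partial>lborel) \<le> ennreal (norm z * V k)" for k z
  proof -
    have grad: "grad (\<lambda>x. H (\<phi> k x)) x = H' (\<phi> k x) *\<^sub>R grad (\<phi> k) x" for x
      by (rule grad_comp[OF H(1) test_functions_differentiable[OF test]])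
    have "((\<lambda>x. H (\<phi> k x)) has_derivative (\<lambda>v. (H' (\<phi> k x) *\<^sub>R grad (\<phi> k) x) \<bullet> v)) (at x)" for x
      using has_derivative_real_comp[where \<phi> = "\<phi> k", OF H(1) has_derivative_grad[OF test_functions_differentiable[OF test]]]
      by simp
    moreover have cont: "continuous_on UNIV (\<lambda>x. H' (\<phi> k x) *\<^sub>R grad (\<phi> k) x)"
    proof (intro continuous_on_scaleR test_functions_continuous_grad[OF test])
      have "continuous_on UNIV H'" using H(2) by (simp add: continuous_on_eq_continuous_at)
      then show "continuous_on UNIV (\<lambda>x. H' (\<phi> k x))"
        by (rule continuous_on_compose2[OF _ test_functions_continuous[OF test]]) simp
    qed
    ultimately have "(\<integral>\<^sup>+x. ennreal \<bar>H (\<phi> k (x + z)) - H (\<phi> k x)\<bar> \<partial>lborel) \<le>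
        ennreal (norm z) * (\<integral>\<^sup>+x. ennreal (norm (H' (\<phi> k x) *\<^sub>R grad (\<phi> k) x)) \<partial>lborel)"
      by (rule nn_integral_translate_diff_le)
    also have "(\<integral>\<^sup>+x. ennreal (norm (H' (\<phi> k x) *\<^sub>R grad (\<phi> k) x)) \<partial>lborel) =
        (\<integral>\<^sup>+x. ennreal (norm (H' (\<phi> k x) *\<^sub>R grad (\<phi> k) x)) \<partial>lebesgue)"
      by (rule nn_integral_completion[symmetric])
    also have "\<dots> = (\<integral>\<^sup>+x. ennreal (\<bar>H' (\<phi> k x)\<bar> * norm (grad (\<phi> k) x)) * indicator \<Omega> x \<partial>lebesgue)"
    proof (rule nn_integral_cong)
      fix x
      have "grad (\<phi> k) x = 0" if "x \<notin> \<Omega>"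
        using test_functions_grad_eq_0[OF test[of k], of x] test[of k] that by (auto simp: test_functions_def)
      then show "ennreal (norm (H' (\<phi> k x) *\<^sub>R grad (\<phi> k) x)) = ennreal (\<bar>H' (\<phi> k x)\<bar> * norm (grad (\<phi> k) x)) * indicator \<Omega> x"
        by (cases "x \<in> \<Omega>") simp_all
    qed
    also have "\<dots> = (\<integral>\<^sup>+x. ennreal (\<bar>H' (\<phi> k x)\<bar> * norm (grad (\<phi> k) x)) \<partial>M)"
      using \<Omega>_sets by (simp add: nn_integral_restrict_space)
    also have "\<dots> = ennreal (V k)"
      unfolding V_def by (rule nn_integral_eq_integral[OF V_int]) simp
    finally show ?thesis by (simp add: ennreal_mult')
  qed
  define I where "I = (\<integral>x. \<bar>H' (u x)\<bar> * norm (Du x) \<partial>M)"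
  have diff: "(\<integral>\<^sup>+x. ennreal \<bar>H (U (x + z)) - H (U x)\<bar> \<partial>lborel) \<le> ennreal (norm z) * ennreal I" for z
  proof -
    have [measurable]: "\<phi> k \<in> borel_measurable borel" for k by (rule test_functions_measurable(1)[OF test])
    \<comment> \<open>Translation by \<open>z\<close> preserves null sets, so the shifted sequence
      also converges almost everywhere, and Fatou's lemma applies to the differences.\<close>
    have "AE x in distr lborel borel ((+) z). (\<lambda>k. \<phi> k x) \<longlonglongrightarrow> U x"
      unfolding lborel_distr_plus by (rule U_lim)
    then have "AE x in lborel. (\<lambda>k. \<phi> k (z + x)) \<longlonglongrightarrow> U (z + x)"
      by (rule AE_distrD[rotated]) simp
    then have "AE x in lborel. (\<lambda>k. ennreal \<bar>H (\<phi> k (x + z)) - H (\<phi> k x)\<bar>) \<longlonglongrightarrow> ennreal \<bar>H (U (x + z)) - H (U x)\<bar>"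
      using U_lim
      by eventually_elim (intro tendsto_ennrealI tendsto_rabs tendsto_diff isCont_tendsto_compose[OF H_cont], simp_all add: add.commute)
    then have "(\<integral>\<^sup>+x. ennreal \<bar>H (U (x + z)) - H (U x)\<bar> \<partial>lborel) =
        (\<integral>\<^sup>+x. liminf (\<lambda>k. ennreal \<bar>H (\<phi> k (x + z)) - H (\<phi> k x)\<bar>) \<partial>lborel)"
    proof (intro nn_integral_cong_AE, eventually_elim)
      case (elim x)
      show ?case by (rule lim_imp_Liminf[OF sequentially_bot elim(2), symmetric])
    qed
    also have "\<dots> \<le> liminf (\<lambda>k. \<integral>\<^sup>+x. ennreal \<bar>H (\<phi> k (x + z)) - H (\<phi> k x)\<bar> \<partial>lborel)"
      by (intro nn_integral_liminf) measurable
    also have "\<dots> \<le> liminf (\<lambda>k. ennreal (norm z * V k))"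
      by (intro Liminf_mono always_eventually allI step)
    also have "\<dots> = ennreal (norm z * I)"
      unfolding I_def by (intro lim_imp_Liminf tendsto_ennrealI tendsto_mult tendsto_const V_lim) simp
    finally show ?thesis by (simp add: ennreal_mult' I_def)
  qed
  have meas_eq: "emeasure lborel {x. H (U x) \<noteq> 0} = ennreal (measure M {x \<in> \<Omega>. H (u x) \<noteq> 0})"
  proof -
    have S: "{x \<in> \<Omega>. H (u x) \<noteq> 0} \<in> sets M"
      using measurable_sets[of "\<lambda>x. H (u x)" M borel "- {0}"] by (simp add: vimage_def Collect_conj_eq Int_commute)
    have S': "{x. H (U x) \<noteq> 0} \<in> sets borel" by measurable
    have "emeasure lborel {x. H (U x) \<noteq> 0} = (\<integral>\<^sup>+x. indicator {x. H (U x) \<noteq> 0} x \<partial>lebesgue)"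
      using S' by (simp add: nn_integral_completion)
    \<comment> \<open>Almost everywhere outside \<open>\<Omega>\<close> the function
      \<open>U\<close> vanishes, and so does \<open>H(U)\<close> because
      \<open>H 0 = 0\<close>.\<close>
    also have "\<dots> = (\<integral>\<^sup>+x. indicator {x \<in> \<Omega>. H (u x) \<noteq> 0} x * indicator \<Omega> x \<partial>lebesgue)"
      using AE_completion[OF U(2)] by (intro nn_integral_cong_AE, eventually_elim) (auto simp: indicator_def H(3) split: if_splits)
    also have "\<dots> = emeasure M {x \<in> \<Omega>. H (u x) \<noteq> 0}"
      using \<Omega>_sets S by (simp add: nn_integral_restrict_space[symmetric])
    finally show ?thesis by (simp add: emeasure_eq_measure)
  qed
  have "(\<integral>\<^sup>+x. ennreal \<bar>H (u x)\<bar> \<partial>M) = (\<integral>\<^sup>+x. ennreal \<bar>H (u x)\<bar> * indicator \<Omega> x \<partial>lebesgue)"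
    using \<Omega>_sets by (simp add: nn_integral_restrict_space)
  also have "\<dots> = (\<integral>\<^sup>+x. ennreal \<bar>H (U x)\<bar> \<partial>lebesgue)"
    using AE_completion[OF U(2)] by (intro nn_integral_cong_AE, eventually_elim) (auto simp: H(3) split: if_splits)
  also have "\<dots> = (\<integral>\<^sup>+x. ennreal \<bar>H (U x)\<bar> \<partial>lborel)" by (rule nn_integral_completion)
  also have "\<dots> \<le> ennreal (2 * DIM(real ^ 'n) * (2 * measure M {x \<in> \<Omega>. H (u x) \<noteq> 0}) powr (1 / DIM(real ^ 'n))) * ennreal I"
    by (rule nn_integral_le_of_translate_diff[OF _ diff meas_eq]) auto
  also have "\<dots> = ennreal (2 * CARD('n) * (2 * measure M {x \<in> \<Omega>. H (u x) \<noteq> 0}) powr (1 / CARD('n)) * I)"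
    by (simp add: ennreal_mult'' I_def)
  finally show ?thesis by (simp add: I_def)
qed

end

subsection \<open>Energy estimate on superlevel sets\<close>

text \<open>
  The flat function \<open>exp (- 1 / t)\<close> dominates its derivatives up to an arbitrarily small loss in the exponent. This
  is what lets the term \<open>|\<nabla>u|\<^sup>p\<close> absorb the quadratic growth of \<open>a(x,u,\<nabla>u) \<bullet> \<nabla>u\<close>.
\<close>

lemma exp_flat_deriv_le:
  assumes "0 \<le> \<theta>" "\<theta> < 1"
  shows "exp_flat [:0, 0, 1:] t \<le> 4 / (1 - \<theta>)\<^sup>2 * exp_flat 1 t powr \<theta>"
    and "exp_flat [:1, 1:] t \<le> (1 + 1 / (1 - \<theta>)) * exp_flat 1 t powr \<theta>"
proof -
  define c where "c = 1 - \<theta>"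
  have c: "c > 0" using assms by (simp add: c_def)
  \<comment> \<open>The split-off factor exp(-c s) pays for the polynomials s^2 and 1 + s that
    differentiation produces, where s = 1/t.\<close>
  have eq: "exp (- s) = exp (- c * s) * exp (- s) powr \<theta>" for s :: real
    by (simp add: exp_powr_real exp_add[symmetric] c_def algebra_simps)
  have 1: "s\<^sup>2 * exp (- s) \<le> 4 / c\<^sup>2 * exp (- s) powr \<theta>" if "s > 0" for s
  proof -
    have "c * s / 2 \<le> exp (c * s / 2)" using exp_ge_add_one_self[of "c * s / 2"] by linarith
    then have "(c * s / 2)\<^sup>2 \<le> (exp (c * s / 2))\<^sup>2" using c that by (intro power_mono) auto
    then have "c\<^sup>2 * s\<^sup>2 \<le> 4 * exp (c * s)"
      by (simp add: power_divide power_mult_distrib exp_double[symmetric])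
    then have "s\<^sup>2 * exp (- c * s) \<le> 4 / c\<^sup>2"
      using c by (simp add: exp_minus field_simps)
    then have "s\<^sup>2 * exp (- c * s) * exp (- s) powr \<theta> \<le> 4 / c\<^sup>2 * exp (- s) powr \<theta>"
      by (intro mult_right_mono) auto
    then show ?thesis using eq[of s] by (simp add: mult.assoc)
  qed
  have 2: "(1 + s) * exp (- s) \<le> (1 + 1 / c) * exp (- s) powr \<theta>" if "s > 0" for s
  proof -
    have "1 + c * s \<le> exp (c * s)" by (rule exp_ge_add_one_self)
    then have "(1 + c * s) * exp (- c * s) \<le> exp (c * s) * exp (- c * s)" by (intro mult_right_mono) auto
    then have *: "(1 + c * s) * exp (- c * s) \<le> 1" by (simp add: exp_add[symmetric])
    have "(1 + s) * exp (- c * s) \<le> (1 + 1 / c) * ((1 + c * s) * exp (- c * s))"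
    proof -
      have "1 + s \<le> (1 + 1 / c) * (1 + c * s)" using c that by (simp add: field_simps)
      then have "(1 + s) * exp (- c * s) \<le> ((1 + 1 / c) * (1 + c * s)) * exp (- c * s)" by (intro mult_right_mono) auto
      then show ?thesis by (simp only: mult.assoc)
    qed
    also have "\<dots> \<le> (1 + 1 / c) * 1" using c by (intro mult_left_mono *) auto
    finally have le: "(1 + s) * exp (- c * s) * exp (- s) powr \<theta> \<le> (1 + 1 / c) * exp (- s) powr \<theta>"
      by (intro mult_right_mono) auto
    have E: "(1 + s) * exp (- s) = (1 + s) * exp (- c * s) * exp (- s) powr \<theta>"
      by (subst eq) (simp only: mult.assoc)
    show ?thesis unfolding E by (rule le)
  qed
  show "exp_flat [:0, 0, 1:] t \<le> 4 / (1 - \<theta>)\<^sup>2 * exp_flat 1 t powr \<theta>"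
    using 1[of "1 / t"] by (simp add: exp_flat_def c_def power2_eq_square)
  show "exp_flat [:1, 1:] t \<le> (1 + 1 / (1 - \<theta>)) * exp_flat 1 t powr \<theta>"
    using 2[of "1 / t"] by (simp add: exp_flat_def c_def)
qed

section \<open>Cutoffs and truncations at level k with a transition layer of width h\<close>

lemma isCont_exp_flat: "isCont (exp_flat P) t"
  by (rule DERIV_isCont[OF has_real_derivative_exp_flat])

lemma has_real_derivative_exp_flat_1: "(exp_flat 1 has_real_derivative exp_flat [:0, 0, 1:] t) (at t)"
  using has_real_derivative_exp_flat[of 1 t] by simp

text \<open>A sum of two one-sided flat functions instead of a function of |s|: smoothness at 0 is
  then immediate, and for k >= 0 the two supports meet at most in one point.\<close>

definition cutoff :: "real \<Rightarrow> real \<Rightarrow> real \<Rightarrow> real" where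
  "cutoff k h s = exp_flat 1 ((s - k) / h) + exp_flat 1 ((- s - k) / h)"

definition cutoff_deriv :: "real \<Rightarrow> real \<Rightarrow> real \<Rightarrow> real" where
  "cutoff_deriv k h s = (exp_flat [:0, 0, 1:] ((s - k) / h) - exp_flat [:0, 0, 1:] ((- s - k) / h)) / h"

text \<open>For k >= 0 and h > 0 this is (|s| - k) exp(-h / (|s| - k)) where |s| > k and 0
  elsewhere, a continuously differentiable stand-in for (|s| - k)^+. The outer factor
  \<open>h\<close> undoes the rescaling, so that no 1/h appears in the derivative; [:1, 1:] arises
  from (t exp(-1/t))' = (1 + 1/t) exp(-1/t).\<close>

definition trunc :: "real \<Rightarrow> real \<Rightarrow> real \<Rightarrow> real" where
  "trunc k h s = h * ((s - k) / h * exp_flat 1 ((s - k) / h) + (- s - k) / h * exp_flat 1 ((- s - k) / h))"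

definition trunc_deriv :: "real \<Rightarrow> real \<Rightarrow> real \<Rightarrow> real" where
  "trunc_deriv k h s = exp_flat [:1, 1:] ((s - k) / h) - exp_flat [:1, 1:] ((- s - k) / h)"

lemma smooth_real_cutoff: "smooth_real (cutoff k h)"
proof -
  have "smooth_real (\<lambda>s. 1 * exp_flat 1 (1 / h * s + - k / h) + 1 * exp_flat 1 (- 1 / h * s + - k / h))"
    by (intro smooth_real_add smooth_real_scale_affine smooth_real_exp_flat)
  then show ?thesis by (simp add: cutoff_def[abs_def] diff_divide_distrib)
qed

lemma DERIV_cutoff: "h > 0 \<Longrightarrow> (cutoff k h has_real_derivative cutoff_deriv k h s) (at s)"
  unfolding cutoff_def[abs_def] cutoff_deriv_def
  by (auto intro!: derivative_eq_intros DERIV_chain2[OF has_real_derivative_exp_flat_1] simp: diff_divide_distrib)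

lemma DERIV_trunc:
  assumes "h > 0"
  shows "(trunc k h has_real_derivative trunc_deriv k h s) (at s)"
proof -
  have *: "((\<lambda>t. t * exp_flat 1 t) has_real_derivative exp_flat [:1, 1:] t) (at t)" for t
  proof -
    have "((\<lambda>t. t * exp_flat 1 t) has_real_derivative t * exp_flat [:0, 0, 1:] t + 1 * exp_flat 1 t) (at t)"
      using DERIV_mult'[OF DERIV_ident has_real_derivative_exp_flat_1] by simp
    moreover have "t * exp_flat [:0, 0, 1:] t + 1 * exp_flat 1 t = exp_flat [:1, 1:] t"
      by (simp add: exp_flat_def field_simps)
    ultimately show ?thesis by simp
  qed
  have "((\<lambda>s. (s - k) / h * exp_flat 1 ((s - k) / h)) has_real_derivative exp_flat [:1, 1:] ((s - k) / h) * (1 / h)) (at s)"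
    by (rule DERIV_chain2[OF *]) (use assms in \<open>auto intro!: derivative_eq_intros\<close>)
  moreover have "((\<lambda>s. (- s - k) / h * exp_flat 1 ((- s - k) / h)) has_real_derivative exp_flat [:1, 1:] ((- s - k) / h) * (- 1 / h)) (at s)"
    by (rule DERIV_chain2[OF *]) (use assms in \<open>auto intro!: derivative_eq_intros\<close>)
  ultimately have "(trunc k h has_real_derivative
      h * (exp_flat [:1, 1:] ((s - k) / h) * (1 / h) + exp_flat [:1, 1:] ((- s - k) / h) * (- 1 / h))) (at s)"
    unfolding trunc_def[abs_def] by (intro DERIV_cmult DERIV_add)
  then show ?thesis using assms by (simp add: trunc_deriv_def algebra_simps)
qed

lemma isCont_cutoff_deriv: "h > 0 \<Longrightarrow> isCont (cutoff_deriv k h) s"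
  unfolding cutoff_deriv_def[abs_def]
  by (intro continuous_intros isCont_o2[OF _ isCont_exp_flat]) auto

lemma isCont_trunc_deriv: "h > 0 \<Longrightarrow> isCont (trunc_deriv k h) s"
  unfolding trunc_deriv_def[abs_def]
  by (intro continuous_intros isCont_o2[OF _ isCont_exp_flat]) auto

lemma exp_flat_neg: "t \<le> 0 \<Longrightarrow> exp_flat P t = 0"
  by (simp add: exp_flat_def)

text \<open>For k >= 0 the arguments (s - k)/h and (-s - k)/h have a nonpositive sum, so at most one
  of the two summands is nonzero, and the sign of \<open>s\<close> decides which.\<close>

lemma cutoff_abs:
  assumes "0 \<le> k" "0 < h"
  shows "cutoff k h s = exp_flat 1 ((\<bar>s\<bar> - k) / h)"
    "\<bar>cutoff_deriv k h s\<bar> = exp_flat [:0, 0, 1:] ((\<bar>s\<bar> - k) / h) / h"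
    "trunc k h s = (\<bar>s\<bar> - k) * exp_flat 1 ((\<bar>s\<bar> - k) / h)"
    "\<bar>trunc_deriv k h s\<bar> = exp_flat [:1, 1:] ((\<bar>s\<bar> - k) / h)"
proof -
  have pos: "0 \<le> exp_flat [:0, 0, 1:] t" "0 \<le> exp_flat [:1, 1:] t" for t by (auto simp: exp_flat_def)
  have hk: "h \<noteq> 0" "\<bar>h\<bar> = h" using assms by auto
  consider "0 \<le> s" "\<And>P. exp_flat P ((- s - k) / h) = 0" | "s < 0" "\<And>P. exp_flat P ((s - k) / h) = 0"
  proof (cases "0 \<le> s")
    case True
    then have "(- s - k) / h \<le> 0" using assms by (intro divide_nonpos_pos) auto
    then show ?thesis using that(1) True exp_flat_neg by blast
  next
    case False
    then have "(s - k) / h \<le> 0" using assms by (intro divide_nonpos_pos) auto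
    then show ?thesis using that(2) False exp_flat_neg by (meson not_le)
  qed
  then have "cutoff k h s = exp_flat 1 ((\<bar>s\<bar> - k) / h) \<and>
    \<bar>cutoff_deriv k h s\<bar> = exp_flat [:0, 0, 1:] ((\<bar>s\<bar> - k) / h) / h \<and>
    trunc k h s = (\<bar>s\<bar> - k) * exp_flat 1 ((\<bar>s\<bar> - k) / h) \<and>
    \<bar>trunc_deriv k h s\<bar> = exp_flat [:1, 1:] ((\<bar>s\<bar> - k) / h)"
  proof cases
    case 1
    then show ?thesis
      using pos hk unfolding cutoff_def cutoff_deriv_def trunc_def trunc_deriv_def 1(2) by (simp add: abs_divide)
  next
    case 2
    then show ?thesis
      using pos hk unfolding cutoff_def cutoff_deriv_def trunc_def trunc_deriv_def 2(2) by (simp add: abs_divide)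
  qed
  then show "cutoff k h s = exp_flat 1 ((\<bar>s\<bar> - k) / h)"
    "\<bar>cutoff_deriv k h s\<bar> = exp_flat [:0, 0, 1:] ((\<bar>s\<bar> - k) / h) / h"
    "trunc k h s = (\<bar>s\<bar> - k) * exp_flat 1 ((\<bar>s\<bar> - k) / h)"
    "\<bar>trunc_deriv k h s\<bar> = exp_flat [:1, 1:] ((\<bar>s\<bar> - k) / h)" by blast+
qed

text \<open>The exponent 2/p matches the quadratic drift, so that G^(2/p) |Du|^2 is a power of the
  energy density G |Du|^p. The exponent 1/p does the same for the gradient of \<open>trunc\<close>.
  The last bound holds because exp(-h / (|s| - k)) >= exp(-1) once |s| > k + h.\<close>

lemma cutoff_bounds:
  assumes "0 \<le> k" "0 < h" "2 < p"
  shows "0 \<le> cutoff k h s" "cutoff k h s \<le> 1" "\<bar>s\<bar> \<le> k \<Longrightarrow> cutoff k h s = 0"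
    "\<bar>cutoff_deriv k h s\<bar> \<le> 4 / (1 - 2 / p)\<^sup>2 / h * cutoff k h s powr (2 / p)"
    "0 \<le> trunc k h s" "\<bar>s\<bar> \<le> k \<Longrightarrow> trunc k h s = 0"
    "\<bar>trunc_deriv k h s\<bar> \<le> (1 + 1 / (1 - 1 / p)) * cutoff k h s powr (1 / p)"
    "max 0 (\<bar>s\<bar> - (k + h)) \<le> exp 1 * trunc k h s"
proof -
  note eq = cutoff_abs[OF assms(1,2), of s]
  show "0 \<le> cutoff k h s" "cutoff k h s \<le> 1" unfolding eq by (auto simp: exp_flat_1_bounds)
  show "\<bar>s\<bar> \<le> k \<Longrightarrow> cutoff k h s = 0" "\<bar>s\<bar> \<le> k \<Longrightarrow> trunc k h s = 0"
  proof -
    assume "\<bar>s\<bar> \<le> k"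
    then have "(\<bar>s\<bar> - k) / h \<le> 0" using assms by (intro divide_nonpos_pos) auto
    then show "cutoff k h s = 0" "trunc k h s = 0" unfolding eq by (simp_all add: exp_flat_neg)
  qed
  show "\<bar>cutoff_deriv k h s\<bar> \<le> 4 / (1 - 2 / p)\<^sup>2 / h * cutoff k h s powr (2 / p)"
    using divide_right_mono[OF exp_flat_deriv_le(1)[of "2 / p" "(\<bar>s\<bar> - k) / h"], of h] assms unfolding eq by simp
  show "\<bar>trunc_deriv k h s\<bar> \<le> (1 + 1 / (1 - 1 / p)) * cutoff k h s powr (1 / p)"
    unfolding eq by (rule exp_flat_deriv_le(2)) (use assms in auto)
  show nn: "0 \<le> trunc k h s"
  proof (cases "\<bar>s\<bar> \<le> k")
    case True
    then have "(\<bar>s\<bar> - k) / h \<le> 0" using assms by (intro divide_nonpos_pos) auto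
    then show ?thesis unfolding eq by (simp add: exp_flat_neg)
  next
    case False
    then show ?thesis unfolding eq by (intro mult_nonneg_nonneg exp_flat_1_bounds) simp
  qed
  show "max 0 (\<bar>s\<bar> - (k + h)) \<le> exp 1 * trunc k h s"
  proof (cases "\<bar>s\<bar> \<le> k + h")
    case True
    then show ?thesis using nn by simp
  next
    case False
    then have r: "(\<bar>s\<bar> - k) / h > 1" using assms by simp
    then have "1 / ((\<bar>s\<bar> - k) / h) < 1" by (subst divide_less_eq_1_pos) linarith+
    then have "exp (- 1) \<le> exp_flat 1 ((\<bar>s\<bar> - k) / h)" using r by (simp add: exp_flat_1 del: divide_divide_eq_right)
    then have "exp 1 * exp (- 1) \<le> exp 1 * exp_flat 1 ((\<bar>s\<bar> - k) / h)" by (intro mult_left_mono) auto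
    then have "1 \<le> exp 1 * exp_flat 1 ((\<bar>s\<bar> - k) / h)" by (simp add: exp_minus)
    then have "(\<bar>s\<bar> - k) * 1 \<le> (\<bar>s\<bar> - k) * (exp 1 * exp_flat 1 ((\<bar>s\<bar> - k) / h))"
      using False assms by (intro mult_left_mono) auto
    then have "\<bar>s\<bar> - k \<le> exp 1 * ((\<bar>s\<bar> - k) * exp_flat 1 ((\<bar>s\<bar> - k) / h))"
      by (simp only: mult_1_right mult.left_commute)
    moreover have "max 0 (\<bar>s\<bar> - (k + h)) = \<bar>s\<bar> - (k + h)" using False by simp
    ultimately show ?thesis unfolding eq using assms(2) by linarith
  qed
qed

text \<open>Young's inequality for the conjugate exponents p/2 and p/(p-2). The cases are separated
  at the value of \<open>y\<close> above which m y^(2/p) <= y/2; below it the left side is at most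
  the constant.\<close>

lemma young_two_over_p:
  fixes y m p :: real
  assumes "0 \<le> y" "0 \<le> m" "2 < p"
  shows "m * y powr (2 / p) \<le> y / 2 + (2 * m) powr (p / (p - 2))"
proof (cases "y \<le> (2 * m) powr (p / (p - 2))")
  case True
  then have "y powr (2 / p) \<le> ((2 * m) powr (p / (p - 2))) powr (2 / p)"
    using assms by (intro powr_mono2) auto
  also have "\<dots> = (2 * m) powr (2 / (p - 2))" using assms by (simp add: powr_powr)
  finally have "m * y powr (2 / p) \<le> (2 * m) * (2 * m) powr (2 / (p - 2))"
    using assms by (intro mult_mono) auto
  also have "\<dots> = (2 * m) powr (p / (p - 2))"
  proof (cases "m = 0")
    case False
    then have "(2 * m) * (2 * m) powr (2 / (p - 2)) = (2 * m) powr (1 + 2 / (p - 2))"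
      using assms by (simp add: powr_add)
    also have "1 + 2 / (p - 2) = p / (p - 2)" using assms by (simp add: field_simps)
    finally show ?thesis .
  qed simp
  finally show ?thesis using assms by simp
next
  case False
  then have "((2 * m) powr (p / (p - 2))) powr ((p - 2) / p) \<le> y powr ((p - 2) / p)"
    using assms by (intro powr_mono2) auto
  then have "2 * m \<le> y powr ((p - 2) / p)" using assms by (simp add: powr_powr)
  then have "2 * m * y powr (2 / p) \<le> y powr ((p - 2) / p) * y powr (2 / p)"
    by (intro mult_right_mono) auto
  also have "\<dots> = y powr ((p - 2) / p + 2 / p)" by (rule powr_add[symmetric])
  also have "(p - 2) / p + 2 / p = 1" using assms by (simp add: field_simps)
  finally have "m * y powr (2 / p) \<le> y / 2" using assms by simp
  then show ?thesis by (smt (verit) powr_ge_zero)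
qed

text \<open>With m = \<beta> (4 / (1 - 2/p)^2) / h, which bounds \<beta> |G'| / G^(2/p) for the
  cutoff G, this is m + (2 (2 m))^(p/(p-2)): what remains of m (1 + 2 G^(2/p) |Du|^2) after half of
  the energy density has been split off by Young's inequality with coefficient 2 m.\<close>

definition drift_const :: "real \<Rightarrow> real \<Rightarrow> real \<Rightarrow> real" where
  "drift_const \<beta> p h = \<beta> * (4 / (1 - 2 / p)\<^sup>2) / h + (4 * (\<beta> * (4 / (1 - 2 / p)\<^sup>2) / h)) powr (p / (p - 2))"

locale W01_subsolution = W01_approximation \<Omega> p u Du \<phi>
  for \<Omega> :: "(real ^ 'n) set" and p u Du \<phi> +
  fixes A :: "real ^ 'n \<Rightarrow> real ^ 'n" and f :: "real ^ 'n \<Rightarrow> real" and \<beta> lam :: real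
  assumes A_measurable: "A \<in> borel_measurable M"
    and A_bound: "AE x in M. norm (A x) \<le> \<beta> * (1 + norm (Du x))" and \<beta>_pos: "0 < \<beta>"
    and f_integrable: "integrable M f"
    and subsolution: "\<And>\<psi>. \<psi> \<in> test_functions \<Omega> \<Longrightarrow> (\<And>x. 0 \<le> \<psi> x) \<Longrightarrow>
      (\<integral>x. A x \<bullet> grad \<psi> x \<partial>M) + lam * (\<integral>x. u x * \<psi> x \<partial>M) + (\<integral>x. norm (Du x) powr p * \<psi> x \<partial>M)
        \<le> (\<integral>x. f x * \<psi> x \<partial>M)"
begin

definition superlevel :: "real \<Rightarrow> (real ^ 'n) set" where
  "superlevel k = {x \<in> \<Omega>. k < \<bar>u x\<bar>}"

lemma superlevel_sets [measurable]: "superlevel k \<in> sets M"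
proof -
  have "{x \<in> space M. k < \<bar>u x\<bar>} \<in> sets M" by measurable
  then show ?thesis by (simp add: superlevel_def)
qed

lemma integrable_superlevel: "integrable M (\<lambda>x. c * indicator (superlevel k) x :: real)"
  by (intro integrable_mult_right integrable_const_bound[of _ 1] AE_I2) (auto simp: indicator_def)

lemma integral_superlevel: "(\<integral>x. indicator (superlevel k) x \<partial>M) = measure M (superlevel k)"
proof -
  have "superlevel k \<inter> \<Omega> = superlevel k" by (auto simp: superlevel_def)
  then show ?thesis by simp
qed

lemma integrable_indicator_mult:
  "integrable M v \<Longrightarrow> integrable M (\<lambda>x. indicator (superlevel k) x * v x)" for v :: "real ^ 'n \<Rightarrow> real"
  using integrable_mult_indicator[OF superlevel_sets, of v] by simp

lemma cutoff_deriv_bounded: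
  assumes "0 \<le> k" "0 < h"
  shows "\<bar>cutoff_deriv k h s\<bar> \<le> 4 / (1 - 2 / p)\<^sup>2 / h"
proof -
  have "cutoff k h s powr (2 / p) \<le> 1 powr (2 / p)"
    using cutoff_bounds(1,2)[OF assms p_gt_2, of s] p_gt_2 by (intro powr_mono2) auto
  then have "4 / (1 - 2 / p)\<^sup>2 / h * cutoff k h s powr (2 / p) \<le> 4 / (1 - 2 / p)\<^sup>2 / h * 1"
    using assms by (intro mult_left_mono) auto
  then show ?thesis using cutoff_bounds(4)[OF assms p_gt_2, of s] by simp
qed

lemma cutoff_integrable:
  assumes "0 \<le> k" "0 < h" "integrable M v"
  shows "integrable M (\<lambda>x. cutoff k h (u x) * v x)"
proof (rule tendsto_integral_comp_mult(1)[OF _ _ assms(3)])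
  show "isCont (cutoff k h) t" for t using DERIV_cutoff[OF assms(2)] by (rule DERIV_isCont)
  show "\<bar>cutoff k h t\<bar> \<le> 1" for t using cutoff_bounds(1,2)[OF assms(1,2) p_gt_2, of t] by simp
qed

text \<open>Half of the energy is absorbed on the left, hence the overall factor 2. The terms with
  \<open>lam\<close> and \<open>f\<close> are bounded in absolute value, so neither the sign of
  \<open>lam\<close> nor that of \<open>u\<close> matters.\<close>

lemma energy_estimate:
  assumes k: "0 \<le> k" and h: "0 < h"
  shows "(\<integral>x. cutoff k h (u x) * norm (Du x) powr p \<partial>M) \<le>
    2 * ((\<integral>x. indicator (superlevel k) x * \<bar>f x\<bar> \<partial>M) + \<bar>lam\<bar> * (\<integral>x. indicator (superlevel k) x * \<bar>u x\<bar> \<partial>M)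
      + drift_const \<beta> p h * measure M (superlevel k))"
proof -
  let ?G = "\<lambda>x. cutoff k h (u x)" and ?S = "superlevel k"
  define m where "m = \<beta> * (4 / (1 - 2 / p)\<^sup>2) / h"
  have m: "0 \<le> m" using \<beta>_pos h by (simp add: m_def)
  have T: "drift_const \<beta> p h = m + (2 * (2 * m)) powr (p / (p - 2))" by (simp add: drift_const_def m_def)
  note bounds = cutoff_bounds[OF k h p_gt_2]
  note test = test_with_comp[OF A_measurable A_bound f_integrable subsolution smooth_real_cutoff DERIV_cutoff[OF h]
      isCont_cutoff_deriv[OF h] _ bounds(1) bounds(2) cutoff_deriv_bounded[OF k h]]
  have int1: "integrable M (\<lambda>x. cutoff_deriv k h (u x) * (A x \<bullet> Du x))"
    using bounds(3)[of 0] k by (intro test(1)) auto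
  have main: "(\<integral>x. cutoff_deriv k h (u x) * (A x \<bullet> Du x) \<partial>M) + lam * (\<integral>x. ?G x * u x \<partial>M)
      + (\<integral>x. ?G x * norm (Du x) powr p \<partial>M) \<le> (\<integral>x. ?G x * f x \<partial>M)"
    using bounds(3)[of 0] k by (intro test(2)) auto
  have G_ind: "?G x \<le> indicator ?S x" if "x \<in> space M" for x
    using bounds(2,3)[of "u x"] that by (auto simp: superlevel_def indicator_def)
  have u_int: "integrable M u" using u_integrable by (simp add: integrable_abs_iff)
  note ints = cutoff_integrable[OF k h]
  have pt: "AE x in M. - (cutoff_deriv k h (u x) * (A x \<bullet> Du x)) \<le>
      ?G x * norm (Du x) powr p / 2 + drift_const \<beta> p h * indicator ?S x"
    using A_bound AE_space
  proof eventually_elim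
    case (elim x)
    define d where "d = norm (Du x)"
    have d: "0 \<le> d" by (simp add: d_def)
    \<comment> \<open>The energy density. The dangerous quantity G^(2/p) |Du|^2 equals y^(2/p), a
      sublinear power since p > 2.\<close>
    define y where "y = ?G x * d powr p"
    have y: "y powr (2 / p) = ?G x powr (2 / p) * d\<^sup>2"
      using bounds(1)[of "u x"] p_gt_2 d by (simp add: y_def powr_mult powr_powr)
    show ?case
    proof (cases "k < \<bar>u x\<bar>")
      case True
      then have ind: "indicator ?S x = (1::real)" using elim(2) by (simp add: superlevel_def)
      have "- (cutoff_deriv k h (u x) * (A x \<bullet> Du x)) \<le> \<bar>cutoff_deriv k h (u x)\<bar> * \<bar>A x \<bullet> Du x\<bar>"
        by (metis abs_ge_minus_self abs_mult)
      also have "\<dots> \<le> (4 / (1 - 2 / p)\<^sup>2 / h * ?G x powr (2 / p)) * (\<beta> * (1 + d) * d)"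
      proof (rule mult_mono)
        show "\<bar>A x \<bullet> Du x\<bar> \<le> \<beta> * (1 + d) * d"
          using Cauchy_Schwarz_ineq2[of "A x" "Du x"] mult_right_mono[OF elim(1) norm_ge_zero[of "Du x"]]
          by (simp add: d_def)
      qed (use bounds(4) h in auto)
      also have "\<dots> = m * (?G x powr (2 / p) * ((1 + d) * d))" by (simp add: m_def)
      also have "\<dots> \<le> m * (1 + 2 * (?G x powr (2 / p) * d\<^sup>2))"
      proof (rule mult_left_mono[OF _ m])
        have G1: "?G x powr (2 / p) \<le> 1"
          using powr_mono2[of "2 / p" "?G x" 1] bounds(1,2)[of "u x"] p_gt_2 by simp
        have "(1 + d) * d \<le> 1 + 2 * d\<^sup>2"
          using zero_le_power2[of "d - 1 / 2"] by (simp add: power2_eq_square algebra_simps)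
        then have "?G x powr (2 / p) * ((1 + d) * d) \<le> ?G x powr (2 / p) * (1 + 2 * d\<^sup>2)"
          by (intro mult_left_mono) auto
        then show "?G x powr (2 / p) * ((1 + d) * d) \<le> 1 + 2 * (?G x powr (2 / p) * d\<^sup>2)"
          using G1 by (simp add: algebra_simps)
      qed
      also have "\<dots> = m + 2 * m * y powr (2 / p)" by (simp add: y algebra_simps)
      also have "\<dots> \<le> m + (y / 2 + (2 * (2 * m)) powr (p / (p - 2)))"
        using young_two_over_p[of y "2 * m" p] m p_gt_2 bounds(1)[of "u x"] by (simp add: y_def)
      finally show ?thesis by (simp add: ind T y_def d_def)
    next
      case False
      then have "?G x = 0" using bounds(3) by simp
      then have "cutoff_deriv k h (u x) = 0" using bounds(4)[of "u x"] by simp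
      moreover have "0 \<le> drift_const \<beta> p h" using m by (simp add: T)
      ultimately show ?thesis using \<open>?G x = 0\<close> by simp
    qed
  qed
  have "- (\<integral>x. cutoff_deriv k h (u x) * (A x \<bullet> Du x) \<partial>M) = (\<integral>x. - (cutoff_deriv k h (u x) * (A x \<bullet> Du x)) \<partial>M)"
    by simp
  also have "\<dots> \<le> (\<integral>x. ?G x * norm (Du x) powr p / 2 + drift_const \<beta> p h * indicator ?S x \<partial>M)"
  proof (rule integral_mono_AE[OF _ _ pt])
    show "integrable M (\<lambda>x. - (cutoff_deriv k h (u x) * (A x \<bullet> Du x)))"
      using int1 by (rule Bochner_Integration.integrable_minus)
    show "integrable M (\<lambda>x. ?G x * norm (Du x) powr p / 2 + drift_const \<beta> p h * indicator ?S x)"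
      by (intro Bochner_Integration.integrable_add integrable_superlevel integrable_divide ints[OF Du_integrable])
  qed
  also have "\<dots> = (\<integral>x. ?G x * norm (Du x) powr p \<partial>M) / 2 + drift_const \<beta> p h * measure M ?S"
    by (subst Bochner_Integration.integral_add[OF integrable_divide[OF ints[OF Du_integrable]] integrable_superlevel])
      (simp only: integral_divide_zero integral_mult_right_zero integral_superlevel)
  finally have drift: "- (\<integral>x. cutoff_deriv k h (u x) * (A x \<bullet> Du x) \<partial>M)
      \<le> (\<integral>x. ?G x * norm (Du x) powr p \<partial>M) / 2 + drift_const \<beta> p h * measure M ?S" .
  have abs_le: "\<bar>\<integral>x. ?G x * v x \<partial>M\<bar> \<le> (\<integral>x. indicator ?S x * \<bar>v x\<bar> \<partial>M)" if v: "integrable M v" for v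
  proof -
    have "\<bar>\<integral>x. ?G x * v x \<partial>M\<bar> \<le> (\<integral>x. \<bar>?G x * v x\<bar> \<partial>M)" by (rule integral_abs_bound)
    also have "\<dots> \<le> (\<integral>x. indicator ?S x * \<bar>v x\<bar> \<partial>M)"
      using G_ind bounds(1) ints[OF v] integrable_indicator_mult[OF integrable_abs[OF v]]
      by (intro integral_mono integrable_abs) (auto simp: abs_mult intro!: mult_right_mono)
    finally show ?thesis .
  qed
  have "\<bar>lam * (\<integral>x. ?G x * u x \<partial>M)\<bar> \<le> \<bar>lam\<bar> * (\<integral>x. indicator ?S x * \<bar>u x\<bar> \<partial>M)"
    using abs_le[OF u_int] by (simp add: abs_mult mult_left_mono)
  with main drift abs_le[OF f_integrable] show ?thesis by (simp add: abs_le_iff)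
qed

text \<open>By \<open>cutoff_bounds\<close>, |H'(u)| |Du| <= c (G |Du|^p)^(1/p) for H =
  \<open>trunc k h\<close>, so its integral is at most 2 c J^(1/p) mu^(1 - 1/p), with mu the measure
  of the superlevel set. The inequality of \<open>sobolev_comp\<close> adds the factor mu^(1/N).
  \<open>J\<close> is any positive bound for the energy, which lets the iteration insert a
  convenient one.\<close>

lemma level_estimate:
  assumes k: "0 \<le> k" and h: "0 < h" and pos: "0 < measure M (superlevel k)" and J: "0 < J"
    "2 * ((\<integral>x. indicator (superlevel k) x * \<bar>f x\<bar> \<partial>M) + \<bar>lam\<bar> * (\<integral>x. indicator (superlevel k) x * \<bar>u x\<bar> \<partial>M)
      + drift_const \<beta> p h * measure M (superlevel k)) \<le> J"
  shows "(\<integral>x. max 0 (\<bar>u x\<bar> - (k + h)) \<partial>M) \<le>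
    8 * exp 1 * CARD('n) * (1 + 1 / (1 - 1 / p)) *
      measure M (superlevel k) powr (1 / CARD('n) + 1 - 1 / p) * J powr (1 / p)"
proof -
  let ?G = "\<lambda>x. cutoff k h (u x)" and ?S = "superlevel k" and ?N = "real CARD('n)"
  define \<mu> where "\<mu> = measure M ?S"
  define c where "c = 1 + 1 / (1 - 1 / p)"
  have c: "0 < c" using p_gt_2 by (simp add: c_def add_pos_pos)
  note bounds = cutoff_bounds[OF k h p_gt_2]
  have energy: "(\<integral>x. ?G x * norm (Du x) powr p \<partial>M) \<le> J" using energy_estimate[OF k h] J(2) by linarith
  \<comment> \<open>The threshold at which both terms of \<open>powr_le_add_powr\<close> integrate
    to the same bound J^(1/p) mu^(1 - 1/p).\<close>
  define s where "s = (J / \<mu>) powr (1 / p)"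
  have s: "0 < s" using J(1) pos by (simp add: s_def \<mu>_def)
  have J\<mu>: "s * \<mu> = J powr (1 / p) * \<mu> powr (1 - 1 / p)" "s powr (1 - p) * J = J powr (1 / p) * \<mu> powr (1 - 1 / p)"
  proof -
    have \<mu>: "0 < \<mu>" using pos by (simp add: \<mu>_def)
    show "s * \<mu> = J powr (1 / p) * \<mu> powr (1 - 1 / p)"
      using J(1) \<mu> by (simp add: s_def powr_divide powr_diff)
    have "s powr (1 - p) * J = (J powr ((1 - p) / p) * J) / \<mu> powr ((1 - p) / p)"
      using J(1) \<mu> by (simp add: s_def powr_powr powr_divide)
    also have "J powr ((1 - p) / p) * J = J powr ((1 - p) / p + 1)" using J(1) by (simp add: powr_add)
    also have "(1 - p) / p + 1 = 1 / p" using p_gt_2 by (simp add: field_simps)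
    also have "J powr (1 / p) / \<mu> powr ((1 - p) / p) = J powr (1 / p) * \<mu> powr (- ((1 - p) / p))"
      by (simp add: powr_minus divide_inverse)
    also have "- ((1 - p) / p) = 1 - 1 / p" using p_gt_2 by (simp add: field_simps)
    finally show "s powr (1 - p) * J = J powr (1 / p) * \<mu> powr (1 - 1 / p)" .
  qed
  have H_bound: "\<bar>trunc_deriv k h t\<bar> \<le> c" for t
  proof -
    have "cutoff k h t powr (1 / p) \<le> 1"
      using powr_mono2[of "1 / p" "cutoff k h t" 1] bounds(1,2)[of t] p_gt_2 by simp
    then have "c * cutoff k h t powr (1 / p) \<le> c * 1" using c by (intro mult_left_mono) auto
    then show ?thesis using bounds(7)[of t] by (simp add: c_def)
  qed
  have H'_int: "integrable M (\<lambda>x. \<bar>trunc_deriv k h (u x)\<bar> * norm (Du x))"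
    by (rule tendsto_integral_comp_mult(1)[OF _ _ Du_powers(1)])
      (use H_bound in \<open>auto intro!: continuous_intros isCont_trunc_deriv h\<close>)
  have pt: "\<bar>trunc_deriv k h (u x)\<bar> * norm (Du x) \<le>
      c * (s * indicator ?S x + s powr (1 - p) * (?G x * norm (Du x) powr p))" if "x \<in> space M" for x
  proof (cases "k < \<bar>u x\<bar>")
    case True
    let ?t = "?G x powr (1 / p) * norm (Du x)"
    have "\<bar>trunc_deriv k h (u x)\<bar> * norm (Du x) \<le> (c * ?G x powr (1 / p)) * norm (Du x)"
      using bounds(7)[of "u x"] by (intro mult_right_mono) (auto simp: c_def)
    also have "\<dots> = c * ?t" by simp
    also have "\<dots> \<le> c * (s + s powr (1 - p) * ?t powr p)"
      using powr_le_add_powr[of s ?t 1 p] s c p_gt_2 by (intro mult_left_mono) auto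
    also have "?t powr p = ?G x * norm (Du x) powr p"
      using bounds(1)[of "u x"] p_gt_2 by (simp add: powr_mult powr_powr)
    finally show ?thesis using True that by (simp add: superlevel_def)
  next
    case False
    then have "?G x = 0" using bounds(3) by simp
    then have "trunc_deriv k h (u x) = 0" using bounds(7)[of "u x"] by simp
    then show ?thesis using \<open>?G x = 0\<close> s c by simp
  qed
  note int1 = integrable_superlevel[of s k]
    and int2 = integrable_mult_right[OF cutoff_integrable[OF k h Du_integrable], of "s powr (1 - p)"]
  have "(\<integral>x. \<bar>trunc_deriv k h (u x)\<bar> * norm (Du x) \<partial>M) \<le>
      (\<integral>x. c * (s * indicator ?S x + s powr (1 - p) * (?G x * norm (Du x) powr p)) \<partial>M)"
    by (intro integral_mono H'_int pt integrable_mult_right Bochner_Integration.integrable_add int1 int2)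
  also have "\<dots> = c * (s * \<mu> + s powr (1 - p) * (\<integral>x. ?G x * norm (Du x) powr p \<partial>M))"
    unfolding integral_mult_right_zero Bochner_Integration.integral_add[OF int1 int2] integral_superlevel \<mu>_def ..
  also have "\<dots> \<le> c * (s * \<mu> + s powr (1 - p) * J)"
    using energy c by (intro mult_left_mono add_left_mono) auto
  also have "\<dots> = 2 * c * (J powr (1 / p) * \<mu> powr (1 - 1 / p))" unfolding J\<mu> by simp
  finally have grad: "(\<integral>x. \<bar>trunc_deriv k h (u x)\<bar> * norm (Du x) \<partial>M) \<le> 2 * c * (J powr (1 / p) * \<mu> powr (1 - 1 / p))" .
  have H0: "trunc k h 0 = 0" using bounds(6)[of 0] k by simp
  have sub: "measure M {x \<in> \<Omega>. trunc k h (u x) \<noteq> 0} \<le> \<mu>"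
    unfolding \<mu>_def using bounds(6) by (intro finite_measure_mono superlevel_sets) (force simp: superlevel_def not_less)
  have "ennreal (\<integral>x. max 0 (\<bar>u x\<bar> - (k + h)) \<partial>M) = (\<integral>\<^sup>+x. ennreal (max 0 (\<bar>u x\<bar> - (k + h))) \<partial>M)"
    using u_integrable by (intro nn_integral_eq_integral[symmetric] integrable_max) auto
  also have "\<dots> \<le> (\<integral>\<^sup>+x. ennreal (exp 1) * ennreal \<bar>trunc k h (u x)\<bar> \<partial>M)"
    using bounds(5,8) by (intro nn_integral_mono) (simp add: ennreal_mult'[symmetric] ennreal_leI del: max.bounded_iff)
  also have "\<dots> = ennreal (exp 1) * (\<integral>\<^sup>+x. ennreal \<bar>trunc k h (u x)\<bar> \<partial>M)"
  proof (rule nn_integral_cmult)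
    have "continuous_on UNIV (trunc k h)"
      by (intro continuous_at_imp_continuous_on ballI DERIV_isCont[OF DERIV_trunc[OF h]])
    then have [measurable]: "trunc k h \<in> borel_measurable borel" by (rule borel_measurable_continuous_onI)
    show "(\<lambda>x. ennreal \<bar>trunc k h (u x)\<bar>) \<in> borel_measurable M" by measurable
  qed
  also have "\<dots> \<le> ennreal (exp 1) * ennreal (2 * ?N * (2 * measure M {x \<in> \<Omega>. trunc k h (u x) \<noteq> 0}) powr (1 / ?N) *
      (\<integral>x. \<bar>trunc_deriv k h (u x)\<bar> * norm (Du x) \<partial>M))"
  proof (rule mult_left_mono)
    show "(\<integral>\<^sup>+x. ennreal \<bar>trunc k h (u x)\<bar> \<partial>M) \<le>
        ennreal (2 * ?N * (2 * measure M {x \<in> \<Omega>. trunc k h (u x) \<noteq> 0}) powr (1 / ?N) *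
          (\<integral>x. \<bar>trunc_deriv k h (u x)\<bar> * norm (Du x) \<partial>M))"
      using sobolev_comp[OF DERIV_trunc[OF h] isCont_trunc_deriv[OF h] H0 H_bound]
      unfolding of_nat_mult of_nat_numeral .
  qed simp
  also have "\<dots> = ennreal (exp 1 * (2 * ?N * (2 * measure M {x \<in> \<Omega>. trunc k h (u x) \<noteq> 0}) powr (1 / ?N) *
      (\<integral>x. \<bar>trunc_deriv k h (u x)\<bar> * norm (Du x) \<partial>M)))"
    by (simp add: ennreal_mult')
  \<comment> \<open>As N >= 1, the factor 2^(1/N) is rounded up to 2. The factors e, 2 N, 2 and 2 c
    then multiply to 8 e N c.\<close>
  also have "\<dots> \<le> ennreal (exp 1 * (2 * ?N * (2 * \<mu> powr (1 / ?N)) *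
      (2 * c * (J powr (1 / p) * \<mu> powr (1 - 1 / p)))))"
  proof (intro ennreal_leI mult_left_mono mult_mono)
    have "(2 * measure M {x \<in> \<Omega>. trunc k h (u x) \<noteq> 0}) powr (1 / ?N) \<le> (2 * \<mu>) powr (1 / ?N)"
      using sub by (intro powr_mono2) auto
    also have "\<dots> = 2 powr (1 / ?N) * \<mu> powr (1 / ?N)" by (simp add: powr_mult \<mu>_def)
    also have "\<dots> \<le> 2 powr 1 * \<mu> powr (1 / ?N)" by (intro mult_right_mono powr_mono) auto
    finally show "(2 * measure M {x \<in> \<Omega>. trunc k h (u x) \<noteq> 0}) powr (1 / ?N) \<le> 2 * \<mu> powr (1 / ?N)" by simp
  qed (use grad in auto)
  finally have "(\<integral>x. max 0 (\<bar>u x\<bar> - (k + h)) \<partial>M) \<le> exp 1 * (2 * ?N * (2 * \<mu> powr (1 / ?N)) *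
      (2 * c * (J powr (1 / p) * \<mu> powr (1 - 1 / p))))"
    using c by (subst (asm) ennreal_le_iff) auto
  also have "\<dots> = 8 * exp 1 * ?N * c * (\<mu> powr (1 / ?N) * \<mu> powr (1 - 1 / p)) * J powr (1 / p)" by simp
  also have "\<mu> powr (1 / ?N) * \<mu> powr (1 - 1 / p) = \<mu> powr (1 / ?N + 1 - 1 / p)"
    by (simp add: powr_add[symmetric] add_diff_eq)
  finally show ?thesis by (simp add: \<mu>_def c_def)
qed

end

subsection \<open>De Giorgi iteration\<close>

lemma power_powr: "0 < x \<Longrightarrow> (x ^ n) powr a = (x powr a) ^ n" for x a :: real
  by (simp add: powr_realpow[symmetric] powr_powr mult.commute)

text \<open>Induction shows Y n <= X rho^n with rho = B^(-1/\<delta>). Since rho^\<delta> = 1/B, the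
  superlinear part of the recursion cancels the growth B^n exactly, and the smallness condition
  supplies one more factor rho.\<close>

lemma de_giorgi_sequence:
  fixes Y :: "nat \<Rightarrow> real"
  assumes nonneg: "\<And>n. 0 \<le> Y n" and Y0: "Y 0 \<le> X" and X: "0 < X"
    and step: "\<And>n. Y (Suc n) \<le> Q * B ^ n * Y n powr (1 + \<delta>)"
    and B: "1 < B" and \<delta>: "0 < \<delta>" and Q: "0 \<le> Q" "Q * X powr \<delta> \<le> B powr (- 1 / \<delta>)"
  shows "Y \<longlonglongrightarrow> 0"
proof -
  define \<rho> where "\<rho> = B powr (- 1 / \<delta>)"
  have \<rho>: "0 < \<rho>" using B by (simp add: \<rho>_def)
  have \<rho>\<delta>: "\<rho> powr \<delta> = 1 / B" 
  proof -
    have "\<rho> powr \<delta> = B powr (- 1 / \<delta> * \<delta>)" unfolding \<rho>_def by (rule powr_powr)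
    also have "- 1 / \<delta> * \<delta> = - 1" using \<delta> by simp
    finally show ?thesis using B by (simp add: powr_minus_divide)
  qed
  have Y: "Y n \<le> X * \<rho> ^ n" for n
  proof (induction n)
    case (Suc n)
    have "Y (Suc n) \<le> Q * B ^ n * Y n powr (1 + \<delta>)" by (rule step)
    also have "\<dots> \<le> Q * B ^ n * (X * \<rho> ^ n) powr (1 + \<delta>)"
      using Q B \<delta> nonneg Suc.IH by (intro mult_left_mono powr_mono2) auto
    also have "(X * \<rho> ^ n) powr (1 + \<delta>) = X * \<rho> ^ n * (X powr \<delta> * (1 / B) ^ n)"
      using X \<rho> by (simp add: powr_add powr_mult power_powr \<rho>\<delta>)
    also have "Q * B ^ n * (X * \<rho> ^ n * (X powr \<delta> * (1 / B) ^ n)) = (Q * X powr \<delta>) * (X * \<rho> ^ n)"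
      using B by (simp add: power_one_over)
    also have "\<dots> \<le> \<rho> * (X * \<rho> ^ n)"
      using Q(2) X \<rho> by (intro mult_right_mono) (auto simp: \<rho>_def)
    finally show ?case by (simp add: mult_ac)
  qed (use Y0 in simp)
  have "\<rho> < B powr 0" unfolding \<rho>_def using B \<delta> by (intro powr_less_mono) (auto simp: divide_neg_pos)
  then have "(\<lambda>n. X * \<rho> ^ n) \<longlonglongrightarrow> X * 0"
    using \<rho> B by (intro tendsto_mult_left LIMSEQ_power_zero) simp
  then show ?thesis
    by (intro tendsto_sandwich[of "\<lambda>_. 0" Y sequentially "\<lambda>n. X * \<rho> ^ n" 0]) (use nonneg Y in auto)
qed

text \<open>As 1/p <= 1/2 and the base is at least 1, the power is at most a square root. The weight
  d + 1 in the arithmetic-geometric inequality leaves at most Z/2 on the right, which is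
  absorbed.\<close>

lemma sublinear_bound:
  fixes Z :: real
  assumes "2 \<le> p" "1 \<le> c" "0 \<le> d" "0 \<le> Z" and Z: "Z \<le> m + b * (c + d * Z) powr (1 / p)"
  shows "Z \<le> 2 * m + c + b\<^sup>2 * (d + 1)"
proof -
  define x where "x = c + d * Z"
  have x: "1 \<le> x" using assms by (simp add: x_def add_increasing2)
  have "b * x powr (1 / p) \<le> \<bar>b\<bar> * x powr (1 / 2)"
    using assms(1) x by (intro mult_mono powr_mono) (auto simp: field_simps)
  also have "x powr (1 / 2) = sqrt x" using x by (simp add: powr_half_sqrt)
  also have "\<bar>b\<bar> * sqrt x \<le> (x / (d + 1) + b\<^sup>2 * (d + 1)) / 2"
  proof -
    have "0 \<le> (sqrt x / sqrt (d + 1) - \<bar>b\<bar> * sqrt (d + 1))\<^sup>2" by simp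
    also have "\<dots> = x / (d + 1) + b\<^sup>2 * (d + 1) - 2 * (\<bar>b\<bar> * sqrt x)"
      using assms(3) x by (simp add: power2_diff power_divide power_mult_distrib)
    finally show ?thesis by simp
  qed
  also have "x / (d + 1) \<le> c + Z"
    using assms by (simp add: x_def field_simps add_increasing2)
  finally show ?thesis using Z by (simp add: x_def)
qed

section \<open>The iteration on a finite measure space, for functions satisfying an abstract level
  estimate\<close>

context finite_measure
begin

abbreviation level_set :: "('a \<Rightarrow> real) \<Rightarrow> real \<Rightarrow> 'a set" where
  "level_set u k \<equiv> {x \<in> space M. k < \<bar>u x\<bar>}"

lemma excess_integrable: "integrable M (\<lambda>x. \<bar>u x\<bar>) \<Longrightarrow> integrable M (\<lambda>x. max 0 (\<bar>u x\<bar> - k))"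
  for u :: "'a \<Rightarrow> real"
  by (intro integrable_max) auto

lemma integrable_level_set:
  fixes u :: "'a \<Rightarrow> real"
  assumes "u \<in> borel_measurable M"
  shows "integrable M (\<lambda>x. c * indicator (level_set u k) x :: real)"
    "(\<integral>x. c * indicator (level_set u k) x \<partial>M) = c * measure M (level_set u k)"
proof -
  have [measurable]: "level_set u k \<in> sets M" using assms by measurable
  show "integrable M (\<lambda>x. c * indicator (level_set u k) x :: real)"
    by (intro integrable_mult_right integrable_const_bound[of _ 1] AE_I2) (auto simp: indicator_def)
  have "level_set u k \<inter> space M = level_set u k" by auto
  then show "(\<integral>x. c * indicator (level_set u k) x \<partial>M) = c * measure M (level_set u k)"
    by simp
qed

lemma excess_integral_eq_0:
  fixes u :: "'a \<Rightarrow> real"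
  assumes u: "u \<in> borel_measurable M" and "measure M (level_set u k) = 0" "k \<le> l"
  shows "(\<integral>x. max 0 (\<bar>u x\<bar> - l) \<partial>M) = 0"
proof (rule integral_eq_zero_AE)
  have "level_set u k \<in> null_sets M"
    using assms by (intro null_setsI) (auto simp: emeasure_eq_measure)
  from AE_not_in[OF this] AE_space show "AE x in M. max 0 (\<bar>u x\<bar> - l) = 0"
    by eventually_elim (use assms(3) in auto)
qed

text \<open>The energy bound at level 0 with layer width 1 is affine in the L^1 norm of
  \<open>u\<close> and enters with the power 1/p. The estimate is thus sublinear in that norm and
  bounds it, without any smallness of \<open>L\<close>.\<close>

lemma L1_bound_of_level_estimate:
  fixes u :: "'a \<Rightarrow> real"
  assumes u: "u \<in> borel_measurable M" "integrable M (\<lambda>x. \<bar>u x\<bar>)"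
    and par: "2 \<le> p" "0 \<le> \<theta>" "0 \<le> \<tau>" "0 \<le> C" "0 \<le> F" "0 \<le> L" "0 \<le> T1"
    and level: "\<And>J. 0 < measure M (level_set u 0) \<Longrightarrow> 0 < J \<Longrightarrow>
      2 * (F * measure M (level_set u 0) powr \<tau> + L * (\<integral>x. indicator (level_set u 0) x * \<bar>u x\<bar> \<partial>M)
        + T1 * measure M (level_set u 0)) \<le> J \<Longrightarrow>
      (\<integral>x. max 0 (\<bar>u x\<bar> - 1) \<partial>M) \<le> C * measure M (level_set u 0) powr \<theta> * J powr (1 / p)"
  shows "(\<integral>x. \<bar>u x\<bar> \<partial>M) \<le> 2 * measure M (space M) + (2 * (F * measure M (space M) powr \<tau> + T1 * measure M (space M)) + 1)
    + (C * measure M (space M) powr \<theta>)\<^sup>2 * (2 * L + 1)"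
proof -
  define m where "m = measure M (space M)"
  define c where "c = 2 * (F * m powr \<tau> + T1 * m) + 1"
  define Z where "Z = (\<integral>x. \<bar>u x\<bar> \<partial>M)"
  define \<mu> where "\<mu> = measure M (level_set u 0)"
  have m: "0 \<le> m" by (simp add: m_def)
  have Z: "0 \<le> Z" by (simp add: Z_def)
  have \<mu>m: "\<mu> \<le> m" unfolding \<mu>_def m_def by (intro finite_measure_mono) auto
  have \<mu>0: "0 \<le> \<mu>" by (simp add: \<mu>_def)
  have c: "1 \<le> c" using par m by (simp add: c_def)
  have "Z \<le> (\<integral>x. 1 + max 0 (\<bar>u x\<bar> - 1) \<partial>M)"
    unfolding Z_def using u by (intro integral_mono Bochner_Integration.integrable_add excess_integrable) auto
  also have "\<dots> = m + (\<integral>x. max 0 (\<bar>u x\<bar> - 1) \<partial>M)"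
    using excess_integrable[OF u(2)] by (subst Bochner_Integration.integral_add) (auto simp: m_def)
  finally have Z_le: "Z \<le> m + (\<integral>x. max 0 (\<bar>u x\<bar> - 1) \<partial>M)" .
  have "(\<integral>x. max 0 (\<bar>u x\<bar> - 1) \<partial>M) \<le> C * m powr \<theta> * (c + 2 * L * Z) powr (1 / p)"
  proof (cases "\<mu> = 0")
    case True
    then have "(\<integral>x. max 0 (\<bar>u x\<bar> - 1) \<partial>M) = 0"
      by (intro excess_integral_eq_0[OF u(1), of 0]) (auto simp: \<mu>_def)
    then show ?thesis using par by simp
  next
    case False
    have "(\<integral>x. indicator (level_set u 0) x * \<bar>u x\<bar> \<partial>M) \<le> Z"
      unfolding Z_def using u(2)
    proof (rule integral_mono[rotated])
      have "level_set u 0 \<in> sets M" using u(1) by measurable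
      then show "integrable M (\<lambda>x. indicator (level_set u 0) x * \<bar>u x\<bar>)"
        using integrable_mult_indicator[OF _ u(2)] by simp
    qed (auto simp: indicator_def)
    then have "L * (\<integral>x. indicator (level_set u 0) x * \<bar>u x\<bar> \<partial>M) \<le> L * Z" using par by (intro mult_left_mono) auto
    moreover have "F * \<mu> powr \<tau> \<le> F * m powr \<tau>" using par \<mu>m \<mu>0 by (intro mult_left_mono powr_mono2) auto
    moreover have "T1 * \<mu> \<le> T1 * m" using par \<mu>m by (intro mult_left_mono) auto
    ultimately have le: "2 * (F * \<mu> powr \<tau> + L * (\<integral>x. indicator (level_set u 0) x * \<bar>u x\<bar> \<partial>M) + T1 * \<mu>) \<le> c + 2 * L * Z"
      unfolding c_def by (simp add: algebra_simps)
    have pos: "0 < \<mu>" "0 < c + 2 * L * Z" using False \<mu>0 c par Z by (auto simp: add_pos_nonneg)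
    have "(\<integral>x. max 0 (\<bar>u x\<bar> - 1) \<partial>M) \<le> C * \<mu> powr \<theta> * (c + 2 * L * Z) powr (1 / p)"
      unfolding \<mu>_def by (rule level[OF pos[unfolded \<mu>_def] le[unfolded \<mu>_def]])
    also have "\<dots> \<le> C * m powr \<theta> * (c + 2 * L * Z) powr (1 / p)"
      using par \<mu>m \<mu>0 by (intro mult_right_mono mult_left_mono powr_mono2) auto
    finally show ?thesis .
  qed
  with Z_le have "Z \<le> m + C * m powr \<theta> * (c + 2 * L * Z) powr (1 / p)" by simp
  from sublinear_bound[OF par(1) c _ Z this] par show ?thesis
    by (simp add: Z_def m_def c_def)
qed

text \<open>Each step from one level to the next has two halves: Chebyshev's inequality on the first
  bounds the measure of the level set by the current excess \<open>Y n\<close>, and the level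
  estimate on the second bounds \<open>Y (Suc n)\<close>. The recursion involves \<open>K\<close>
  only through K^(-\<theta>), so enlarging \<open>K\<close> yields the smallness condition.\<close>

lemma bounded_of_level_estimate:
  fixes u :: "'a \<Rightarrow> real" and T :: "real \<Rightarrow> real"
  assumes u: "u \<in> borel_measurable M" "integrable M (\<lambda>x. \<bar>u x\<bar>)" "(\<integral>x. \<bar>u x\<bar> \<partial>M) \<le> X" "1 \<le> X"
    and par: "0 < p" "0 < \<theta>" "0 \<le> \<tau>" "\<tau> \<le> 1" "\<theta> + \<tau> / p = 1 + \<delta>" "0 < \<delta>" "0 \<le> C" "0 \<le> F" "0 \<le> L"
    and T: "0 \<le> T0" "1 \<le> B0" "\<And>h j. 1 \<le> h * 2 ^ j \<Longrightarrow> T h \<le> T0 * B0 ^ j"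
    and level: "\<And>k h J. 0 \<le> k \<Longrightarrow> 0 < h \<Longrightarrow> 0 < measure M (level_set u k) \<Longrightarrow> 0 < J \<Longrightarrow>
      2 * (F * measure M (level_set u k) powr \<tau> + L * (\<integral>x. indicator (level_set u k) x * \<bar>u x\<bar> \<partial>M)
        + T h * measure M (level_set u k)) \<le> J \<Longrightarrow>
      (\<integral>x. max 0 (\<bar>u x\<bar> - (k + h)) \<partial>M) \<le> C * measure M (level_set u k) powr \<theta> * J powr (1 / p)"
    and D: "D = 2 * (4 * F + 16 * L * X + T0 * (2 * B0)\<^sup>2 * X) + 1"
    and B: "B = 2 powr \<theta> * (2 * B0) powr (1 / p)"
    and K: "1 \<le> K" "C * D powr (1 / p) * 4 powr \<theta> * K powr (- \<theta>) * X powr \<delta> \<le> B powr (- 1 / \<delta>)"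
  shows "AE x in M. \<bar>u x\<bar> \<le> 2 * K"
proof -
  \<comment> \<open>The levels rise from K towards 2 K with increments \<open>2 * h n\<close>, one
    \<open>h n\<close> for each half step. As K >= 1, \<open>h n * 2 ^ (n + 2)\<close> is at least
    1, so the bound on \<open>T\<close> applies with exponent \<open>n + 2\<close>.\<close>
  define \<kappa> where "\<kappa> n = K * (2 - 1 / 2 ^ n)" for n :: nat
  define h where "h n = K / 2 ^ (n + 2)" for n :: nat
  define Y where "Y n = (\<integral>x. max 0 (\<bar>u x\<bar> - \<kappa> n) \<partial>M)" for n
  define B1 where "B1 = 2 * B0"
  define Q where "Q = C * D powr (1 / p) * 4 powr \<theta> * K powr (- \<theta>)"
  have B1: "2 \<le> B1" using T(2) by (simp add: B1_def)
  have Dpos: "0 < D" using par T u(4) by (simp add: D add_nonneg_pos)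
  have \<kappa>_bounds: "0 \<le> \<kappa> n" "\<kappa> n \<le> 2 * K" "1 \<le> h n * 2 ^ (n + 2)" "0 < h n" for n
  proof -
    have "1 / 2 ^ n \<le> (1::real)" by simp
    then have "0 \<le> 2 - 1 / (2::real) ^ n" by linarith
    then show "0 \<le> \<kappa> n" using K(1) unfolding \<kappa>_def by (intro mult_nonneg_nonneg) auto
    show "\<kappa> n \<le> 2 * K" "1 \<le> h n * 2 ^ (n + 2)" "0 < h n"
      using K(1) by (simp_all add: \<kappa>_def h_def right_diff_distrib)
  qed
  have \<kappa>_Suc: "\<kappa> (Suc n) = (\<kappa> n + h n) + h n" for n
    by (simp add: \<kappa>_def h_def field_simps)
  have Y_nonneg: "0 \<le> Y n" for n by (simp add: Y_def)
  note exc = excess_integrable[OF u(2)]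
  have Y_le: "Y n \<le> X" for n
  proof -
    have "Y n \<le> (\<integral>x. \<bar>u x\<bar> \<partial>M)"
      unfolding Y_def using \<kappa>_bounds(1)[of n] by (intro integral_mono exc u(2)) auto
    then show ?thesis using u(3) by simp
  qed
  have step: "Y (Suc n) \<le> Q * B ^ n * Y n powr (1 + \<delta>)" for n
  proof -
    define S where "S = level_set u (\<kappa> n + h n)"
    define \<mu> where "\<mu> = measure M S"
    have Q: "0 \<le> Q * B ^ n * Y n powr (1 + \<delta>)" using par by (simp add: Q_def B)
    have S_meas: "S \<in> sets M" unfolding S_def using u(1) by measurable
    \<comment> \<open>The level estimate requires a level set of positive measure and a positive
      \<open>J\<close>; in the degenerate cases the next excess vanishes.\<close>
    consider "Y n = 0" | "\<mu> = 0" | "0 < Y n" "0 < \<mu>"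
      using Y_nonneg[of n] measure_nonneg[of M S] unfolding \<mu>_def by linarith
    then show ?thesis
    proof cases
      case 1
      have "Y (Suc n) \<le> Y n"
        unfolding Y_def using \<kappa>_bounds(4)[of n] by (intro integral_mono exc) (auto simp: \<kappa>_Suc)
      then show ?thesis using 1 Q by simp
    next
      case 2
      then have "Y (Suc n) = 0"
        unfolding Y_def \<kappa>_Suc \<mu>_def S_def using \<kappa>_bounds(4)[of n] by (intro excess_integral_eq_0[OF u(1)]) auto
      then show ?thesis using Q by simp
    next
      case 3
      \<comment> \<open>All three terms of the energy bound are brought to the form constant * B1^n
        * (Y n)^\<tau>; \<open>D\<close> collects the constants, with 1 added for
        positivity.\<close>
      define J where "J = D * B1 ^ n * Y n powr \<tau>"
      have J: "0 < J" using Dpos B1 3 by (simp add: J_def)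
      have h\<mu>: "h n * \<mu> \<le> Y n"
      proof -
        have "h n * \<mu> = (\<integral>x. h n * indicator S x \<partial>M)"
          unfolding \<mu>_def S_def integrable_level_set(2)[OF u(1)] ..
        also have "\<dots> \<le> Y n"
          unfolding Y_def S_def using \<kappa>_bounds(4)[of n]
          by (intro integral_mono exc integrable_level_set[OF u(1)]) (auto simp: indicator_def)
        finally show ?thesis .
      qed
      then have \<mu>Y: "\<mu> \<le> 4 * 2 ^ n * Y n / K" using K(1) by (simp add: h_def field_simps)
      also have "\<dots> \<le> 4 * 2 ^ n * Y n"
        using K(1) 3 by (simp add: field_simps mult_left_le_one_le)
      finally have \<mu>Y': "\<mu> \<le> 4 * 2 ^ n * Y n" .
      have two_n: "2 ^ n \<le> B1 ^ n" using B1 by (intro power_mono) auto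
      \<comment> \<open>The terms from \<open>u\<close> and from the drift are linear in
        \<open>Y n\<close>; the bound Y n <= X lowers their exponent to that of the \<open>f\<close>
        term.\<close>
      have YX: "Y n \<le> X * Y n powr \<tau>"
      proof -
        have "Y n = Y n powr (1 - \<tau>) * Y n powr \<tau>" using 3 by (simp add: powr_add[symmetric])
        also have "\<dots> \<le> X powr (1 - \<tau>) * Y n powr \<tau>"
          using 3 par Y_le by (intro mult_right_mono powr_mono2) auto
        also have "\<dots> \<le> X powr 1 * Y n powr \<tau>"
          using u(4) par by (intro mult_right_mono powr_mono) auto
        finally show ?thesis using u(4) by simp
      qed
      have F: "F * \<mu> powr \<tau> \<le> 4 * F * (B1 ^ n * Y n powr \<tau>)"
      proof -
        have "\<mu> powr \<tau> \<le> (4 * 2 ^ n * Y n) powr \<tau>" using \<mu>Y' 3 par by (intro powr_mono2) auto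
        also have "\<dots> = (4 * 2 ^ n) powr \<tau> * Y n powr \<tau>" using 3 by (simp add: powr_mult)
        also have "\<dots> \<le> (4 * 2 ^ n) powr 1 * Y n powr \<tau>"
          using par by (intro mult_right_mono powr_mono) (auto simp: mult_ge1_I)
        also have "\<dots> \<le> (4 * B1 ^ n) * Y n powr \<tau>" using two_n by (intro mult_right_mono) auto
        finally have "F * \<mu> powr \<tau> \<le> F * ((4 * B1 ^ n) * Y n powr \<tau>)" using par by (intro mult_left_mono) auto
        then show ?thesis by (simp add: mult_ac)
      qed
      have U: "L * (\<integral>x. indicator S x * \<bar>u x\<bar> \<partial>M) \<le> 16 * L * X * (B1 ^ n * Y n powr \<tau>)"
      proof -
        have "(\<integral>x. indicator S x * \<bar>u x\<bar> \<partial>M) \<le> (\<integral>x. max 0 (\<bar>u x\<bar> - \<kappa> n) + 2 * K * indicator S x \<partial>M)"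
        proof (rule integral_mono)
          show "integrable M (\<lambda>x. indicator S x * \<bar>u x\<bar>)"
            using integrable_mult_indicator[OF S_meas u(2)] by simp
          show "integrable M (\<lambda>x. max 0 (\<bar>u x\<bar> - \<kappa> n) + 2 * K * indicator S x)"
            unfolding S_def by (intro Bochner_Integration.integrable_add exc integrable_level_set[OF u(1)])
          show "indicator S x * \<bar>u x\<bar> \<le> max 0 (\<bar>u x\<bar> - \<kappa> n) + 2 * K * indicator S x" for x
            using \<kappa>_bounds(2)[of n] by (auto simp: indicator_def)
        qed
        also have "\<dots> = Y n + 2 * K * \<mu>"
          unfolding Y_def S_def \<mu>_def
          by (subst Bochner_Integration.integral_add) (use exc integrable_level_set[OF u(1)] in auto)
        \<comment> \<open>The level height K is cancelled by the 1/K in the Chebyshev bound, so no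
          positive power of K enters the recursion.\<close>
        also have "2 * K * \<mu> \<le> 8 * 2 ^ n * Y n" using \<mu>Y K(1) by (simp add: field_simps)
        also have "Y n + 8 * 2 ^ n * Y n \<le> 16 * 2 ^ n * Y n" 
        proof -
          have "1 * Y n \<le> 2 ^ n * Y n" using 3 by (intro mult_right_mono one_le_power) auto
          then show ?thesis unfolding mult.assoc using 3 by linarith
        qed
        also have "\<dots> \<le> 16 * B1 ^ n * (X * Y n powr \<tau>)"
          using two_n YX 3 B1 by (intro mult_mono) auto
        finally have "L * (\<integral>x. indicator S x * \<bar>u x\<bar> \<partial>M) \<le> L * (16 * B1 ^ n * (X * Y n powr \<tau>))"
          using par by (intro mult_left_mono) auto
        then show ?thesis by (simp add: mult_ac)
      qed
      have TT: "T (h n) * \<mu> \<le> T0 * B1\<^sup>2 * X * (B1 ^ n * Y n powr \<tau>)"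
      proof -
        have "T (h n) * \<mu> \<le> (T0 * B0 ^ (n + 2)) * (4 * 2 ^ n * Y n)"
          using T(3)[OF \<kappa>_bounds(3)[of n]] \<mu>Y' 3 T by (intro mult_mono) auto
        also have "\<dots> = T0 * B1 ^ (n + 2) * Y n" by (simp add: B1_def power_add power_mult_distrib)
        also have "\<dots> \<le> T0 * B1 ^ (n + 2) * (X * Y n powr \<tau>)"
          using YX T B1 by (intro mult_left_mono) auto
        finally show ?thesis by (simp add: power_add power2_eq_square mult_ac)
      qed
      have "0 \<le> B1 ^ n * Y n powr \<tau>" using B1 by simp
      then have "2 * (F * \<mu> powr \<tau> + L * (\<integral>x. indicator S x * \<bar>u x\<bar> \<partial>M) + T (h n) * \<mu>) \<le> J"
        using F U TT unfolding J_def D B1_def[symmetric] by (simp add: algebra_simps)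
      then have "Y (Suc n) \<le> C * \<mu> powr \<theta> * J powr (1 / p)"
        unfolding Y_def \<kappa>_Suc \<mu>_def S_def
        using 3(2) J \<kappa>_bounds(1,4)[of n] by (intro level) (auto simp: \<mu>_def S_def)
      also have "\<dots> \<le> C * (4 * 2 ^ n * Y n / K) powr \<theta> * J powr (1 / p)"
        using \<mu>Y 3 par by (intro mult_right_mono mult_left_mono powr_mono2) auto
      also have "(4 * 2 ^ n * Y n / K) powr \<theta> = 4 powr \<theta> * (2 powr \<theta>) ^ n * Y n powr \<theta> * K powr (- \<theta>)"
      proof -
        have "(4 * 2 ^ n * Y n / K) powr \<theta> = (4 * 2 ^ n * Y n) powr \<theta> / K powr \<theta>"
          by (rule powr_divide)
        then show ?thesis using 3 by (simp add: powr_mult power_powr powr_minus_divide)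
      qed
      also have "J powr (1 / p) = D powr (1 / p) * (B1 powr (1 / p)) ^ n * Y n powr (\<tau> / p)"
        using Dpos B1 3 by (simp add: J_def powr_mult power_powr powr_powr)
      also have "C * (4 powr \<theta> * (2 powr \<theta>) ^ n * Y n powr \<theta> * K powr (- \<theta>)) *
          (D powr (1 / p) * (B1 powr (1 / p)) ^ n * Y n powr (\<tau> / p))
          = Q * B ^ n * (Y n powr \<theta> * Y n powr (\<tau> / p))"
        by (simp add: Q_def B B1_def[symmetric] power_mult_distrib)
      also have "Y n powr \<theta> * Y n powr (\<tau> / p) = Y n powr (1 + \<delta>)"
        using par(5) by (simp add: powr_add[symmetric])
      finally show ?thesis .
    qed
  qed
  have "1 < B"
  proof -
    have "1 < (2::real) powr \<theta>" using par(2) by simp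
    moreover have "1 \<le> (2 * B0) powr (1 / p)" using T(2) par(1) by (intro ge_one_powr_ge_zero) auto
    ultimately have "1 * 1 < 2 powr \<theta> * (2 * B0) powr (1 / p)"
      by (intro mult_less_le_imp_less) auto
    then show ?thesis by (simp add: B)
  qed
  have "Y \<longlonglongrightarrow> 0"
    by (rule de_giorgi_sequence[OF Y_nonneg Y_le _ step \<open>1 < B\<close> par(6)]) (use u(4) par K(2) in \<open>auto simp: Q_def\<close>)
  moreover have "(\<integral>x. max 0 (\<bar>u x\<bar> - 2 * K) \<partial>M) \<le> Y n" for n
    unfolding Y_def using \<kappa>_bounds(2)[of n] by (intro integral_mono exc) auto
  ultimately have "(\<integral>x. max 0 (\<bar>u x\<bar> - 2 * K) \<partial>M) \<le> 0"
    by (intro LIMSEQ_le_const) auto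
  then have "(\<integral>x. max 0 (\<bar>u x\<bar> - 2 * K) \<partial>M) = 0" by (simp add: antisym)
  then have "AE x in M. max 0 (\<bar>u x\<bar> - 2 * K) = 0"
    by (subst (asm) integral_nonneg_eq_0_iff_AE[OF exc]) auto
  then show ?thesis by eventually_elim (simp add: max_def split: if_splits)
qed

end

subsection \<open>The boundedness theorem\<close>

text \<open>Hoelder's inequality up to a factor 2, by \<open>powr_le_add_powr\<close> with the
  balancing threshold s = F mu^(-1/q). Adding 1 to the norm keeps this threshold positive when
  \<open>f\<close> vanishes.\<close>

lemma (in finite_measure) integral_indicator_le_Lp:
  fixes f :: "'a \<Rightarrow> real"
  assumes f: "f \<in> borel_measurable M" "integrable M (\<lambda>x. \<bar>f x\<bar> powr q)" "1 \<le> q"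
    and S: "S \<in> sets M" "0 < measure M S"
  shows "(\<integral>x. indicator S x * \<bar>f x\<bar> \<partial>M) \<le> 2 * ((\<integral>x. \<bar>f x\<bar> powr q \<partial>M) powr (1 / q) + 1) * measure M S powr (1 - 1 / q)"
proof -
  define I where "I = (\<integral>x. \<bar>f x\<bar> powr q \<partial>M)"
  define F where "F = I powr (1 / q) + 1"
  define \<mu> where "\<mu> = measure M S"
  have I: "0 \<le> I" by (simp add: I_def)
  have F: "0 < F" by (simp add: F_def add_nonneg_pos)
  have \<mu>: "0 < \<mu>" using S by (simp add: \<mu>_def)
  have IF: "I \<le> F powr q"
  proof -
    have "I = (I powr (1 / q)) powr q" using I f(3) by (simp add: powr_powr)
    also have "\<dots> \<le> F powr q" using f(3) by (intro powr_mono2) (auto simp: F_def)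
    finally show ?thesis .
  qed
  define s where "s = F * \<mu> powr (- (1 / q))"
  have s: "0 < s" using F \<mu> by (simp add: s_def)
  have f1: "integrable M (\<lambda>x. \<bar>f x\<bar>)"
    using integrable_powr_le[OF _ _ f(2), of 1] f by simp
  have S_int: "integrable M (\<lambda>x. s * indicator S x :: real)"
    using S by (intro integrable_mult_right integrable_real_indicator) (simp_all add: less_top[symmetric])
  have "(\<integral>x. indicator S x * \<bar>f x\<bar> \<partial>M) \<le> (\<integral>x. s * indicator S x + s powr (1 - q) * \<bar>f x\<bar> powr q \<partial>M)"
  proof (rule integral_mono)
    show "integrable M (\<lambda>x. indicator S x * \<bar>f x\<bar>)" using integrable_mult_indicator[OF S(1) f1] by simp
    show "integrable M (\<lambda>x. s * indicator S x + s powr (1 - q) * \<bar>f x\<bar> powr q)"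
      by (intro Bochner_Integration.integrable_add S_int integrable_mult_right f(2))
    show "indicator S x * \<bar>f x\<bar> \<le> s * indicator S x + s powr (1 - q) * \<bar>f x\<bar> powr q" for x
      using powr_le_add_powr[of s "\<bar>f x\<bar>" 1 q] s f(3) by (auto simp: indicator_def)
  qed
  also have "\<dots> = s * \<mu> + s powr (1 - q) * I"
    using sets.Int_space_eq2[OF S(1)]
    by (subst Bochner_Integration.integral_add[OF S_int integrable_mult_right[OF f(2)]]) (simp add: \<mu>_def I_def)
  also have "\<dots> \<le> s * \<mu> + s powr (1 - q) * F powr q"
    using IF by (intro add_left_mono mult_left_mono) auto
  also have "s * \<mu> = F * \<mu> powr (1 - 1 / q)"
  proof -
    have "\<mu> powr (- (1 / q)) * \<mu> = \<mu> powr (1 - 1 / q)" using powr_add[of \<mu> "- (1 / q)" 1] \<mu> by simp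
    then show ?thesis by (simp add: s_def mult.assoc)
  qed
  also have "s powr (1 - q) * F powr q = F * \<mu> powr (1 - 1 / q)"
  proof -
    have "s powr (1 - q) = F powr (1 - q) * \<mu> powr (- (1 / q) * (1 - q))"
      unfolding s_def using F \<mu> by (simp add: powr_mult powr_powr)
    moreover have "- (1 / q) * (1 - q) = 1 - 1 / q" using f(3) by (simp add: field_simps)
    moreover have "F powr (1 - q) * F powr q = F" using F by (simp add: powr_add[symmetric])
    ultimately show ?thesis by (metis mult.assoc mult.commute)
  qed
  finally show ?thesis by (simp add: F_def I_def \<mu>_def algebra_simps)
qed

text \<open>Since 1/h <= 2^j and the largest power of 1/h that occurs is p/(p-2), layers shrinking
  geometrically make the constant grow at most at the rate 2^(p/(p-2)).\<close>

lemma drift_const_le: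
  assumes "2 < p" "0 < \<beta>" "1 \<le> h * 2 ^ j"
  defines "m0 \<equiv> \<beta> * (4 / (1 - 2 / p)\<^sup>2)" and "r \<equiv> p / (p - 2)"
  shows "drift_const \<beta> p h \<le> (m0 + (4 * m0) powr r) * (2 powr r) ^ j"
proof -
  have m0: "0 \<le> m0" using assms by (simp add: m0_def)
  have r: "1 \<le> r" using assms by (simp add: r_def)
  have h: "0 < h" using assms(3) by (smt (verit) mult_nonpos_nonneg zero_le_power)
  then have inv: "1 / h \<le> 2 ^ j" using assms(3) by (simp add: field_simps)
  have two: "(2::real) \<le> 2 powr r" using powr_mono[of 1 r 2] r by simp
  have "drift_const \<beta> p h = m0 * (1 / h) + (4 * m0 * (1 / h)) powr r"
    by (simp add: drift_const_def m0_def r_def)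
  also have "\<dots> \<le> m0 * 2 ^ j + (4 * m0 * 2 ^ j) powr r"
    using inv m0 h r by (intro add_mono mult_left_mono powr_mono2) auto
  also have "(4 * m0 * 2 ^ j) powr r = (4 * m0) powr r * (2 powr r) ^ j"
    by (simp add: powr_mult power_powr)
  also have "m0 * 2 ^ j \<le> m0 * (2 powr r) ^ j"
    using m0 two by (intro mult_left_mono power_mono) auto
  finally show ?thesis by (simp add: distrib_right)
qed

text \<open>The quantifier order expresses the uniformity: \<open>K\<close> is chosen from numbers
  alone, with \<open>F\<close> and \<open>m\<close> the prescribed norm of \<open>f\<close> and
  measure of the domain, before the domain, the coefficients and the solution appear.\<close>

lemma bounded_subsolutions:
  fixes \<beta> p lam F m :: real and q :: ereal
  shows "\<exists>K\<ge>0. \<forall>(\<Omega> :: (real ^ 'n) set) a f u Du.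
      open \<Omega> \<and> bounded \<Omega> \<and> caratheodory \<Omega> a \<and> \<beta> > 0 \<and>
      (AE x in lebesgue_on \<Omega>. \<forall>s \<xi>. norm (a x s \<xi>) \<le> \<beta> * (1 + norm \<xi>)) \<and>
      p > 2 \<and> q \<ge> 1 \<and> q > ereal (real CARD('n) / p) \<and>
      f \<in> Lp_space (lebesgue_on \<Omega>) q \<and> u \<in> sobolev_W01 \<Omega> p \<and> has_weak_gradient \<Omega> u Du \<and>
      distributional_subsolution \<Omega> a lam p f u Du \<and>
      Lp_norm (lebesgue_on \<Omega>) q f = F \<and> measure lebesgue \<Omega> = m
      \<longrightarrow> (AE x in lebesgue_on \<Omega>. \<bar>u x\<bar> \<le> K)"
proof (cases "\<beta> > 0 \<and> p > 2 \<and> q \<ge> 1 \<and> q > ereal (real CARD('n) / p) \<and> 0 \<le> m")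
  case False
  \<comment> \<open>No data satisfy the hypotheses for such parameters; in particular a measure is
    never a negative \<open>m\<close>.\<close>
  then show ?thesis by (intro exI[of _ 0]) auto
next
  case True
  then have par: "\<beta> > 0" "p > 2" "q \<ge> 1" "q > ereal (real CARD('n) / p)" "0 \<le> m" by auto
  let ?N = "real CARD('n)"
  have N: "1 \<le> ?N" by (simp add: Suc_leI)
  text \<open>For \<open>q = \<infinity>\<close> any finite exponent above \<open>N / p\<close> does.\<close>
  define r where "r = (if q = \<infinity> then ?N + 1 else real_of_ereal q)"
  \<comment> \<open>The constant in the bound of the integral of |f| over S by F' |S|^(1 - 1/r). For
    a bounded \<open>f\<close> it results from F |S| = F |S|^(1/r) |S|^(1 - 1/r) and |S| <= m;
    otherwise it is that of \<open>integral_indicator_le_Lp\<close>.\<close>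
  define F' where "F' = (if q = \<infinity> then \<bar>F\<bar> * m powr (1 / r) else 2 * (F + 1))"
  have r: "1 \<le> r" "?N < p * r"
  proof -
    have "1 \<le> r \<and> ?N < p * r"
    proof (cases q)
      case (real x)
      then show ?thesis using par by (simp add: r_def field_simps one_ereal_def)
    next
      case PInf
      have "1 * ?N < p * (?N + 1)" using par N by (intro mult_strict_mono') auto
      with PInf show ?thesis using N by (simp add: r_def mult.commute)
    qed (use par in auto)
    then show "1 \<le> r" "?N < p * r" by auto
  qed
  \<comment> \<open>\<open>\<tau>\<close> is the power of the measure contributed by
    \<open>f\<close>, \<open>\<theta>\<close> the one in \<open>level_estimate\<close>. They satisfy
    \<theta> + \<tau>/p = 1 + \<delta>, and \<delta> > 0 is equivalent to N < p r.\<close>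
  define \<tau> where "\<tau> = 1 - 1 / r"
  define \<theta> where "\<theta> = 1 / ?N + 1 - 1 / p"
  define \<delta> where "\<delta> = 1 / ?N - 1 / (p * r)"
  define C where "C = 8 * exp 1 * ?N * (1 + 1 / (1 - 1 / p))"
  define m0 where "m0 = \<beta> * (4 / (1 - 2 / p)\<^sup>2)"
  define T0 where "T0 = m0 + (4 * m0) powr (p / (p - 2))"
  define B0 where "B0 = 2 powr (p / (p - 2))"
  define L where "L = \<bar>lam\<bar>"
  define F0 where "F0 = max 0 F'"
  define T1 where "T1 = drift_const \<beta> p 1"
  \<comment> \<open>The L^1 bound obtained from level 0 and width 1, raised to at least 1 as the
    iteration assumes.\<close>
  define X where "X = max 1 (2 * m + (2 * (F0 * m powr \<tau> + T1 * m) + 1) + (C * m powr \<theta>)\<^sup>2 * (2 * L + 1))"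
  define D where "D = 2 * (4 * F0 + 16 * L * X + T0 * (2 * B0)\<^sup>2 * X) + 1"
  define B where "B = 2 powr \<theta> * (2 * B0) powr (1 / p)"
  define Q where "Q = C * D powr (1 / p) * 4 powr \<theta> * X powr \<delta>"
  \<comment> \<open>The least K >= 1 for which the smallness condition Q K^(-\<theta>) <=
    B^(-1/\<delta>) of the iteration holds.\<close>
  define K where "K = max 1 ((Q * B powr (1 / \<delta>)) powr (1 / \<theta>))"
  have \<tau>: "0 \<le> \<tau>" "\<tau> \<le> 1" using r(1) by (auto simp: \<tau>_def)
  have \<theta>: "0 < \<theta>"
  proof -
    have "1 / p < 1" "0 < 1 / ?N" using par(2) N by simp_all
    then show ?thesis unfolding \<theta>_def by linarith
  qed
  have \<delta>: "0 < \<delta>" using r par(2) N by (simp add: \<delta>_def field_simps)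
  have \<theta>\<tau>: "\<theta> + \<tau> / p = 1 + \<delta>" using r(1) par(2) by (simp add: \<theta>_def \<tau>_def \<delta>_def field_simps)
  have C: "0 \<le> C" using par(2) by (simp add: C_def)
  have m0: "0 \<le> m0" using par by (simp add: m0_def)
  have T0: "0 \<le> T0" using m0 by (simp add: T0_def)
  have B0: "1 \<le> B0" unfolding B0_def using par(2) by (intro ge_one_powr_ge_zero) auto
  have L: "0 \<le> L" by (simp add: L_def)
  have F0: "0 \<le> F0" by (simp add: F0_def)
  have T1: "0 \<le> T1" using par by (simp add: T1_def drift_const_def)
  have X: "1 \<le> X" by (simp add: X_def)
  have D: "0 < D" using F0 L X T0 by (simp add: D_def add_nonneg_pos)
  have Bpos: "0 < B" using B0 by (simp add: B_def)
  have Q0: "0 \<le> Q" using C by (simp add: Q_def)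
  have K: "1 \<le> K" by (simp add: K_def)
  have KQ: "C * D powr (1 / p) * 4 powr \<theta> * K powr (- \<theta>) * X powr \<delta> \<le> B powr (- 1 / \<delta>)"
  proof -
    have "Q * B powr (1 / \<delta>) = ((Q * B powr (1 / \<delta>)) powr (1 / \<theta>)) powr \<theta>"
      using Q0 \<theta> by (simp add: powr_powr)
    also have "\<dots> \<le> K powr \<theta>" using \<theta> by (intro powr_mono2) (auto simp: K_def)
    finally have "Q * B powr (1 / \<delta>) \<le> K powr \<theta>" .
    then have "Q / K powr \<theta> \<le> 1 / B powr (1 / \<delta>)" using K Bpos by (simp add: field_simps)
    then show ?thesis by (simp add: Q_def powr_minus_divide mult_ac)
  qed
  show ?thesis
  proof (intro exI[of _ "2 * K"] conjI allI impI; (elim conjE)?)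
    show "0 \<le> 2 * K" using K by simp
    fix \<Omega> :: "(real ^ 'n) set" and a :: "real ^ 'n \<Rightarrow> real \<Rightarrow> real ^ 'n \<Rightarrow> real ^ 'n"
      and f u :: "real ^ 'n \<Rightarrow> real" and Du :: "real ^ 'n \<Rightarrow> real ^ 'n"
    assume \<Omega>: "open \<Omega>" "bounded \<Omega>" and cara: "caratheodory \<Omega> a"
      and growth: "AE x in lebesgue_on \<Omega>. \<forall>s \<xi>. norm (a x s \<xi>) \<le> \<beta> * (1 + norm \<xi>)"
      and f: "f \<in> Lp_space (lebesgue_on \<Omega>) q" and u: "u \<in> sobolev_W01 \<Omega> p" "has_weak_gradient \<Omega> u Du"
      and sub: "distributional_subsolution \<Omega> a lam p f u Du"
      and F: "Lp_norm (lebesgue_on \<Omega>) q f = F" and m: "measure lebesgue \<Omega> = m"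
    note approx = sobolev_W01_approximation[OF \<Omega> par(2) u]
    obtain \<phi> where \<phi>: "\<And>k. \<phi> k \<in> test_functions \<Omega>" "AE x in lebesgue_on \<Omega>. (\<lambda>k. \<phi> k x) \<longlonglongrightarrow> u x"
      "\<And>k. integrable (lebesgue_on \<Omega>) (\<lambda>x. norm (grad (\<phi> k) x - Du x) powr p)"
      "(\<lambda>k. \<integral>x. norm (grad (\<phi> k) x - Du x) powr p \<partial>lebesgue_on \<Omega>) \<longlonglongrightarrow> 0"
      using approx(5) by blast
    interpret W01_approximation \<Omega> p u Du \<phi>
      by unfold_locales (fact \<Omega> par(2) approx(1-4) \<phi>)+
    have f_meas: "f \<in> borel_measurable M" using f by (simp add: Lp_space_def)
    have m_space: "measure M (space M) = m"
      using \<Omega>_sets m by (simp add: measure_restrict_space)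
    have f_int_le: "integrable M f \<and>
        (\<forall>S\<in>sets M. 0 < measure M S \<longrightarrow> (\<integral>x. indicator S x * \<bar>f x\<bar> \<partial>M) \<le> F0 * measure M S powr \<tau>)"
    proof (cases "q = \<infinity>")
      case True
      define e where "e = esssup M (\<lambda>x. ereal (norm (f x)))"
      have e: "e < \<infinity>" using f True by (simp add: Lp_space_def e_def)
      have Fe: "F = real_of_ereal e" using F True by (simp add: Lp_norm_def e_def)
      have "AE x in M. ereal (norm (f x)) \<le> e" unfolding e_def by (rule esssup_AE)
      then have bound: "AE x in M. \<bar>f x\<bar> \<le> F"
      proof eventually_elim
        case (elim x)
        then show ?case unfolding Fe using e by (cases e) auto
      qed
      have f_int: "integrable M f" using bound f_meas by (intro integrable_const_bound) auto
      moreover have "(\<integral>x. indicator S x * \<bar>f x\<bar> \<partial>M) \<le> F0 * measure M S powr \<tau>"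
        if S: "S \<in> sets M" "0 < measure M S" for S
      proof -
        have "(\<integral>x. indicator S x * \<bar>f x\<bar> \<partial>M) \<le> (\<integral>x. F * indicator S x \<partial>M)"
        proof (rule integral_mono_AE)
          show "integrable M (\<lambda>x. indicator S x * \<bar>f x\<bar>)"
            using integrable_mult_indicator[OF S(1) integrable_abs[OF f_int]] by simp
          show "integrable M (\<lambda>x. F * indicator S x)"
            using S by (intro integrable_mult_right integrable_real_indicator) (simp_all add: less_top[symmetric])
          show "AE x in M. indicator S x * \<bar>f x\<bar> \<le> F * indicator S x"
            using bound by eventually_elim (auto simp: indicator_def)
        qed
        also have "\<dots> = F * measure M S" using sets.Int_space_eq2[OF S(1)] by simp
        also have "\<dots> = F * measure M S powr (1 / r) * measure M S powr \<tau>"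
          using S(2) by (simp add: powr_add[symmetric] \<tau>_def mult.assoc)
        also have "\<dots> \<le> F0 * measure M S powr \<tau>"
        proof (rule mult_right_mono)
          have "measure M S \<le> m" unfolding m_space[symmetric] using S(1)
            by (intro finite_measure_mono sets.top sets.sets_into_space)
          then have "F * measure M S powr (1 / r) \<le> \<bar>F\<bar> * m powr (1 / r)"
            using S(2) r(1) by (intro mult_mono powr_mono2) auto
          then show "F * measure M S powr (1 / r) \<le> F0" using True by (simp add: F0_def F'_def)
        qed simp
        finally show ?thesis .
      qed
      ultimately show ?thesis by blast
    next
      case False
      then have q: "q = ereal r" using par(3) by (cases q) (auto simp: r_def)
      have f_pow: "integrable M (\<lambda>x. \<bar>f x\<bar> powr r)" using f q by (simp add: Lp_space_def)
      have FI: "F = (\<integral>x. \<bar>f x\<bar> powr r \<partial>M) powr (1 / r)" using F q by (simp add: Lp_norm_def)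
      have F0_eq: "F0 = 2 * ((\<integral>x. \<bar>f x\<bar> powr r \<partial>M) powr (1 / r) + 1)"
        using False by (simp add: F0_def F'_def FI)
      have "integrable M (\<lambda>x. \<bar>f x\<bar>)"
        using integrable_powr_le[OF _ _ f_pow, of 1] f_meas r(1) by simp
      then have "integrable M f" using f_meas by (simp add: integrable_abs_iff)
      then show ?thesis
        using integral_indicator_le_Lp[OF f_meas f_pow r(1)] unfolding F0_eq \<tau>_def by blast
    qed
    have A_bound: "AE x in M. norm (a x (u x) (Du x)) \<le> \<beta> * (1 + norm (Du x))"
      using growth by eventually_elim blast
    interpret W01_subsolution \<Omega> p u Du \<phi> "\<lambda>x. a x (u x) (Du x)" f \<beta> lam
    proof unfold_locales
      show "(\<lambda>x. a x (u x) (Du x)) \<in> borel_measurable M"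
        by (rule caratheodory_measurable[OF cara \<Omega>_sets u_measurable Du_measurable])
      show "integrable M f" using f_int_le by blast
      fix \<psi> assume "\<psi> \<in> test_functions \<Omega>" "\<And>x. 0 \<le> \<psi> x"
      then show "(\<integral>x. a x (u x) (Du x) \<bullet> grad \<psi> x \<partial>M) + lam * (\<integral>x. u x * \<psi> x \<partial>M) +
          (\<integral>x. norm (Du x) powr p * \<psi> x \<partial>M) \<le> (\<integral>x. f x * \<psi> x \<partial>M)"
        using sub unfolding distributional_subsolution_def by blast
    qed (fact A_bound par(1))+
    have S_eq: "level_set u k = superlevel k" for k by (auto simp: superlevel_def)
    have level: "(\<integral>x. max 0 (\<bar>u x\<bar> - (k + h)) \<partial>M) \<le> C * measure M (level_set u k) powr \<theta> * J powr (1 / p)"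
      if "0 \<le> k" "0 < h" "0 < measure M (level_set u k)" "0 < J"
        "2 * (F0 * measure M (level_set u k) powr \<tau> + L * (\<integral>x. indicator (level_set u k) x * \<bar>u x\<bar> \<partial>M)
          + drift_const \<beta> p h * measure M (level_set u k)) \<le> J" for k h J
    proof -
      have mono: "2 * (s + t + v) \<le> J" if "s \<le> w" "2 * (w + t + v) \<le> J" for s t v w :: real
        using that by (simp add: algebra_simps)
      have f_le: "(\<integral>x. indicator (superlevel k) x * \<bar>f x\<bar> \<partial>M) \<le> F0 * measure M (superlevel k) powr \<tau>"
        using f_int_le superlevel_sets that(3) unfolding S_eq by blast
      have "2 * ((\<integral>x. indicator (superlevel k) x * \<bar>f x\<bar> \<partial>M) + \<bar>lam\<bar> * (\<integral>x. indicator (superlevel k) x * \<bar>u x\<bar> \<partial>M)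
          + drift_const \<beta> p h * measure M (superlevel k)) \<le> J"
        by (rule mono[OF f_le that(5)[unfolded S_eq L_def]])
      from level_estimate[OF that(1,2) that(3)[unfolded S_eq] that(4) this]
      show ?thesis unfolding S_eq C_def \<theta>_def .
    qed
    have "(\<integral>x. \<bar>u x\<bar> \<partial>M) \<le> 2 * measure M (space M) + (2 * (F0 * measure M (space M) powr \<tau> + T1 * measure M (space M)) + 1)
        + (C * measure M (space M) powr \<theta>)\<^sup>2 * (2 * L + 1)"
    proof (rule L1_bound_of_level_estimate[OF u_measurable u_integrable])
      fix J assume "0 < measure M (level_set u 0)" "0 < J"
        "2 * (F0 * measure M (level_set u 0) powr \<tau> + L * (\<integral>x. indicator (level_set u 0) x * \<bar>u x\<bar> \<partial>M)
          + T1 * measure M (level_set u 0)) \<le> J"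
      from level[OF order_refl zero_less_one this[unfolded T1_def]]
      show "(\<integral>x. max 0 (\<bar>u x\<bar> - 1) \<partial>M) \<le> C * measure M (level_set u 0) powr \<theta> * J powr (1 / p)"
        unfolding add_0 .
    qed (use par \<theta> \<tau> C F0 L T1 in auto)
    then have uX: "(\<integral>x. \<bar>u x\<bar> \<partial>M) \<le> X" unfolding m_space X_def by simp
    show "AE x in lebesgue_on \<Omega>. \<bar>u x\<bar> \<le> 2 * K"
    proof (rule bounded_of_level_estimate[OF u_measurable u_integrable uX X _ \<theta> \<tau> \<theta>\<tau> \<delta> C F0 L T0 B0 _ level D_def B_def K KQ])
      show "0 < p" using par(2) by simp
      show "drift_const \<beta> p h \<le> T0 * B0 ^ j" if "1 \<le> h * 2 ^ j" for h j
        using drift_const_le[OF par(2,1) that] unfolding T0_def B0_def m0_def .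
    qed
  qed
qed

theorem theorem5p2:
  shows "\<exists>C :: real \<Rightarrow> real \<Rightarrow> nat \<Rightarrow> ereal \<Rightarrow> real \<Rightarrow> real \<Rightarrow> real \<Rightarrow> real.
    \<forall>(\<Omega> :: (real ^ 'n) set) (a :: real ^ 'n \<Rightarrow> real \<Rightarrow> real ^ 'n \<Rightarrow> real ^ 'n)
      (\<beta> :: real) (p :: real) (q :: ereal) (lam :: real)
      (f :: real ^ 'n \<Rightarrow> real) (u :: real ^ 'n \<Rightarrow> real) (Du :: real ^ 'n \<Rightarrow> real ^ 'n).
      open \<Omega> \<and> bounded \<Omega> \<and>
      caratheodory \<Omega> a \<and>
      \<beta> > 0 \<and>
      (AE x in lebesgue_on \<Omega>. \<forall>s \<xi>. norm (a x s \<xi>) \<le> \<beta> * (1 + norm \<xi>)) \<and>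
      p > 2 \<and>
      q \<ge> 1 \<and> q > ereal (real CARD('n) / p) \<and>
      f \<in> Lp_space (lebesgue_on \<Omega>) q \<and>
      u \<in> sobolev_W01 \<Omega> p \<and> has_weak_gradient \<Omega> u Du \<and>
      distributional_subsolution \<Omega> a lam p f u Du
      \<longrightarrow>
      u \<in> Lp_space (lebesgue_on \<Omega>) \<infinity> \<and>
      Lp_norm (lebesgue_on \<Omega>) \<infinity> u
        \<le> C \<beta> p CARD('n) q lam (Lp_norm (lebesgue_on \<Omega>) q f) (measure lebesgue \<Omega>)"
proof -
  \<comment> \<open>\<open>P\<close> quantifies over all domains, coefficients and solutions with
    the given numerical data, so a choice of \<open>K\<close> from \<open>P\<close> is a function of
    these numbers alone.\<close>
  define P where "P \<beta> p q lam F m K \<longleftrightarrow> 0 \<le> K \<and> (\<forall>(\<Omega> :: (real ^ 'n) set) a f u Du.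
      open \<Omega> \<and> bounded \<Omega> \<and> caratheodory \<Omega> a \<and> \<beta> > 0 \<and>
      (AE x in lebesgue_on \<Omega>. \<forall>s \<xi>. norm (a x s \<xi>) \<le> \<beta> * (1 + norm \<xi>)) \<and>
      p > 2 \<and> q \<ge> 1 \<and> q > ereal (real CARD('n) / p) \<and>
      f \<in> Lp_space (lebesgue_on \<Omega>) q \<and> u \<in> sobolev_W01 \<Omega> p \<and> has_weak_gradient \<Omega> u Du \<and>
      distributional_subsolution \<Omega> a lam p f u Du \<and>
      Lp_norm (lebesgue_on \<Omega>) q f = F \<and> measure lebesgue \<Omega> = m
      \<longrightarrow> (AE x in lebesgue_on \<Omega>. \<bar>u x\<bar> \<le> K))" for \<beta> p q lam F m K
  define C where "C \<beta> p (N :: nat) q lam F m = (SOME K. P \<beta> p q lam F m K)" for \<beta> p N q lam F m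
  have C: "P \<beta> p q lam F m (C \<beta> p N q lam F m)" for \<beta> p N q lam F m
  proof -
    have "\<exists>K. P \<beta> p q lam F m K" unfolding P_def using bounded_subsolutions[where 'n = 'n] by blast
    then show ?thesis unfolding C_def by (rule someI_ex)
  qed
  show ?thesis
  proof (intro exI[of _ C] allI impI)
    fix \<Omega> :: "(real ^ 'n) set" and a :: "real ^ 'n \<Rightarrow> real \<Rightarrow> real ^ 'n \<Rightarrow> real ^ 'n"
      and \<beta> p :: real and q :: ereal and lam :: real
      and f u :: "real ^ 'n \<Rightarrow> real" and Du :: "real ^ 'n \<Rightarrow> real ^ 'n"
    assume hyp: "open \<Omega> \<and> bounded \<Omega> \<and>
      caratheodory \<Omega> a \<and>
      \<beta> > 0 \<and>
      (AE x in lebesgue_on \<Omega>. \<forall>s \<xi>. norm (a x s \<xi>) \<le> \<beta> * (1 + norm \<xi>)) \<and>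
      p > 2 \<and>
      q \<ge> 1 \<and> q > ereal (real CARD('n) / p) \<and>
      f \<in> Lp_space (lebesgue_on \<Omega>) q \<and>
      u \<in> sobolev_W01 \<Omega> p \<and> has_weak_gradient \<Omega> u Du \<and>
      distributional_subsolution \<Omega> a lam p f u Du"
    let ?M = "lebesgue_on \<Omega>"
    let ?K = "C \<beta> p CARD('n) q lam (Lp_norm ?M q f) (measure lebesgue \<Omega>)"
    have K: "0 \<le> ?K" and ae: "AE x in ?M. \<bar>u x\<bar> \<le> ?K"
      using C[of \<beta> p q lam "Lp_norm ?M q f" "measure lebesgue \<Omega>" "CARD('n)"] hyp unfolding P_def by blast+
    have u: "u \<in> borel_measurable ?M"
      using hyp by (simp add: sobolev_W01_def Lp_space_def)
    have le: "esssup ?M (\<lambda>x. ereal (norm (u x))) \<le> ereal ?K"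
      using u ae by (intro esssup_I) auto
    then have "u \<in> Lp_space ?M \<infinity>"
      using u by (auto simp: Lp_space_def)
    moreover have "Lp_norm ?M \<infinity> u \<le> ?K"
      using le K by (cases "esssup ?M (\<lambda>x. ereal (norm (u x)))") (auto simp: Lp_norm_def)
    ultimately show "u \<in> Lp_space ?M \<infinity> \<and> Lp_norm ?M \<infinity> u \<le> ?K" by blast
  qed
qed

end
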